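(* Let $K$ be the matrix defined in the context, let $M_A$, $\widehat S$, $\widehat M_S$ be symmetric positive definite, and let $\underline\mu,\bar\mu,\underline\nu,\bar\nu,\underline\tau,\bar\tau,\underline\omega,\bar\omega$, $\underline\vartheta,\bar\vartheta$, $\underline\delta,\bar\delta$, $\xi_1,\dots,\xi_4$ and the functions $g_1,g_2,\varrho,\underline h,\bar h$ be as defined in the context. Assume $0<\bar\mu\le2$, $0<\bar\nu\le2$ and $0<\bar\mu\bar\nu<2$. Then for each $*\in\{d,ut,lt,f_1,f_2,f_3,f_4,f_5\}$, any eigenvalue $\lambda_*$ of $M_*^{-1}K$ satisfies $$\underline\eta_*\le\mathrm{Re}(\lambda_* )\le\bar\eta_*,\qquad|\mathrm{Im}(\lambda_* )|\le\rho_*,$$ where $\underline\eta_*$, $\bar\eta_*$ and $\rho_*\ge0$ are as follows. Write $N=M_A^{-1}A$. 1. $*=d$: $\underline\eta_*=0$, $\bar\eta_*=\max\{\bar\mu,\bar\tau\}$, $\rho_*^2=\bar\omega+\bar\nu\bar\mu$. 2. $*\in\{ut,lt\}$: - if $\bar\mu\le1$: $\underline\eta_*=\min\{\underline\mu,\underline\tau,\underline\mu\,\underline\nu\}$, $\bar\eta_*=\max\{\bar\mu,\bar\tau,\bar\mu\bar\nu\}$, $\rho_*^2=\bar\omega+\bar\nu\lambda_{\max}(N(I-N))$; - if $\underline\mu\ge1$: $\underline\eta_*=\min\{\underline\mu g_1(\xi_1),\underline\nu g_1(\xi_1),\underline\tau\}$, $\bar\eta_*=\max\{\bar\mu g_2(\xi_1),\bar\nu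 g_2(\xi_1),\bar\tau\}$, $\rho_*^2=\bar\omega$; - if $\underline\mu<1<\bar\mu$: $\underline\eta_*=\min\{\underline\mu,\underline\tau,g_1(\xi_1),\underline\mu\,\underline\nu g_1(\xi_1)\}$, $\bar\eta_*=\max\{\bar\tau,\bar\mu g_2(\xi_1),\bar\nu g_2(\xi_1)\}$, $\rho_*^2=\bar\omega+\bar\nu\lambda_{\max}(N(I-N))$. 3. $*=f_1$: $\underline\eta_*=\min\{\underline\mu,\underline\tau,\underline\delta\,\underline\nu\}$, $\bar\eta_*=\max\{\bar\mu,\bar\tau,\bar\delta\bar\nu\}$, $\rho_*^2=\bar\omega+\bar\nu\lambda_{\max}((I-N)^2N)$. 4. $*=f_2$: $\underline\eta_*=0$, $\bar\eta_*=\max\{\bar\mu,\bar h(\bar\nu)+\bar\omega(1-\underline\nu)\}g_2(\xi_2)$, $\rho_*^2=\bar\omega+\bar\nu\bar\mu$. 5. $*\in\{f_3,f_4\}$: - if $\bar\mu\le1$: $\underline\eta_*=\min\big\{\underline\mu,\ \underline h(\bar\nu)+\underline\omega(1-\bar\nu),\ \frac{\underline\mu\,\underline\nu}{g_1(\xi_3)}\big\}g_1(\xi_3)$, $\bar\eta_*=\max\big\{\bar\mu,\ \bar h(\bar\nu)+\bar\omega(1-\underline\nu),\ \frac{\bar\mu\bar\nu}{g_2(\xi_3)}\big\}g_2(\xi_3)$, $\rho_*^2=\bar\omega\varrho(\bar\mu\bar\nu,\underline\mu\,\underline\nu)+\bar\nu\lambda_{\max}(N(I-N))$; - if $\underline\mu\ge1$: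 $\underline\eta_*=\min\{\underline\mu g_1(\xi_1),\ \underline\nu g_1(\xi_1),\ \underline h(\bar\mu\bar\nu)+\underline\omega(1-\bar\mu\bar\nu)\}$, $\bar\eta_*=\max\{\bar\mu g_2(\xi_1),\ \bar\nu g_2(\xi_1),\ \bar h(\bar\mu\bar\nu)+\bar\omega(1-\underline\mu\,\underline\nu)\}$, $\rho_*^2=\bar\omega\big(\bar\nu\bar\mu(\bar\mu-1)+\varrho(\bar\mu\bar\nu,\underline\mu\,\underline\nu)\big)$; - if $\underline\mu<1<\bar\mu$: $\underline\eta_*=\min\big\{\underline\mu,\ \underline h(\bar\mu\bar\nu)+\underline\omega(1-\bar\mu\bar\nu),\ \frac{g_1(\xi_1)}{g_1(\xi_3)},\ \frac{\underline\mu\,\underline\nu g_1(\xi_1)}{g_1(\xi_3)}\big\}g_1(\xi_3)$, $\bar\eta_*=\max\big\{1,\ \bar h(\bar\mu\bar\nu)+\bar\omega(1-\underline\nu),\ \frac{\bar\mu g_2(\xi_1)}{g_2(\xi_3)},\ \frac{\bar\nu g_2(\xi_1)}{g_2(\xi_3)}\big\}g_2(\xi_3)$, $\rho_*^2=\bar\omega\big(\bar\nu\bar\mu(\bar\mu-1)+\varrho(\bar\mu\bar\nu,\underline\mu\,\underline\nu)\big)+\bar\nu\lambda_{\max}(N(I-N))$. 6. $*=f_5$: $\underline\eta_*=\min\big\{\underline\mu,\ \underline h(\bar\nu)+\underline\omega(1-\bar\nu),\ \frac{\underline\delta\,\underline\nu}{g_1(\xi_4)}\big\}g_1(\xi_4)$,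 $\bar\eta_*=\max\big\{\bar\mu,\ \bar h(\bar\nu)+\bar\omega(1-\underline\nu),\ \frac{\bar\delta\bar\nu}{g_2(\xi_4)}\big\}g_2(\xi_4)$, $\rho_*^2=\bar\omega\varrho(\bar\delta\bar\nu,\underline\delta\,\underline\nu)+\bar\nu\lambda_{\max}((I-N)^2N)$.
   Context: Let $A\in\mathbb R^{n\times n}$ be symmetric positive definite (SPD), $B\in\mathbb R^{m\times n}$ have full row rank ($m\le n$), $D\in\mathbb R^{l\times l}$ be symmetric positive semi-definite, and $C\in\mathbb R^{l\times m}$, where $C$ has full row rank whenever $D$ is not SPD. Put $$K=\begin{pmatrix}A&B^T&0\\ B&0&C^T\\ 0&C&D\end{pmatrix},\qquad S=BA^{-1}B^T.$$ Let $M_A\in\mathbb R^{n\times n}$, $\widehat S\in\mathbb R^{m\times m}$, $\widehat M_S\in\mathbb R^{l\times l}$ be SPD matrices (thought of as approximations of $A$, $S$ and $M_S=D+CS^{-1}C^T$). For $W_S\in\{0,\widehat S^{-1}\}$ and $Y_A,Z_A\in\{0,M_A^{-1}\}$ let $$M(Y_A,Z_A,W_S)=\begin{pmatrix}I&0&0\\ BY_A&I&0\\ 0&-CW_S&I\end{pmatrix}\begin{pmatrix}M_A&0&0\\ 0&-\widehat S&0\\ 0&0&\widehat M_S\end{pmatrix}\begin{pmatrix}I&Z_AB^T&0\\ 0&I&-W_SC^T\\ 0&0&I\end{pmatrix}.$$ The eight preconditioners are $$M_d=M(0,0,0),\quad M_{ut}=M(0,M_A^{-1},0),\quad M_{lt}=M(M_A^{-1},0,0),\quad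 M_{f_1}=M(M_A^{-1},M_A^{-1},0),$$ $$M_{f_2}=M(0,0,\widehat S^{-1}),\quad M_{f_3}=M(0,M_A^{-1},\widehat S^{-1}),\quad M_{f_4}=M(M_A^{-1},0,\widehat S^{-1}),\quad M_{f_5}=M(M_A^{-1},M_A^{-1},\widehat S^{-1}).$$ $\lambda_{\min}(\cdot)$, $\lambda_{\max}(\cdot)$ denote the minimum and maximum eigenvalues; they are applied here to matrices all of whose eigenvalues are real. An underlined symbol denotes the minimum and a barred symbol the maximum eigenvalue of the following matrices: $\underline\mu,\bar\mu$ of $M_A^{-1}A$; $\underline\nu,\bar\nu$ of $\widehat S^{-1}S$; $\underline\omega,\bar\omega$ of $\widehat M_S^{-1}C\widehat S^{-1}C^T$; $\underline\tau,\bar\tau$ of $\widehat M_S^{-1}D$; $\underline\vartheta,\bar\vartheta$ of $\widehat M_S^{-1}(D+C\widehat S^{-1}C^T)$. Further, $$\underline\delta=\min\{\underline\mu(2-\underline\mu),\bar\mu(2-\bar\mu)\},\qquad\bar\delta=\max\{\underline\mu(2-\underline\mu),\bar\mu(2-\bar\mu),1\},$$ $$\underline h(t)=\begin{cases}\underline\vartheta,&0\le t\le1,\\ \underline\tau+\underline\omega,&1<t\le2,\end{cases}\qquad\bar h(t)=\begin{cases}\bar\vartheta,&0\le t\le1,\\ \bar\tau+\bar\omega,&1<t\le2,\end{cases}$$ $$g_1(s)=1+\tfrac12s-\sqrt{\tfrac14s^2+s},\qquad g_2(s)=1+\tfrac12s+\sqrt{\tfrac14s^2+s}\quad(s\ge0),$$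 $$\varrho(s,t)=\max\{(s-1)^2,(1-t)^2\}\quad(s,t\ge0),$$ $$\xi_1=\bar\nu-\frac{\bar\nu}{\bar\mu},\qquad\xi_2=\frac{\bar\omega\bar\nu}{\underline\mu},\qquad\xi_3=(1-\underline\mu)\xi_2,\qquad\xi_4=(1-\underline\delta)\xi_2.$$ *)

theory Defs
  imports "HOL-Analysis.Analysis"
begin

definition spd :: "real^'n^'n \<Rightarrow> bool" where
  "spd A \<longleftrightarrow> transpose A = A \<and> (\<forall>x. x \<noteq> 0 \<longrightarrow> x \<bullet> (A *v x) > 0)"

definition spsd :: "real^'n^'n \<Rightarrow> bool" where
  "spsd A \<longleftrightarrow> transpose A = A \<and> (\<forall>x. x \<bullet> (A *v x) \<ge> 0)"

definition is_eigenvalue :: "'a::field^'n^'n \<Rightarrow> 'a \<Rightarrow> bool" where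
  "is_eigenvalue A k \<longleftrightarrow> (\<exists>v. v \<noteq> 0 \<and> A *v v = k *s v)"

(* Only the real eigenvalues are collected; these two are meant for real matrices
   all of whose eigenvalues are real. *)
definition lambda_min :: "real^'n^'n \<Rightarrow> real" where
  "lambda_min A = Min {k. is_eigenvalue A k}"

definition lambda_max :: "real^'n^'n \<Rightarrow> real" where
  "lambda_max A = Max {k. is_eigenvalue A k}"

(* 3 x 3 block matrix; rows and columns are indexed by the disjoint union of the
   three index types. *)
definition block3 ::
  "'a^'n^'n \<Rightarrow> 'a^'m^'n \<Rightarrow> 'a^'l^'n \<Rightarrow>
   'a^'n^'m \<Rightarrow> 'a^'m^'m \<Rightarrow> 'a^'l^'m \<Rightarrow>
   'a^'n^'l \<Rightarrow> 'a^'m^'l \<Rightarrow> 'a^'l^'l \<Rightarrow> 'a^('n + 'm + 'l)^('n + 'm + 'l)" where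
  "block3 A11 A12 A13 A21 A22 A23 A31 A32 A33 = (\<chi> i j.
     case i of
       Inl a \<Rightarrow>
         (case j of Inl b \<Rightarrow> A11 $ a $ b | Inr (Inl b) \<Rightarrow> A12 $ a $ b | Inr (Inr b) \<Rightarrow> A13 $ a $ b)
     | Inr (Inl a) \<Rightarrow>
         (case j of Inl b \<Rightarrow> A21 $ a $ b | Inr (Inl b) \<Rightarrow> A22 $ a $ b | Inr (Inr b) \<Rightarrow> A23 $ a $ b)
     | Inr (Inr a) \<Rightarrow>
         (case j of Inl b \<Rightarrow> A31 $ a $ b | Inr (Inl b) \<Rightarrow> A32 $ a $ b | Inr (Inr b) \<Rightarrow> A33 $ a $ b))"

definition saddle_matrix ::
  "real^'n^'n \<Rightarrow> real^'n^'m \<Rightarrow> real^'m^'l \<Rightarrow> real^'l^'l \<Rightarrow> real^('n + 'm + 'l)^('n + 'm + 'l)" where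
  "saddle_matrix A B C D = block3
     A (transpose B) 0
     B 0             (transpose C)
     0 C             D"

definition preconditioner ::
  "real^'n^'n \<Rightarrow> real^'m^'m \<Rightarrow> real^'l^'l \<Rightarrow> real^'n^'m \<Rightarrow> real^'m^'l \<Rightarrow>
   real^'n^'n \<Rightarrow> real^'n^'n \<Rightarrow> real^'m^'m \<Rightarrow> real^('n + 'm + 'l)^('n + 'm + 'l)" where
  "preconditioner M_A Sh M_S B C YA ZA WS =
     block3
       (mat 1)   0             0
       (B ** YA) (mat 1)       0
       0         (- (C ** WS)) (mat 1)
     ** block3
       M_A 0      0
       0   (- Sh) 0
       0   0      M_S
     ** block3
       (mat 1) (ZA ** transpose B) 0
       0       (mat 1)             (- (WS ** transpose C))
       0       0                   (mat 1)"

(* The bound sqrt r on the imaginary part also encodes r \<ge> 0: for r < 0 we have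
   sqrt r < 0 in HOL, and every square matrix has a complex eigenvalue. *)
definition spectrum_bounds :: "real^'k^'k \<Rightarrow> real \<Rightarrow> real \<Rightarrow> real \<Rightarrow> bool" where
  "spectrum_bounds T lo hi r \<longleftrightarrow>
     (\<forall>z. is_eigenvalue (map_matrix complex_of_real T) z \<longrightarrow>
        lo \<le> Re z \<and> Re z \<le> hi \<and> \<bar>Im z\<bar> \<le> sqrt r)"

(* The two functions h are obtained with the minimum and the maximum eigenvalues,
   respectively; they are only meant for 0 \<le> t \<le> 2. *)
definition h_fun :: "real \<Rightarrow> real \<Rightarrow> real \<Rightarrow> real \<Rightarrow> real" where
  "h_fun theta tau omega t = (if t \<le> 1 then theta else tau + omega)"

definition g1 :: "real \<Rightarrow> real" where
  "g1 s = 1 + s / 2 - sqrt (s\<^sup>2 / 4 + s)"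

definition g2 :: "real \<Rightarrow> real" where
  "g2 s = 1 + s / 2 + sqrt (s\<^sup>2 / 4 + s)"

definition varrho :: "real \<Rightarrow> real \<Rightarrow> real" where
  "varrho s t = max ((s - 1)\<^sup>2) ((1 - t)\<^sup>2)"

end

theory Submission
  imports Defs
begin

text \<open>
  The proof is Bendixson's argument: if an operator \<open>T\<close> is written, for some inner product, as the
  sum of a symmetric part \<open>H\<close> and a skew part \<open>J\<close>, then the real parts of its eigenvalues lie between
  the extreme eigenvalues of \<open>H\<close> and the imaginary parts are bounded by the norm of \<open>J\<close>. Everything
  depends on a good choice of coordinates and of the inner product.

  \<^emph>\<open>Coordinates.\<close> In bases in which \<open>M_A\<close>, \<open>Sh\<close>, \<open>M_S\<close> are identity matrices and \<open>A\<close> is a diagonal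
  matrix with entries \<open>mu i\<close>, and after the two triangular factors of the preconditioner are moved to
  the other side, the pencil \<open>(K, M)\<close> becomes an explicit operator on triples \<open>(x, y, z)\<close>
  (\<open>normal_form_step\<close>, \<open>spectrum_bounds_of_normal_form\<close>). It depends on three switches: \<open>s\<close>, \<open>t\<close>,
  \<open>w\<close> are \<open>1\<close> if \<open>Z_A\<close>, \<open>Y_A\<close>, \<open>W_S\<close>, respectively, is nonzero.

  \<^emph>\<open>Inner product.\<close> For \<open>s = t\<close> the Euclidean one is right. For \<open>s = 0\<close>, \<open>t = 1\<close> (the
  preconditioners \<open>lt\<close> and \<open>f4\<close>) the coordinate \<open>x_i\<close> gets the weight \<open>\<bar>1 - mu i\<bar>\<close>. The coupling of
  \<open>x_i\<close> with \<open>y\<close> is then skew and its coupling with \<open>z\<close> symmetric if \<open>mu i < 1\<close>, and it is the other way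
  round if \<open>mu i > 1\<close>; this is why the bounds distinguish three cases. The preconditioners \<open>ut\<close>
  and \<open>f3\<close> are the transposes of \<open>lt\<close> and \<open>f4\<close> and so give the same spectra
  (\<open>spectrum_bounds_transpose\<close>).

  \<^emph>\<open>Real parts.\<close> Consequently \<open>H\<close> splits into two independent blocks: the \<open>x_i\<close> with skew \<open>z\<close>-coupling
  together with \<open>y\<close>, and the remaining \<open>x_i\<close> together with \<open>z\<close>. A block factorization
  \<open>L\<^sup>T diag(A, Schur complement) L\<close> bounds each of them by the extreme eigenvalues of the diagonal
  part times those of \<open>L\<^sup>T L\<close>; the latter lie in \<open>[g1 xi, g2 xi]\<close> when the off-diagonal block of the
  unit triangular matrix \<open>L\<close> has squared norm at most \<open>xi\<close> (\<open>block_quadratic_form_bounds\<close>). The Schur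
  complements are functions of \<open>A\<close> sandwiched between \<open>B\<close> and its transpose in the first block,
  which \<open>weighted_sum_le\<close> and \<open>weighted_sum_ge\<close> compare with \<open>S\<close>. In the second block they are \<open>D\<close>
  if \<open>W_S = 0\<close>, and otherwise of the form \<open>D + C (2 I - X) C\<^sup>T\<close>, which is where the functions
  \<open>h\<close> come from.

  \<^emph>\<open>Imaginary parts.\<close> The skew part couples the group (\<open>x_i\<close> of the second block, \<open>z\<close>) only with the
  group (\<open>y\<close>, \<open>x_i\<close> of the first block). It is a block matrix with two block rows, and its
  squared norm is at most the sum of the squared norms of these rows (\<open>skew_bracket\<close>). Each
  \<open>\<rho>\<^sup>2\<close> adds a bound for the row of \<open>x\<close>, which contains \<open>nu_max\<close>, and one for the row of \<open>z\<close>, which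
  contains \<open>omega_max\<close>; the former is \<open>0\<close> if no \<open>x_i\<close> has a skew coupling with \<open>y\<close>.
\<close>


section \<open>Simultaneous diagonalization of a symmetric and a positive definite matrix\<close>

lemma symmetric_inner: "transpose X = X \<Longrightarrow> x \<bullet> (X *v y) = (X *v x) \<bullet> (y :: real^'n)"
  by (metis dot_lmul_matrix transpose_matrix_vector)

lemma spd_symmetric: "spd M \<Longrightarrow> transpose M = M"
  by (simp add: spd_def)

lemma spd_pos: "spd M \<Longrightarrow> x \<noteq> 0 \<Longrightarrow> 0 < x \<bullet> (M *v x)"
  by (simp add: spd_def)

text \<open>
  The degenerate case of the Cauchy-Schwarz inequality for a form that is only semidefinite. It
  turns a maximizer of a Rayleigh quotient into an eigenvector.
\<close>
lemma semidefinite_kernel: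
  fixes b :: "'a::real_vector \<Rightarrow> 'a \<Rightarrow> real"
  assumes W: "x \<in> W" "y \<in> W" "subspace W"
    and lin: "\<And>x y z k. b (x + k *\<^sub>R y) z = b x z + k * b y z"
    and sym: "\<And>x y. b x y = b y x"
    and nn: "\<And>x. x \<in> W \<Longrightarrow> 0 \<le> b x x" and z: "b x x = 0"
  shows "b y x = 0"
proof (rule ccontr)
  assume ne: "b y x \<noteq> 0"
  have *: "0 \<le> 2 * k * b y x + k * k * b y y" for k
  proof -
    have "x + k *\<^sub>R y \<in> W" using W by (simp add: subspace_add subspace_mul)
    from nn[OF this] have "0 \<le> b x (x + k *\<^sub>R y) + k * b y (x + k *\<^sub>R y)" by (simp add: lin)
    also have "\<dots> = 2 * k * b y x + k * k * b y y"
      using z by (simp add: sym[of _ "x + k *\<^sub>R y"] lin sym[of x y] algebra_simps)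
    finally show ?thesis .
  qed
  have byy: "0 \<le> b y y" using nn W by simp
  have "0 \<le> 2 * (- b y x / (b y y + 1)) * b y x + (- b y x / (b y y + 1)) * (- b y x / (b y y + 1)) * b y y"
    by (rule *)
  also have "\<dots> = - ((b y x)\<^sup>2 * (b y y + 2) / (b y y + 1)\<^sup>2)"
  proof -
    have "b y y + 1 \<noteq> 0" using byy by linarith
    then show ?thesis by (simp add: divide_simps) algebra
  qed
  also have "\<dots> < 0"
    using byy ne by (simp add: divide_pos_pos)
  finally show False by simp
qed

text \<open>
  The Rayleigh quotient of \<open>(X, M)\<close> attains its maximum \<open>d\<close> on the \<open>M\<close>-orthogonal complement \<open>W\<close> of the
  eigenvectors found so far. There \<open>d M - X\<close> is positive semidefinite and vanishes at the maximizer,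
  so that the maximizer solves the eigenvalue equation when tested against \<open>W\<close>; tested against the old
  eigenvectors the equation holds by orthogonality.
\<close>
lemma generalized_eigenbasis_extend:
  fixes M X :: "real^'n^'n"
  assumes M: "spd M" and X: "transpose X = X"
    and V: "finite V" "card V < CARD('n)"
      "\<forall>v\<in>V. v \<bullet> (M *v v) = 1 \<and> (\<exists>d. X *v v = d *\<^sub>R (M *v v))"
      "\<forall>v\<in>V. \<forall>v'\<in>V. v \<noteq> v' \<longrightarrow> v \<bullet> (M *v v') = 0"
  obtains x where "x \<bullet> (M *v x) = 1" "\<exists>d. X *v x = d *\<^sub>R (M *v x)" "\<forall>v\<in>V. v \<bullet> (M *v x) = 0"
proof -
  note Ms = symmetric_inner[OF spd_symmetric[OF M]] and Xs = symmetric_inner[OF X]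
  define W where "W = {x. \<forall>v\<in>V. (M *v v) \<bullet> x = 0}"
  have W: "subspace W"
    by (auto simp: W_def subspace_def inner_add_right)
  have "dim (span ((*v) M ` V)) < DIM(real^'n)"
    using V(2) card_image_le[OF V(1), of "(*v) M"] dim_le_card'[of "(*v) M ` V"] V(1) by simp
  then have "dim ((*v) M ` V) < DIM(real^'n)" by simp
  then obtain x0 where x0: "x0 \<noteq> 0" "\<And>y. y \<in> span ((*v) M ` V) \<Longrightarrow> orthogonal x0 y"
    using orthogonal_to_subspace_exists by blast
  then have x0W: "x0 \<in> W"
    by (force simp: W_def orthogonal_def inner_commute span_base)
  define R where "R x = (x \<bullet> (X *v x)) / (x \<bullet> (M *v x))" for x
  define U where "U = W \<inter> sphere 0 1"
  have "compact U"
    unfolding U_def by (intro closed_Int_compact closed_subspace W compact_sphere)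
  moreover have "(1 / norm x0) *\<^sub>R x0 \<in> U"
    using x0 x0W W by (simp add: U_def subspace_mul)
  moreover have "continuous_on U R"
  proof -
    have "x \<bullet> (M *v x) \<noteq> 0" if "x \<in> U" for x
    proof -
      have "x \<noteq> 0" using that by (auto simp: U_def)
      then show ?thesis using spd_pos[OF M] by (metis less_irrefl)
    qed
    then show ?thesis
      unfolding R_def
      by (intro continuous_intros linear_continuous_on_compose[OF _ matrix_vector_mul_linear]) auto
  qed
  ultimately obtain x where x: "x \<in> U" and mx: "\<And>y. y \<in> U \<Longrightarrow> R y \<le> R x"
    using continuous_attains_sup[of U R] by blast
  define d where "d = R x"
  have xW: "x \<in> W" "x \<noteq> 0" using x by (auto simp: U_def)
  define b where "b y z = d * (y \<bullet> (M *v z)) - y \<bullet> (X *v z)" for y z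
  have bnn: "0 \<le> b y y" if "y \<in> W" for y
  proof (cases "y = 0")
    case False
    define k where "k = 1 / norm y"
    have "k *\<^sub>R y \<in> U"
      using False that W by (simp add: U_def subspace_mul k_def)
    then have "R (k *\<^sub>R y) \<le> d" using mx d_def by simp
    moreover have "R (k *\<^sub>R y) = R y"
    proof -
      have "k \<noteq> 0" using False by (simp add: k_def)
      then show ?thesis by (simp add: R_def matrix_vector_mult_scaleR)
    qed
    ultimately have "(y \<bullet> (X *v y)) / (y \<bullet> (M *v y)) \<le> d"
      by (simp add: R_def)
    then show ?thesis
      using spd_pos[OF M False] by (simp add: b_def pos_divide_le_eq)
  qed (simp add: b_def)
  have bx: "b x x = 0"
    using spd_pos[OF M xW(2)] by (simp add: b_def d_def R_def)
  have bW: "b y x = 0" if "y \<in> W" for y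
  proof (rule semidefinite_kernel[where b = b, OF xW(1) that W _ _ bnn bx])
    show "b (x + k *\<^sub>R y) z = b x z + k * b y z" for x y z k
      by (simp add: b_def inner_add_left algebra_simps)
    show "b x y = b y x" for x y
      unfolding b_def by (metis Ms Xs inner_commute)
  qed
  have bV: "b v x = 0" if v: "v \<in> V" for v
  proof -
    obtain dv where "X *v v = dv *\<^sub>R (M *v v)" using V(3) v by auto
    moreover have "(M *v v) \<bullet> x = 0" using xW(1) v by (simp add: W_def)
    ultimately show ?thesis by (simp add: b_def Ms Xs)
  qed
  have bz: "b y x = 0" for y
  proof -
    \<comment> \<open>the \<open>M\<close>-orthogonal projection of \<open>y\<close> onto the span of \<open>V\<close>\<close>
    define p where "p = (\<Sum>v\<in>V. (v \<bullet> (M *v y)) *\<^sub>R v)"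
    have "(M *v v) \<bullet> p = (M *v v) \<bullet> y" if v: "v \<in> V" for v
    proof -
      have "(M *v v) \<bullet> p = (\<Sum>v'\<in>V. if v' = v then v \<bullet> (M *v y) else 0)"
        unfolding p_def inner_sum_right
      proof (intro sum.cong refl)
        fix v' assume "v' \<in> V"
        then have "(M *v v) \<bullet> v' = (if v' = v then 1 else 0)"
          using V(3,4) v by (metis inner_commute)
        then show "(M *v v) \<bullet> ((v' \<bullet> (M *v y)) *\<^sub>R v') = (if v' = v then v \<bullet> (M *v y) else 0)"
          by simp
      qed
      then show ?thesis using v V(1) by (simp add: Ms)
    qed
    then have "y - p \<in> W" by (simp add: W_def inner_diff_right)
    then have "b (y - p) x = 0" by (rule bW)
    moreover have "b (y - p) x = b y x - b p x"
      by (simp add: b_def inner_diff_left algebra_simps)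
    moreover have "b p x = (\<Sum>v\<in>V. (v \<bullet> (M *v y)) * b v x)"
      by (simp add: b_def p_def inner_sum_left sum_distrib_left right_diff_distrib sum_subtractf mult.left_commute)
    ultimately show ?thesis using bV by simp
  qed
  have "y \<bullet> (X *v x) = y \<bullet> (d *\<^sub>R (M *v x))" for y
    using bz[of y] unfolding b_def inner_scaleR_right by linarith
  then have eig: "X *v x = d *\<^sub>R (M *v x)"
    using vector_eq_ldot[of "X *v x" "d *\<^sub>R (M *v x)"] by blast
  define k where "k = 1 / sqrt (x \<bullet> (M *v x))"
  have k: "k * k * (x \<bullet> (M *v x)) = 1"
    using spd_pos[OF M xW(2)] by (simp add: k_def)
  show ?thesis
  proof (rule that[of "k *\<^sub>R x"])
    show "(k *\<^sub>R x) \<bullet> (M *v (k *\<^sub>R x)) = 1"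
      using k by (simp add: matrix_vector_mult_scaleR mult.assoc)
    show "\<exists>d. X *v (k *\<^sub>R x) = d *\<^sub>R (M *v (k *\<^sub>R x))"
      using eig by (auto simp: matrix_vector_mult_scaleR mult.commute intro!: exI[of _ d])
    show "\<forall>v\<in>V. v \<bullet> (M *v (k *\<^sub>R x)) = 0"
      using xW(1) by (simp add: matrix_vector_mult_scaleR Ms W_def)
  qed
qed

lemma generalized_eigenbasis:
  fixes M X :: "real^'n^'n"
  assumes M: "spd M" and X: "transpose X = X" and k: "k \<le> CARD('n)"
  shows "\<exists>V. finite V \<and> card V = k \<and>
      (\<forall>v\<in>V. v \<bullet> (M *v v) = 1 \<and> (\<exists>d. X *v v = d *\<^sub>R (M *v v))) \<and>
      (\<forall>v\<in>V. \<forall>v'\<in>V. v \<noteq> v' \<longrightarrow> v \<bullet> (M *v v') = 0)"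
  using k
proof (induction k)
  case 0
  then show ?case by (intro exI[of _ "{}"]) simp
next
  case (Suc k)
  then obtain V where V: "finite V" "card V = k"
      "\<forall>v\<in>V. v \<bullet> (M *v v) = 1 \<and> (\<exists>d. X *v v = d *\<^sub>R (M *v v))"
      "\<forall>v\<in>V. \<forall>v'\<in>V. v \<noteq> v' \<longrightarrow> v \<bullet> (M *v v') = 0"
    by auto
  have "card V < CARD('n)" using V(2) Suc.prems by simp
  then obtain x where x: "x \<bullet> (M *v x) = 1" "\<exists>d. X *v x = d *\<^sub>R (M *v x)" "\<forall>v\<in>V. v \<bullet> (M *v x) = 0"
    by (rule generalized_eigenbasis_extend[OF M X V(1) _ V(3,4)])
  have "x \<notin> V" using x(1,3) by force
  have "\<forall>v\<in>V. x \<bullet> (M *v v) = 0"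
    using x(3) by (metis symmetric_inner[OF spd_symmetric[OF M]] inner_commute)
  then show ?case
    using V x \<open>x \<notin> V\<close> by (intro exI[of _ "insert x V"]) simp
qed

theorem simultaneous_diagonalization:
  fixes M X :: "real^'n^'n"
  assumes M: "spd M" and X: "transpose X = X"
  obtains P :: "real^'n^'n" and d :: "'n \<Rightarrow> real" where "transpose P ** M ** P = mat 1"
    "transpose P ** X ** P = (\<chi> i j. if i = j then d i else 0)"
proof -
  obtain V where V: "finite V" "card V = CARD('n)"
      "\<forall>v\<in>V. v \<bullet> (M *v v) = 1 \<and> (\<exists>d. X *v v = d *\<^sub>R (M *v v))"
      "\<forall>v\<in>V. \<forall>v'\<in>V. v \<noteq> v' \<longrightarrow> v \<bullet> (M *v v') = 0"
    using generalized_eigenbasis[OF M X order.refl] by auto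
  obtain g where g: "bij_betw g (UNIV :: 'n set) V"
    using V(1,2) finite_same_card_bij[of "UNIV :: 'n set" V] by auto
  have gV: "g i \<in> V" and gi: "g i = g j \<longleftrightarrow> i = j" for i j
    using g by (auto simp: bij_betw_def inj_eq)
  obtain d where d: "\<And>v. v \<in> V \<Longrightarrow> X *v v = d v *\<^sub>R (M *v v)"
    using V(3) by metis
  define P where "P = (\<chi> i j. g j $ i)"
  have PYP: "(transpose P ** Y ** P) $ i $ j = g i \<bullet> (Y *v g j)" for Y i j
  proof -
    have "(Y ** P) $ k $ j = (Y *v g j) $ k" for k
      by (simp add: matrix_matrix_mult_def matrix_vector_mult_def P_def)
    moreover have "(transpose P ** Z) $ i $ j = (\<Sum>k\<in>UNIV. g i $ k * Z $ k $ j)" for Z :: "real^'n^'n"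
      by (simp add: matrix_matrix_mult_def transpose_def P_def)
    ultimately show ?thesis
      unfolding matrix_mul_assoc[symmetric] by (simp add: inner_vec_def)
  qed
  have "(transpose P ** M ** P) $ i $ j = mat 1 $ i $ j" for i j
    using V(3,4) gV gi by (simp add: PYP mat_def)
  then have "transpose P ** M ** P = mat 1"
    unfolding vec_eq_iff by blast
  moreover have "(transpose P ** X ** P) $ i $ j = (\<chi> i j. if i = j then d (g i) else 0) $ i $ j" for i j
    using V(3,4) gV gi by (simp add: PYP d)
  then have "transpose P ** X ** P = (\<chi> i j. if i = j then d (g i) else 0)"
    unfolding vec_eq_iff by blast
  ultimately show ?thesis
    by (rule that[of P "\<lambda>i. d (g i)"])
qed

section \<open>Extreme eigenvalues of a symmetric-definite pencil\<close>

text \<open>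
  The action of a diagonal matrix on vectors. Once \<open>A\<close> is diagonal, every function of \<open>A\<close> that occurs
  below, such as \<open>\<bar>I - A\<bar>\<close> or the truncation at \<open>1\<close>, is of this kind.
\<close>
definition dscale :: "('n \<Rightarrow> real) \<Rightarrow> real^'n \<Rightarrow> real^'n" where
  "dscale f x = (\<chi> i. f i * x $ i)"

lemma dscale_nth [simp]: "dscale f x $ i = f i * x $ i"
  by (simp add: dscale_def)

lemma dscale_0 [simp]: "dscale f 0 = 0"
  by (simp add: vec_eq_iff)

definition diag_mat :: "('n \<Rightarrow> 'a::zero) \<Rightarrow> 'a^'n^'n" where
  "diag_mat d = (\<chi> i j. if i = j then d i else 0)"

lemma diag_mat_vector: "diag_mat d *v x = dscale d x"
  by (simp add: diag_mat_def dscale_def matrix_vector_mult_def if_distrib[of "\<lambda>c. c * _"] cong: if_cong)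

lemma diag_mat_mult: "diag_mat d ** diag_mat d' = diag_mat (\<lambda>i. d i * d' i :: real)"
  by (simp add: matrix_eq diag_mat_vector vec_eq_iff flip: matrix_vector_mul_assoc)

lemma diag_mat_diff: "diag_mat d - diag_mat d' = diag_mat (\<lambda>i. d i - d' i :: real)"
  by (simp add: diag_mat_def vec_eq_iff)

lemma diag_mat_1: "diag_mat (\<lambda>i. 1 :: real) = mat 1"
  by (simp add: diag_mat_def mat_def)

lemma eigenvalues_of_diagonalizable:
  fixes Y P :: "real^'n^'n"
  assumes P: "invertible P" and YP: "Y ** P = P ** diag_mat d"
  shows "{k. is_eigenvalue Y k} = range d"
proof -
  have P0: "P *v c = 0 \<longleftrightarrow> c = 0" for c
    using inj_matrix_vector_mult[OF P] by (metis injD matrix_vector_mult_0_right)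
  have Psurj: "\<exists>c. v = P *v c" for v
    using P by (metis invertible_def matrix_vector_mul_assoc matrix_vector_mul_lid)
  have act: "Y *v (P *v c) = P *v dscale d c" for c
    using YP by (metis matrix_vector_mul_assoc diag_mat_vector)
  have eig: "Y *v (P *v c) = k *s (P *v c) \<longleftrightarrow> (\<forall>i. d i * c $ i = k * c $ i)" for c k
  proof -
    have "Y *v (P *v c) - k *s (P *v c) = P *v (dscale d c - k *s c)"
      by (simp add: act matrix_vector_mult_diff_distrib vector_scalar_commute)
    then have "Y *v (P *v c) = k *s (P *v c) \<longleftrightarrow> dscale d c - k *s c = 0"
      by (subst eq_iff_diff_eq_0) (simp only: P0)
    then show ?thesis
      by (simp add: vec_eq_iff)
  qed
  show ?thesis
  proof (intro set_eqI iffI)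
    fix k assume "k \<in> {k. is_eigenvalue Y k}"
    then obtain v where "v \<noteq> 0" "Y *v v = k *s v" by (auto simp: is_eigenvalue_def)
    moreover obtain c where "v = P *v c" using Psurj by blast
    ultimately have "c \<noteq> 0" "\<forall>i. d i * c $ i = k * c $ i" using P0 eig by auto
    then show "k \<in> range d" by (auto simp: vec_eq_iff)
  next
    fix k assume "k \<in> range d"
    then obtain i where i: "k = d i" by blast
    have "P *v axis i 1 \<noteq> 0" by (simp add: P0)
    moreover have "Y *v (P *v axis i 1) = k *s (P *v axis i 1)"
      unfolding eig by (simp add: axis_def i)
    ultimately show "k \<in> {k. is_eigenvalue Y k}"
      by (auto simp: is_eigenvalue_def)
  qed
qed

lemma
  fixes Y P :: "real^'n^'n"
  assumes "invertible P" and "Y ** P = P ** diag_mat d"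
  shows lambda_min_le_diag: "lambda_min Y \<le> d i" and diag_le_lambda_max: "d i \<le> lambda_max Y"
    and lambda_min_attained: "\<exists>i. lambda_min Y = d i"
proof -
  have E: "lambda_min Y = Min (range d)" "lambda_max Y = Max (range d)"
    by (simp_all add: lambda_min_def lambda_max_def eigenvalues_of_diagonalizable[OF assms])
  show "lambda_min Y \<le> d i" "d i \<le> lambda_max Y" unfolding E by simp_all
  show "\<exists>i. lambda_min Y = d i"
    unfolding E using Min_in[of "range d"] by (simp add: image_iff)
qed

lemma normalizing_matrix:
  fixes M P :: "real^'n^'n"
  assumes "transpose P ** M ** P = mat 1"
  shows "invertible P" "invertible M" "matrix_inv M = P ** transpose P"
    "P ** transpose P ** M = mat 1" "M ** (P ** transpose P) = mat 1"
proof -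
  show P: "invertible P"
    using assms invertible_left_inverse by blast
  have 1: "P ** transpose P ** M = mat 1"
    using assms matrix_left_right_inverse[of "transpose P ** M" P] by (simp add: matrix_mul_assoc)
  then show "P ** transpose P ** M = mat 1" .
  then show 2: "M ** (P ** transpose P) = mat 1"
    using matrix_left_right_inverse by blast
  show "invertible M"
    unfolding invertible_def using 1 2 by blast
  have "M ** (P ** transpose P) = mat 1 \<and> P ** transpose P ** M = mat 1" using 1 2 by blast
  then have "M ** matrix_inv M = mat 1 \<and> matrix_inv M ** M = mat 1"
    unfolding matrix_inv_def by (rule someI[of "\<lambda>M'. M ** M' = mat 1 \<and> M' ** M = mat 1"])
  then have "P ** transpose P ** (M ** matrix_inv M) = P ** transpose P"
    by simp
  then show "matrix_inv M = P ** transpose P"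
    unfolding matrix_mul_assoc 1 by simp
qed

lemma pencil_diagonalizable:
  fixes M X P :: "real^'n^'n"
  assumes M: "transpose P ** M ** P = mat 1" and X: "transpose P ** X ** P = diag_mat d"
  shows "(matrix_inv M ** X) ** P = P ** diag_mat d"
proof -
  have "(matrix_inv M ** X) ** P = P ** (transpose P ** X ** P)"
    unfolding normalizing_matrix(3)[OF M] by (simp only: matrix_mul_assoc)
  then show ?thesis unfolding X .
qed

lemma simultaneous_diagonalization_diag_mat:
  fixes M X :: "real^'n^'n"
  assumes "spd M" "transpose X = X"
  obtains P :: "real^'n^'n" and d :: "'n \<Rightarrow> real" where "transpose P ** M ** P = mat 1" "transpose P ** X ** P = diag_mat d"
  by (rule simultaneous_diagonalization[OF assms]) (rule that[unfolded diag_mat_def])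

lemma transpose_congruence_inner:
  fixes P X :: "real^'n^'n"
  shows "(P *v c) \<bullet> (X *v (P *v c)) = c \<bullet> ((transpose P ** X ** P) *v c)"
proof -
  have "c \<bullet> ((transpose P ** X ** P) *v c) = c \<bullet> ((X *v (P *v c)) v* P)"
    by (simp flip: matrix_vector_mul_assoc)
  also have "\<dots> = ((X *v (P *v c)) v* P) \<bullet> c"
    by (rule inner_commute)
  also have "\<dots> = (P *v c) \<bullet> (X *v (P *v c))"
    by (simp add: dot_lmul_matrix inner_commute[of "P *v c"])
  finally show ?thesis by simp
qed

lemma rayleigh_bounds:
  fixes M X :: "real^'n^'n"
  assumes "spd M" "transpose X = X"
  shows "lambda_min (matrix_inv M ** X) * (x \<bullet> (M *v x)) \<le> x \<bullet> (X *v x)"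
    and "x \<bullet> (X *v x) \<le> lambda_max (matrix_inv M ** X) * (x \<bullet> (M *v x))"
proof -
  obtain P :: "real^'n^'n" and d where P: "transpose P ** M ** P = mat 1" "transpose P ** X ** P = diag_mat d"
    by (rule simultaneous_diagonalization_diag_mat[OF assms])
  note D = normalizing_matrix(1)[OF P(1)] pencil_diagonalizable[OF P]
  obtain c where c: "x = P *v c"
    using normalizing_matrix(1)[OF P(1)] by (metis invertible_def matrix_vector_mul_assoc matrix_vector_mul_lid)
  have x: "x \<bullet> (M *v x) = (\<Sum>i\<in>UNIV. (c $ i)\<^sup>2)" "x \<bullet> (X *v x) = (\<Sum>i\<in>UNIV. d i * (c $ i)\<^sup>2)"
    unfolding c transpose_congruence_inner P
    by (simp_all add: diag_mat_vector inner_vec_def power2_eq_square algebra_simps)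
  show "lambda_min (matrix_inv M ** X) * (x \<bullet> (M *v x)) \<le> x \<bullet> (X *v x)"
    unfolding x sum_distrib_left
    by (intro sum_mono mult_right_mono lambda_min_le_diag[OF D] zero_le_power2)
  show "x \<bullet> (X *v x) \<le> lambda_max (matrix_inv M ** X) * (x \<bullet> (M *v x))"
    unfolding x sum_distrib_left
    by (intro sum_mono mult_right_mono diag_le_lambda_max[OF D] zero_le_power2)
qed

lemma
  fixes M X :: "real^'n^'n"
  assumes "spd M" "transpose X = X"
  shows lambda_min_eigenvector: "\<exists>x. x \<noteq> 0 \<and> x \<bullet> (X *v x) = lambda_min (matrix_inv M ** X) * (x \<bullet> (M *v x))"
    and lambda_min_le_max: "lambda_min (matrix_inv M ** X) \<le> lambda_max (matrix_inv M ** X)"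
proof -
  obtain P :: "real^'n^'n" and d where P: "transpose P ** M ** P = mat 1" "transpose P ** X ** P = diag_mat d"
    by (rule simultaneous_diagonalization_diag_mat[OF assms])
  note D = normalizing_matrix(1)[OF P(1)] pencil_diagonalizable[OF P]
  obtain i where i: "lambda_min (matrix_inv M ** X) = d i"
    using lambda_min_attained[OF D] by blast
  show "lambda_min (matrix_inv M ** X) \<le> lambda_max (matrix_inv M ** X)"
    unfolding i by (rule diag_le_lambda_max[OF D])
  have "P *v axis i 1 \<noteq> 0"
    using inj_matrix_vector_mult[OF D(1), THEN injD, of "axis i 1" 0] by auto
  moreover have "axis i 1 \<bullet> dscale d (axis i 1) = d i * (axis i 1 \<bullet> (axis i 1 :: real^'n))"
    by (simp add: inner_axis')
  ultimately show "\<exists>x. x \<noteq> 0 \<and> x \<bullet> (X *v x) = lambda_min (matrix_inv M ** X) * (x \<bullet> (M *v x))"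
    by (intro exI[of _ "P *v axis i 1"])
      (simp add: transpose_congruence_inner P i diag_mat_vector)
qed

lemma lambda_min_nonneg:
  fixes M X :: "real^'n^'n"
  assumes "spd M" "transpose X = X" "\<And>x. 0 \<le> x \<bullet> (X *v x)"
  shows "0 \<le> lambda_min (matrix_inv M ** X)"
proof -
  obtain x where x: "x \<noteq> 0" "x \<bullet> (X *v x) = lambda_min (matrix_inv M ** X) * (x \<bullet> (M *v x))"
    using lambda_min_eigenvector[OF assms(1,2)] by blast
  then show ?thesis
    using spd_pos[OF assms(1) x(1)] assms(3)[of x] by (simp add: zero_le_mult_iff)
qed

lemma matrix_inv_right: "invertible M \<Longrightarrow> M ** matrix_inv M = mat 1"
  and matrix_inv_left: "invertible M \<Longrightarrow> matrix_inv M ** M = mat 1"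
proof -
  assume "invertible M"
  then have "M ** matrix_inv M = mat 1 \<and> matrix_inv M ** M = mat 1"
    unfolding invertible_def matrix_inv_def by (rule someI_ex)
  then show "M ** matrix_inv M = mat 1" "matrix_inv M ** M = mat 1" by auto
qed

lemma spd_invertible: "spd A \<Longrightarrow> invertible A"
proof -
  assume A: "spd A"
  have "x = 0" if "A *v x = 0" for x
    using spd_pos[OF A, of x] that by (cases "x = 0") auto
  then show ?thesis
    using matrix_left_invertible_ker invertible_left_inverse by blast
qed

lemma symmetric_matrix_inv:
  fixes A :: "real^'n^'n"
  assumes "transpose A = A" "invertible A"
  shows "transpose (matrix_inv A) = matrix_inv A"
proof -
  have "transpose (matrix_inv A) ** A = mat 1"
    using arg_cong[OF matrix_inv_right[OF assms(2)], of transpose] assms(1)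
    by (simp add: matrix_transpose_mul)
  then have "transpose (matrix_inv A) ** A ** matrix_inv A = matrix_inv A"
    by simp
  then show ?thesis
    by (simp add: matrix_inv_right[OF assms(2)] flip: matrix_mul_assoc)
qed

lemma symmetric_sandwich:
  fixes B :: "real^'n^'m" and X :: "real^'n^'n"
  shows "transpose X = X \<Longrightarrow> transpose (B ** X ** transpose B) = B ** X ** transpose B"
  by (simp only: matrix_transpose_mul transpose_transpose matrix_mul_assoc)

text \<open>
  Both \<open>S\<close> and the matrix defining \<open>omega\<close> have this shape.
\<close>
lemma sandwich_inner:
  fixes B :: "real^'n^'m" and X :: "real^'n^'n"
  shows "y \<bullet> ((B ** X ** transpose B) *v y) = (y v* B) \<bullet> (X *v (y v* B))"
  by (simp add: dot_lmul_matrix flip: matrix_vector_mul_assoc)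

lemma lambda_min_pos:
  fixes M X :: "real^'n^'n"
  assumes "spd M" "spd X"
  shows "0 < lambda_min (matrix_inv M ** X)"
proof -
  obtain x where x: "x \<noteq> 0" "x \<bullet> (X *v x) = lambda_min (matrix_inv M ** X) * (x \<bullet> (M *v x))"
    using lambda_min_eigenvector[OF assms(1) spd_symmetric[OF assms(2)]] by blast
  then show ?thesis
    using spd_pos[OF assms(1) x(1)] spd_pos[OF assms(2) x(1)] by (simp add: zero_less_mult_iff)
qed

lemma diagonalizable_mult:
  fixes P :: "real^'n^'n"
  assumes "Y ** P = P ** diag_mat f" "Z ** P = P ** diag_mat g"
  shows "(Y ** Z) ** P = P ** diag_mat (\<lambda>i. f i * g i)"
proof -
  have "(Y ** Z) ** P = (Y ** P) ** diag_mat g"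
    using assms(2) by (simp flip: matrix_mul_assoc)
  then show ?thesis
    by (simp add: assms(1) diag_mat_mult flip: matrix_mul_assoc)
qed

lemma diagonalizable_one_minus:
  fixes P :: "real^'n^'n"
  assumes "Y ** P = P ** diag_mat f"
  shows "(mat 1 - Y) ** P = P ** diag_mat (\<lambda>i. 1 - f i)"
proof -
  have "(mat 1 - Y) ** P = P ** mat 1 - Y ** P"
    by (simp add: matrix_eq matrix_vector_mult_diff_rdistrib flip: matrix_vector_mul_assoc)
  also have "\<dots> = P ** (mat 1 - diag_mat f)"
    by (simp add: matrix_eq assms matrix_vector_mult_diff_rdistrib matrix_vector_mult_diff_distrib flip: matrix_vector_mul_assoc)
  finally show ?thesis
    by (simp add: diag_mat_diff flip: diag_mat_1)
qed

section \<open>Quadratic forms of triangular congruences\<close>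

lemma g2_ge_1: "0 \<le> s \<Longrightarrow> 1 \<le> g2 s"
  by (simp add: g2_def)

lemma g1_g2: "0 \<le> s \<Longrightarrow> g1 s * g2 s = 1"
proof -
  assume "0 \<le> s"
  then have "(sqrt (s\<^sup>2 / 4 + s))\<^sup>2 = s\<^sup>2 / 4 + s" by simp
  then show ?thesis
    unfolding g1_def g2_def by (simp add: algebra_simps power2_eq_square)
qed

lemma g1_pos:
  assumes "0 \<le> s" shows "0 < g1 s"
proof -
  have "0 < g1 s * g2 s" using g1_g2[OF assms] by simp
  then show ?thesis using g2_ge_1[OF assms] by (simp add: zero_less_mult_iff)
qed

lemma g1_le_1:
  assumes "0 \<le> s" shows "g1 s \<le> 1"
proof -
  have "g1 s * 1 \<le> g1 s * g2 s"
    using g1_pos[OF assms] g2_ge_1[OF assms] by (intro mult_left_mono) auto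
  then show ?thesis using g1_g2[OF assms] by simp
qed

lemma g1_0 [simp]: "g1 0 = 1" and g2_0 [simp]: "g2 0 = 1"
  by (simp_all add: g1_def g2_def)

text \<open>
  This is the upper bound for \<open>L\<^sup>T L\<close> with \<open>L\<close> unit triangular, where \<open>e\<close> is the image of a vector of
  squared length \<open>Y\<close> under the off-diagonal block. Weighting Young's inequality by \<open>t = g2 xi - 1\<close>
  works because \<open>t\<close> is the positive root of \<open>t\<^sup>2 = xi t + xi\<close>, which makes the two
  resulting factors equal.
\<close>
lemma unit_triangular_upper:
  fixes x e :: "'i \<Rightarrow> real"
  assumes "finite I" "0 \<le> xi" "0 \<le> Y" "(\<Sum>i\<in>I. (e i)\<^sup>2) \<le> xi * Y"
  shows "(\<Sum>i\<in>I. (x i + e i)\<^sup>2) + Y \<le> g2 xi * ((\<Sum>i\<in>I. (x i)\<^sup>2) + Y)"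
proof (cases "xi = 0")
  case True
  then have "(\<Sum>i\<in>I. (e i)\<^sup>2) \<le> 0"
    using assms by simp
  then have "(\<Sum>i\<in>I. (e i)\<^sup>2) = 0"
    by (simp add: sum_nonneg antisym)
  then have "\<forall>i\<in>I. e i = 0"
    using assms(1) by (simp add: sum_nonneg_eq_0_iff)
  then show ?thesis
    using True by simp
next
  case False
  \<comment> \<open>the balanced weight in Young's inequality\<close>
  define t where "t = g2 xi - 1"
  have "t > 0"
    using False assms(2) unfolding t_def g2_def by (simp add: add_pos_nonneg)
  have t2: "t * t = xi * t + xi"
    using assms(2) unfolding t_def g2_def by (simp add: field_simps power2_eq_square)
  have "(x i + e i)\<^sup>2 \<le> (1 + t) * (x i)\<^sup>2 + (1 + 1/t) * (e i)\<^sup>2" for i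
  proof -
    have "(1 + t) * (x i)\<^sup>2 + (1 + 1/t) * (e i)\<^sup>2 - (x i + e i)\<^sup>2 = (t * x i - e i)\<^sup>2 / t"
      using \<open>t > 0\<close> by (simp add: field_simps power2_eq_square)
    moreover have "0 \<le> (t * x i - e i)\<^sup>2 / t"
      using \<open>t > 0\<close> by simp
    ultimately show ?thesis by linarith
  qed
  then have "(\<Sum>i\<in>I. (x i + e i)\<^sup>2) \<le> (1 + t) * (\<Sum>i\<in>I. (x i)\<^sup>2) + (1 + 1/t) * (\<Sum>i\<in>I. (e i)\<^sup>2)"
    by (simp add: sum_distrib_left sum_mono flip: sum.distrib)
  also have "\<dots> \<le> (1 + t) * (\<Sum>i\<in>I. (x i)\<^sup>2) + (1 + 1/t) * (xi * Y)"
    using assms(4) \<open>t > 0\<close> by (simp add: mult_left_mono)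
  also have "(1 + 1/t) * (xi * Y) = t * Y"
  proof -
    have "(1 + 1/t) * xi = t"
      using t2 \<open>t > 0\<close> by (simp add: field_simps)
    then show ?thesis
      by (metis mult.assoc)
  qed
  finally show ?thesis
    unfolding t_def by (simp add: algebra_simps)
qed

text \<open>
  The inverse of \<open>L\<close> has the off-diagonal block of \<open>L\<close> with the opposite sign, so that the upper bound
  for the inverse, together with \<open>g1 xi * g2 xi = 1\<close>, gives the lower bound for \<open>L\<close>.
\<close>
lemma unit_triangular_lower:
  fixes x e :: "'i \<Rightarrow> real"
  assumes "finite I" "0 \<le> xi" "0 \<le> Y" "(\<Sum>i\<in>I. (e i)\<^sup>2) \<le> xi * Y"
  shows "g1 xi * ((\<Sum>i\<in>I. (x i)\<^sup>2) + Y) \<le> (\<Sum>i\<in>I. (x i + e i)\<^sup>2) + Y"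
proof -
  have "(\<Sum>i\<in>I. (x i)\<^sup>2) + Y \<le> g2 xi * ((\<Sum>i\<in>I. (x i + e i)\<^sup>2) + Y)"
    using unit_triangular_upper[of I xi Y "\<lambda>i. - e i" "\<lambda>i. x i + e i"] assms by simp
  then have "g1 xi * ((\<Sum>i\<in>I. (x i)\<^sup>2) + Y) \<le> g1 xi * (g2 xi * ((\<Sum>i\<in>I. (x i + e i)\<^sup>2) + Y))"
    using g1_pos[OF assms(2)] by (simp add: mult_left_mono)
  also have "\<dots> = (\<Sum>i\<in>I. (x i + e i)\<^sup>2) + Y"
    using g1_g2[OF assms(2)] by (metis mult.assoc mult_1)
  finally show ?thesis .
qed

text \<open>
  Completing the square in the \<open>x i\<close> exhibits \<open>F\<close> as a block diagonal form with entries \<open>mu i\<close> and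
  \<open>r\<close>, the Schur complement, composed with a unit triangular map. The term with \<open>(kappa i * u i)\<^sup>2\<close>
  in \<open>F\<close> is exactly what completing the square produces.
\<close>
lemma block_quadratic_form_bounds:
  fixes mu kappa x u :: "'i \<Rightarrow> real"
  assumes I: "finite I" "\<And>i. i \<in> I \<Longrightarrow> 0 < mu i \<and> c \<le> mu i \<and> mu i \<le> d"
    and r: "c * Y \<le> r" "r \<le> d * Y"
    and Y: "0 \<le> Y" "0 \<le> c" "0 \<le> d"
    and xi: "0 \<le> xi" "(\<Sum>i\<in>I. (kappa i * u i / mu i)\<^sup>2) \<le> xi * Y"
  defines "F \<equiv> (\<Sum>i\<in>I. mu i * (x i)\<^sup>2 + 2 * kappa i * x i * u i + (kappa i * u i)\<^sup>2 / mu i) + r"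
  shows "c * g1 xi * ((\<Sum>i\<in>I. (x i)\<^sup>2) + Y) \<le> F" "F \<le> d * g2 xi * ((\<Sum>i\<in>I. (x i)\<^sup>2) + Y)"
proof -
  let ?Q = "\<lambda>i. (x i + kappa i * u i / mu i)\<^sup>2"
  have "mu i * (x i)\<^sup>2 + 2 * kappa i * x i * u i + (kappa i * u i)\<^sup>2 / mu i = mu i * ?Q i"
    if "i \<in> I" for i
    using I(2)[OF that] by (simp add: field_simps power2_eq_square)
  then have "F = (\<Sum>i\<in>I. mu i * ?Q i) + r"
    unfolding F_def by simp
  moreover have "(\<Sum>i\<in>I. mu i * ?Q i) \<le> d * (\<Sum>i\<in>I. ?Q i)" "c * (\<Sum>i\<in>I. ?Q i) \<le> (\<Sum>i\<in>I. mu i * ?Q i)"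
    unfolding sum_distrib_left by (rule sum_mono, rule mult_right_mono, auto simp: I(2))+
  ultimately have F: "F \<le> d * ((\<Sum>i\<in>I. ?Q i) + Y)" "c * ((\<Sum>i\<in>I. ?Q i) + Y) \<le> F"
    using r by (simp_all add: algebra_simps)
  have "c * (g1 xi * ((\<Sum>i\<in>I. (x i)\<^sup>2) + Y)) \<le> c * ((\<Sum>i\<in>I. ?Q i) + Y)"
    using unit_triangular_lower[OF I(1) xi(1) Y(1) xi(2)] Y(2) by (intro mult_left_mono) auto
  with F(2) show "c * g1 xi * ((\<Sum>i\<in>I. (x i)\<^sup>2) + Y) \<le> F"
    by (simp add: mult.assoc)
  have "d * ((\<Sum>i\<in>I. ?Q i) + Y) \<le> d * (g2 xi * ((\<Sum>i\<in>I. (x i)\<^sup>2) + Y))"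
    using unit_triangular_upper[OF I(1) xi(1) Y(1) xi(2)] Y(3) by (intro mult_left_mono) auto
  with F(1) show "F \<le> d * g2 xi * ((\<Sum>i\<in>I. (x i)\<^sup>2) + Y)"
    by (simp add: mult.assoc)
qed

text \<open>
  Polarization with a vector of the same length as \<open>x\<close> and the direction of \<open>T x\<close>.
\<close>
lemma norm_le_of_quadratic_form:
  fixes T :: "'a::real_inner \<Rightarrow> 'a"
  assumes T: "linear T" and sym: "\<And>x y. x \<bullet> T y = T x \<bullet> y"
    and q: "\<And>x. \<bar>x \<bullet> T x\<bar> \<le> c * (norm x)\<^sup>2"
  shows "norm (T x) \<le> c * norm x"
proof (cases "T x = 0")
  case True
  show ?thesis
  proof (cases "x = 0")
    case False
    then have "0 \<le> c"
      using order.trans[OF abs_ge_zero q[of x]] by (simp add: zero_le_mult_iff)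
    then show ?thesis using True by simp
  qed (simp add: linear_0[OF T])
next
  case False
  then have "x \<noteq> 0" using T linear_0 by auto
  define y where "y = (norm x / norm (T x)) *\<^sub>R T x"
  have ny: "norm y = norm x"
    using False by (simp add: y_def)
  have "4 * (y \<bullet> T x) = (x + y) \<bullet> T (x + y) - (x - y) \<bullet> T (x - y)"
    using sym[of x y] by (simp add: linear_add[OF T] linear_diff[OF T] algebra_simps inner_commute)
  also have "\<dots> \<le> c * (norm (x + y))\<^sup>2 + c * (norm (x - y))\<^sup>2"
    using q[of "x + y"] q[of "x - y"] by linarith
  also have "\<dots> = 4 * (c * (norm x)\<^sup>2)"
    using arg_cong[OF ny, of "\<lambda>t. c * t\<^sup>2"] by (simp add: power2_norm_eq_inner algebra_simps inner_commute)
  finally have "y \<bullet> T x \<le> c * (norm x)\<^sup>2" by simp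
  moreover have "y \<bullet> T x = norm x * norm (T x)"
    using False by (simp add: y_def power2_eq_square flip: power2_norm_eq_inner)
  ultimately show ?thesis
    using \<open>x \<noteq> 0\<close> by (simp add: power2_eq_square mult.left_commute)
qed

section \<open>The preconditioned operator in normal form\<close>

text \<open>
  The equation \<open>K v = M v'\<close> in the coordinates described at the beginning: \<open>(x, y, z)\<close> stands for \<open>v\<close> and
  \<open>(x', y', z')\<close> for \<open>v'\<close>. The second and third rows are left in terms of \<open>x'\<close> and \<open>y'\<close>, as
  forward substitution in the triangular system leaves them.
\<close>
definition normal_form_step ::
  "('n \<Rightarrow> real) \<Rightarrow> real^'n^'m \<Rightarrow> real^'m^'l \<Rightarrow> real^'l^'l \<Rightarrow> real \<Rightarrow> real \<Rightarrow> real \<Rightarrow>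
   real^'n \<Rightarrow> real^'m \<Rightarrow> real^'l \<Rightarrow> real^'n \<Rightarrow> real^'m \<Rightarrow> real^'l \<Rightarrow> bool" where
  "normal_form_step mu B C D s t w x y z x' y' z' \<longleftrightarrow>
     (let yt = y + w *\<^sub>R (z v* C); b = yt v* B in
      x' = dscale mu x + dscale (\<lambda>i. 1 - s * mu i) b \<and>
      y' = t *\<^sub>R (B *v x') - B *v x + s *\<^sub>R (B *v b) - z v* C \<and>
      z' = C *v yt + D *v z - w *\<^sub>R (C *v y'))"

text \<open>
  An eigenvalue \<open>a + i b\<close> with eigenvector \<open>v + i v'\<close> is expressed by its real and imaginary parts, so
  that only real inner products are needed.
\<close>
definition normal_form_bounds ::
  "('n \<Rightarrow> real) \<Rightarrow> real^'n^'m \<Rightarrow> real^'m^'l \<Rightarrow> real^'l^'l \<Rightarrow> real \<Rightarrow> real \<Rightarrow> real \<Rightarrow>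
   real \<Rightarrow> real \<Rightarrow> real \<Rightarrow> bool" where
  "normal_form_bounds mu B C D s t w lo hi r \<longleftrightarrow>
     (\<forall>a b x y z x2 y2 z2.
        normal_form_step mu B C D s t w x y z
          (a *\<^sub>R x - b *\<^sub>R x2) (a *\<^sub>R y - b *\<^sub>R y2) (a *\<^sub>R z - b *\<^sub>R z2) \<longrightarrow>
        normal_form_step mu B C D s t w x2 y2 z2
          (b *\<^sub>R x + a *\<^sub>R x2) (b *\<^sub>R y + a *\<^sub>R y2) (b *\<^sub>R z + a *\<^sub>R z2) \<longrightarrow>
        \<not> (x = 0 \<and> y = 0 \<and> z = 0 \<and> x2 = 0 \<and> y2 = 0 \<and> z2 = 0) \<longrightarrow>
        lo \<le> a \<and> a \<le> hi \<and> \<bar>b\<bar> \<le> sqrt r)"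

text \<open>
  The vector \<open>scal\<close> determines the inner product on the \<open>x\<close>-component: with \<open>X i = scal i * x $ i\<close>
  the operator couples \<open>X\<close> and \<open>y\<close> through \<open>kappa\<close> in the first row and through \<open>- e * kappa\<close> in the second.
  So the coupling is skew where \<open>e i = 1\<close> and symmetric where \<open>e i = -1\<close>. The
  coupling with \<open>z\<close> is the other way round. Zeros of \<open>scal\<close> are permitted: they occur for \<open>lt\<close> and \<open>f4\<close> where \<open>mu i = 1\<close>, and there the inner product
  degenerates.
\<close>
locale normal_form =
  fixes mu :: "'n::finite \<Rightarrow> real" and B :: "real^'n^'m" and C :: "real^'m^'l" and D :: "real^'l^'l"
    and s t w :: real and scal kappa e :: "'n \<Rightarrow> real"
  assumes mu_pos: "\<And>i. 0 < mu i"
    and D_sym: "transpose D = D"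
    and w01: "w = 0 \<or> w = 1"
    and e_cases: "\<And>i. e i = 1 \<or> e i = -1"
    and kappa_row: "\<And>i. scal i * (1 - s * mu i) = kappa i"
    and kappa_col: "\<And>i. e i * kappa i * scal i = 1 - t * mu i"
begin

text \<open>
  The entries of \<open>Y_A + Z_A - Y_A A Z_A\<close>; they define the block \<open>B diag(q) B\<^sup>T\<close> that acts on \<open>y\<close>. The
  weights \<open>py\<close> and \<open>pz\<close> arise from \<open>q\<close> when the \<open>x\<close>-coordinates are eliminated from the symmetric
  part, in the block of \<open>y\<close> and in that of \<open>z\<close>.
\<close>
definition q where "q i = s + t - s * t * mu i"
definition py where "py i = q i - (if e i = -1 then (kappa i)\<^sup>2 / mu i else 0)"
definition pz where "pz i = q i + (if e i = 1 then (kappa i)\<^sup>2 / mu i else 0)"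

definition sq_norm where
  "sq_norm x y z = (\<Sum>i\<in>UNIV. (scal i * x $ i)\<^sup>2) + (norm y)\<^sup>2 + (norm z)\<^sup>2"
definition ip where
  "ip x1 y1 z1 x y z = (\<Sum>i\<in>UNIV. scal i * x1 $ i * (scal i * x $ i)) + y1 \<bullet> y + z1 \<bullet> z"

definition schur_z where
  "schur_z z = z \<bullet> (D *v z) + w * (2 * (norm (z v* C))\<^sup>2 - (\<Sum>i\<in>UNIV. pz i * (((z v* C) v* B) $ i)\<^sup>2))"

text \<open>
  The skew coupling of \<open>y\<close> and \<open>z\<close>, that is \<open>(I - w B diag(q) B\<^sup>T) C\<^sup>T\<close>.
\<close>
definition Gamma_op where
  "Gamma_op z = z v* C - w *\<^sub>R (B *v dscale q ((z v* C) v* B))"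

abbreviation "Iz \<equiv> {i. e i = 1}"
abbreviation "Iy \<equiv> {i. e i = -1}"

lemma sum_split: "(\<Sum>i\<in>UNIV. h i) = (\<Sum>i\<in>Iy. h i) + (\<Sum>i\<in>Iz. h i :: real)"
proof -
  have "UNIV = Iy \<union> Iz" using e_cases by auto
  moreover have "Iy \<inter> Iz = {}" by auto
  ultimately show ?thesis
    by (metis finite finite_Un sum.union_disjoint)
qed

text \<open>
  The bilinear form of the operator with respect to the inner product \<open>ip\<close>; see \<open>ip_step\<close>.
\<close>
definition form where
  "form x1 y1 z1 x y z =
    (let u = y v* B; v = (z v* C) v* B; u1 = y1 v* B; v1 = (z1 v* C) v* B in
     (\<Sum>i\<in>UNIV. scal i * x1 $ i * (mu i * (scal i * x $ i) + kappa i * (u $ i + w * v $ i))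
        + (u1 $ i - w * v1 $ i) * (q i * (u $ i + w * v $ i) - e i * kappa i * (scal i * x $ i)))
     + (z1 v* C) \<bullet> y - (z v* C) \<bullet> y1 + 2 * w * ((z1 v* C) \<bullet> (z v* C)) + z1 \<bullet> (D *v z))"

lemma step_second_row:
  assumes "normal_form_step mu B C D s t w x y z x' y' z'"
  shows "y1 \<bullet> y' = (\<Sum>i\<in>UNIV. (y1 v* B) $ i * (q i * ((y + w *\<^sub>R (z v* C)) v* B) $ i
            - e i * kappa i * (scal i * x $ i))) - y1 \<bullet> (z v* C)"
proof -
  define b where "b = (y + w *\<^sub>R (z v* C)) v* B"
  have x': "x' = dscale mu x + dscale (\<lambda>i. 1 - s * mu i) b"
    and y': "y' = t *\<^sub>R (B *v x') - B *v x + s *\<^sub>R (B *v b) - z v* C"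
    using assms by (auto simp: normal_form_step_def Let_def b_def)
  have "y1 \<bullet> y' = t * ((y1 v* B) \<bullet> x') - (y1 v* B) \<bullet> x + s * ((y1 v* B) \<bullet> b) - y1 \<bullet> (z v* C)"
    by (simp add: y' inner_diff_right inner_add_right flip: dot_lmul_matrix)
  also have "t * ((y1 v* B) \<bullet> x') - (y1 v* B) \<bullet> x + s * ((y1 v* B) \<bullet> b) =
     (\<Sum>i\<in>UNIV. (y1 v* B) $ i * (t * x' $ i - x $ i + s * b $ i))"
    by (simp add: inner_vec_def sum_distrib_left algebra_simps flip: sum.distrib sum_subtractf)
  also have "\<dots> = (\<Sum>i\<in>UNIV. (y1 v* B) $ i * (q i * b $ i - e i * kappa i * (scal i * x $ i)))"
  proof (intro sum.cong refl)
    fix i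
    have ek: "e i * kappa i * (scal i * x $ i) = (1 - t * mu i) * x $ i"
      by (simp flip: kappa_col)
    show "(y1 v* B) $ i * (t * x' $ i - x $ i + s * b $ i) =
      (y1 v* B) $ i * (q i * b $ i - e i * kappa i * (scal i * x $ i))"
      unfolding ek by (simp add: x' q_def algebra_simps)
  qed
  finally show ?thesis unfolding b_def .
qed

lemma ip_step:
  assumes st: "normal_form_step mu B C D s t w x y z x' y' z'"
  shows "ip x1 y1 z1 x' y' z' = form x1 y1 z1 x y z"
proof -
  define yt where "yt = y + w *\<^sub>R (z v* C)"
  define b where "b = yt v* B"
  have x': "x' = dscale mu x + dscale (\<lambda>i. 1 - s * mu i) b"
    and z': "z' = C *v yt + D *v z - w *\<^sub>R (C *v y')"
    using st by (auto simp: normal_form_step_def Let_def b_def yt_def)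
  have b: "b $ i = (y v* B) $ i + w * ((z v* C) v* B) $ i" for i
    by (simp add: b_def yt_def vector_matrix_left_distrib scaleR_vector_matrix_assoc)
  have sx: "(\<Sum>i\<in>UNIV. scal i * x1 $ i * (scal i * x' $ i)) =
    (\<Sum>i\<in>UNIV. scal i * x1 $ i * (mu i * (scal i * x $ i) + kappa i * b $ i))"
    by (intro sum.cong refl) (simp add: x' algebra_simps flip: kappa_row)
  have sz: "z1 \<bullet> z' = (z1 v* C) \<bullet> yt + z1 \<bullet> (D *v z) - w * ((z1 v* C) \<bullet> y')"
    by (simp add: z' inner_diff_right inner_add_right flip: dot_lmul_matrix)
  show ?thesis
    unfolding ip_def sx sz step_second_row[OF st, folded yt_def b_def] form_def Let_def b
    by (simp add: yt_def inner_add_right inner_commute sum.distrib sum_subtractf sum_distrib_left algebra_simps)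
qed

lemma sq_norm_nonneg: "0 \<le> sq_norm x y z"
  by (simp add: sq_norm_def sum_nonneg)

lemma ip_self: "ip x y z x y z = sq_norm x y z"
  by (simp add: ip_def sq_norm_def power2_eq_square flip: power2_norm_eq_inner)

text \<open>
  On the diagonal all skew couplings drop out, and what remains of the form separates into a block in
  \<open>(X i)\<close> with \<open>i \<in> Iy\<close> and \<open>y\<close>, and a block in \<open>(X i)\<close> with \<open>i \<in> Iz\<close> and \<open>z\<close>. The squares
  \<open>(kappa i * _)\<^sup>2 / mu i\<close> are added here and subtracted again in \<open>py\<close> and \<open>pz\<close>, which brings both blocks
  into the shape of \<open>block_quadratic_form_bounds\<close>.
\<close>
lemma form_diag:
  "form x y z x y z =
     ((\<Sum>i\<in>Iy. mu i * (scal i * x $ i)\<^sup>2 + 2 * kappa i * (scal i * x $ i) * (y v* B) $ i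
          + (kappa i * (y v* B) $ i)\<^sup>2 / mu i) + (\<Sum>i\<in>UNIV. py i * ((y v* B) $ i)\<^sup>2))
   + ((\<Sum>i\<in>Iz. mu i * (scal i * x $ i)\<^sup>2 + 2 * (w * kappa i) * (scal i * x $ i) * ((z v* C) v* B) $ i
          + (w * kappa i * ((z v* C) v* B) $ i)\<^sup>2 / mu i) + schur_z z)"
proof -
  define u v where "u = y v* B" and "v = (z v* C) v* B"
  have ww: "w * w = w" using w01 by auto
  have ww': "w * (w * k) = w * k" for k using w01 by auto
  have "form x y z x y z = 
    (\<Sum>i\<in>UNIV. scal i * x $ i * (mu i * (scal i * x $ i) + kappa i * (u $ i + w * v $ i))
        + (u $ i - w * v $ i) * (q i * (u $ i + w * v $ i) - e i * kappa i * (scal i * x $ i)))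
     + 2 * w * (norm (z v* C))\<^sup>2 + z \<bullet> (D *v z)"
    by (simp add: form_def Let_def u_def v_def power2_norm_eq_inner inner_commute)
  also have "(\<Sum>i\<in>UNIV. scal i * x $ i * (mu i * (scal i * x $ i) + kappa i * (u $ i + w * v $ i))
        + (u $ i - w * v $ i) * (q i * (u $ i + w * v $ i) - e i * kappa i * (scal i * x $ i))) =
    (\<Sum>i\<in>Iy. mu i * (scal i * x $ i)\<^sup>2 + 2 * kappa i * (scal i * x $ i) * u $ i
          + (kappa i * u $ i)\<^sup>2 / mu i)  + (\<Sum>i\<in>UNIV. py i * (u $ i)\<^sup>2) 
   + (\<Sum>i\<in>Iz. mu i * (scal i * x $ i)\<^sup>2 + 2 * (w * kappa i) * (scal i * x $ i) * v $ i
          + (w * kappa i * v $ i)\<^sup>2 / mu i) - w * (\<Sum>i\<in>UNIV. pz i * (v $ i)\<^sup>2)"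
    (is "sum ?f UNIV = sum ?kp Iy + sum ?h1 UNIV + sum ?km Iz - w * sum ?h2 UNIV")
  proof -
    have fp: "?f i = ?kp i + ?h1 i - w * ?h2 i" if "e i = -1" for i
      using that w01 by (auto simp: py_def pz_def algebra_simps power2_eq_square)
    have fm: "?f i = ?km i + ?h1 i - w * ?h2 i" if "e i = 1" for i
      using that w01 by (auto simp: py_def pz_def algebra_simps power2_eq_square)
    have "sum ?f UNIV = (\<Sum>i\<in>Iy. ?kp i + ?h1 i - w * ?h2 i) + (\<Sum>i\<in>Iz. ?km i + ?h1 i - w * ?h2 i)"
      unfolding sum_split[of ?f] using fp fm by (intro arg_cong2[where f = "(+)"] sum.cong) auto
    then show ?thesis
      unfolding sum_split[of ?h1] sum_split[of ?h2]
      by (simp add: sum.distrib sum_subtractf sum_distrib_left algebra_simps)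
  qed
  finally show ?thesis
    unfolding schur_z_def u_def v_def by (simp add: algebra_simps)
qed

text \<open>
  The skew part is twice the difference of two brackets that arise from each other by exchanging the
  arguments. In the first one, \<open>x1\<close> on \<open>Iz\<close> and \<open>z1\<close> meet only \<open>y\<close> and \<open>x\<close> on \<open>Iy\<close>.
\<close>
lemma form_skew:
  "form x1 y1 z1 x y z - form x y z x1 y1 z1 =
   2 * ((\<Sum>i\<in>Iz. scal i * x1 $ i * (kappa i * (y v* B) $ i))
        + (y \<bullet> Gamma_op z1 - (\<Sum>i\<in>Iy. scal i * x $ i * (w * kappa i * ((z1 v* C) v* B) $ i))))
 - 2 * ((\<Sum>i\<in>Iz. scal i * x $ i * (kappa i * (y1 v* B) $ i))
        + (y1 \<bullet> Gamma_op z - (\<Sum>i\<in>Iy. scal i * x1 $ i * (w * kappa i * ((z v* C) v* B) $ i))))"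
proof -
  have Ds: "z \<bullet> (D *v z1) = z1 \<bullet> (D *v z)"
    by (metis D_sym dot_lmul_matrix inner_commute transpose_matrix_vector)
  have G: "y \<bullet> Gamma_op z = y \<bullet> (z v* C) - w * (\<Sum>i\<in>UNIV. (y v* B) $ i * (q i * ((z v* C) v* B) $ i))" for y z
    by (simp add: Gamma_op_def inner_diff_right inner_vec_def[of "_ v* _"] flip: dot_lmul_matrix)
  define X X1 where "X = (\<lambda>i. scal i * x $ i)" and "X1 = (\<lambda>i. scal i * x1 $ i)"
  define u u1 v v1 where "u = y v* B" and "u1 = y1 v* B" and "v = (z v* C) v* B" and "v1 = (z1 v* C) v* B"
  let ?f = "\<lambda>X1 u1 v1 X u v i. X1 i * (mu i * X i + kappa i * (u $ i + w * v $ i))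
        + (u1 $ i - w * v1 $ i) * (q i * (u $ i + w * v $ i) - e i * kappa i * X i)"
  let ?d = "\<lambda>i. ?f X1 u1 v1 X u v i - ?f X u v X1 u1 v1 i"
  let ?c = "\<lambda>i. 2 * w * (q i * (u1 $ i * v $ i - u $ i * v1 $ i))"
  have "?d i = 2 * (w * kappa i * (X1 i * v $ i - X i * v1 $ i)) + ?c i" if "e i = -1" for i
    using that by (simp add: algebra_simps)
  moreover have "?d i = 2 * (kappa i * (X1 i * u $ i - X i * u1 $ i)) + ?c i" if "e i = 1" for i
    using that by (simp add: algebra_simps)
  ultimately have "sum ?d UNIV = (\<Sum>i\<in>Iy. 2 * (w * kappa i * (X1 i * v $ i - X i * v1 $ i)) + ?c i)
      + (\<Sum>i\<in>Iz. 2 * (kappa i * (X1 i * u $ i - X i * u1 $ i)) + ?c i)"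
    unfolding sum_split[of ?d] by (intro arg_cong2[where f = "(+)"] sum.cong) auto
  also have "\<dots> = (\<Sum>i\<in>Iy. 2 * (w * kappa i * (X1 i * v $ i - X i * v1 $ i)))
      + (\<Sum>i\<in>Iz. 2 * (kappa i * (X1 i * u $ i - X i * u1 $ i))) + sum ?c UNIV"
    unfolding sum_split[of ?c] by (simp add: sum.distrib)
  finally have d: "sum (?f X1 u1 v1 X u v) UNIV - sum (?f X u v X1 u1 v1) UNIV = \<dots>"
    by (simp only: sum_subtractf)
  have "form x1 y1 z1 x y z - form x y z x1 y1 z1 =
      sum (?f X1 u1 v1 X u v) UNIV - sum (?f X u v X1 u1 v1) UNIV
       + 2 * ((z1 v* C) \<bullet> y) - 2 * ((z v* C) \<bullet> y1)"
    unfolding form_def Let_def Ds X_def X1_def u_def u1_def v_def v1_def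
    by (simp add: inner_commute)
  then show ?thesis
    unfolding d G unfolding X_def[symmetric] X1_def[symmetric] u_def[symmetric] v_def[symmetric] u1_def[symmetric] v1_def[symmetric]
    by (simp add: X_def X1_def sum_distrib_left sum_subtractf algebra_simps inner_commute)
qed

text \<open>
  The bracket is a bilinear form in the pairs (\<open>X1\<close> on \<open>Iz\<close>, \<open>z1\<close>) and (\<open>y\<close>, \<open>X\<close> on \<open>Iy\<close>). The block row of
  \<open>X1\<close> has squared norm at most \<open>f\<close> and that of \<open>z1\<close> at most \<open>p\<close>. Adding the rows and using that a product
  is at most the mean of the squares gives the bound.
\<close>
lemma skew_bracket:
  assumes f: "\<And>y. (\<Sum>i\<in>Iz. (kappa i * (y v* B) $ i)\<^sup>2) \<le> f * (norm y)\<^sup>2"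
    and p: "\<And>z. (norm (Gamma_op z))\<^sup>2 + (\<Sum>i\<in>Iy. (w * kappa i * ((z v* C) v* B) $ i)\<^sup>2) \<le> p * (norm z)\<^sup>2"
    and fp: "0 \<le> f" "0 \<le> p"
  shows "\<bar>(\<Sum>i\<in>Iz. X1 i * (kappa i * (y v* B) $ i))
        + (y \<bullet> Gamma_op z1 - (\<Sum>i\<in>Iy. X i * (w * kappa i * ((z1 v* C) v* B) $ i)))\<bar>
    \<le> sqrt (f + p) / 2 * ((\<Sum>i\<in>Iz. (X1 i)\<^sup>2) + (norm z1)\<^sup>2 + (\<Sum>i\<in>Iy. (X i)\<^sup>2) + (norm y)\<^sup>2)"
proof -
  define a c b where "a = L2_set X1 Iz" and "c = norm z1" and
    "b = sqrt ((L2_set X Iy)\<^sup>2 + (norm y)\<^sup>2)"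
  have nn: "0 \<le> a" "0 \<le> c" "0 \<le> b"
    by (simp_all add: a_def b_def c_def)
  have cs: "\<bar>\<Sum>i\<in>I. h i * k i\<bar> \<le> L2_set h I * L2_set k I" for I and h k :: "'n \<Rightarrow> real"
    using L2_set_mult_ineq[of h k I] sum_abs[of "\<lambda>i. h i * k i" I] by (simp add: abs_mult)
  have "norm y \<le> b"
    by (simp add: b_def real_le_rsqrt)
  have "\<bar>\<Sum>i\<in>Iz. X1 i * (kappa i * (y v* B) $ i)\<bar> \<le> a * L2_set (\<lambda>i. kappa i * (y v* B) $ i) Iz"
    unfolding a_def by (rule cs)
  also have "L2_set (\<lambda>i. kappa i * (y v* B) $ i) Iz \<le> sqrt f * norm y"
    unfolding L2_set_def using real_sqrt_le_mono[OF f[of y]] by (simp add: real_sqrt_mult)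
  also have "\<dots> \<le> sqrt f * b"
    using \<open>norm y \<le> b\<close> fp by (simp add: mult_left_mono)
  finally have 1: "\<bar>\<Sum>i\<in>Iz. X1 i * (kappa i * (y v* B) $ i)\<bar> \<le> a * (sqrt f * b)"
    using nn by (simp add: mult_left_mono)
  define k where "k = L2_set (\<lambda>i. w * kappa i * ((z1 v* C) v* B) $ i) Iy"
  have "\<bar>y \<bullet> Gamma_op z1 - (\<Sum>i\<in>Iy. X i * (w * kappa i * ((z1 v* C) v* B) $ i))\<bar>
     \<le> norm y * norm (Gamma_op z1) + L2_set X Iy * k"
    using Cauchy_Schwarz_ineq2[of y "Gamma_op z1"] cs[of X "\<lambda>i. w * kappa i * ((z1 v* C) v* B) $ i" Iy]
    unfolding k_def by linarith
  also have "\<dots> \<le> b * sqrt ((norm (Gamma_op z1))\<^sup>2 + k\<^sup>2)"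
  proof -
    have "norm y * norm (Gamma_op z1) + L2_set X Iy * k = (norm y, L2_set X Iy) \<bullet> (norm (Gamma_op z1), k)"
      by simp
    also have "\<dots> \<le> norm (norm y, L2_set X Iy) * norm (norm (Gamma_op z1), k)"
      by (rule norm_cauchy_schwarz)
    finally show ?thesis
      by (simp add: norm_prod_def b_def add.commute)
  qed
  also have "sqrt ((norm (Gamma_op z1))\<^sup>2 + k\<^sup>2) \<le> sqrt p * c"
  proof -
    have "(norm (Gamma_op z1))\<^sup>2 + k\<^sup>2 \<le> p * c\<^sup>2"
      using p[of z1] by (simp add: k_def c_def L2_set_def sum_nonneg)
    then show ?thesis
      using nn(2) real_sqrt_le_mono[of _ "p * c\<^sup>2"] by (simp add: real_sqrt_mult)
  qed
  finally have 2: "\<bar>y \<bullet> Gamma_op z1 - (\<Sum>i\<in>Iy. X i * (w * kappa i * ((z1 v* C) v* B) $ i))\<bar> \<le> b * (sqrt p * c)"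
    using nn by (simp add: mult_left_mono)
  have 3: "sqrt f * a + sqrt p * c \<le> sqrt (f + p) * sqrt (a\<^sup>2 + c\<^sup>2)"
  proof -
    have "sqrt f * a + sqrt p * c = (sqrt f, sqrt p) \<bullet> (a, c)"
      by simp
    also have "\<dots> \<le> norm (sqrt f, sqrt p) * norm (a, c)"
      by (rule norm_cauchy_schwarz)
    finally show ?thesis
      using fp by (simp add: norm_prod_def)
  qed
  have "\<bar>(\<Sum>i\<in>Iz. X1 i * (kappa i * (y v* B) $ i))
        + (y \<bullet> Gamma_op z1 - (\<Sum>i\<in>Iy. X i * (w * kappa i * ((z1 v* C) v* B) $ i)))\<bar>
      \<le> b * (sqrt f * a + sqrt p * c)"
    using 1 2 by (simp add: algebra_simps)
  also have "\<dots> \<le> b * (sqrt (f + p) * sqrt (a\<^sup>2 + c\<^sup>2))"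
    using 3 nn by (simp add: mult_left_mono)
  also have "\<dots> = sqrt (f + p) * (b * sqrt (a\<^sup>2 + c\<^sup>2))"
    by simp
  also have "\<dots> \<le> sqrt (f + p) * ((b\<^sup>2 + (a\<^sup>2 + c\<^sup>2)) / 2)"
  proof -
    have "0 \<le> (b - sqrt (a\<^sup>2 + c\<^sup>2))\<^sup>2" by simp
    then have "b * sqrt (a\<^sup>2 + c\<^sup>2) \<le> (b\<^sup>2 + (a\<^sup>2 + c\<^sup>2)) / 2"
      by (simp add: power2_diff)
    then show ?thesis
      using fp by (intro mult_left_mono) auto
  qed
  also have "b\<^sup>2 + (a\<^sup>2 + c\<^sup>2) = (\<Sum>i\<in>Iz. (X1 i)\<^sup>2) + (norm z1)\<^sup>2 + (\<Sum>i\<in>Iy. (X i)\<^sup>2) + (norm y)\<^sup>2"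
    by (simp add: a_def b_def c_def L2_set_def sum_nonneg)
  finally show ?thesis by simp
qed

lemma sq_norm_zero:
  "sq_norm x y z = 0 \<longleftrightarrow> (\<forall>i. scal i * x $ i = 0) \<and> y = 0 \<and> z = 0"
proof -
  have "0 \<le> (\<Sum>i\<in>UNIV. (scal i * x $ i)\<^sup>2)"
    by (simp add: sum_nonneg)
  then show ?thesis
    unfolding sq_norm_def
    by (auto simp: add_nonneg_eq_0_iff sum_nonneg_eq_0_iff)
qed

text \<open>
  Taking inner products of the two real eigenvalue equations with \<open>(x, y, z)\<close> and \<open>(x', y', z')\<close>
  isolates \<open>a\<close> in the sum of the diagonal values of the form and \<open>b\<close> in its skew part. If the inner
  product vanishes on the eigenvector, then \<open>y = z = 0\<close> and the first row says that the eigenvalue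
  is one of the \<open>mu i\<close>; the bounds hold for it because \<open>g1\<close> is at most and \<open>g2\<close> at least \<open>1\<close>.
\<close>
theorem normal_form_bounds_of_blocks:
  assumes cy: "0 \<le> cy" "0 \<le> dy" "\<And>i. e i = -1 \<Longrightarrow> cy \<le> mu i \<and> mu i \<le> dy"
    and r1: "\<And>y. cy * (norm y)\<^sup>2 \<le> (\<Sum>i\<in>UNIV. py i * ((y v* B) $ i)\<^sup>2)"
            "\<And>y. (\<Sum>i\<in>UNIV. py i * ((y v* B) $ i)\<^sup>2) \<le> dy * (norm y)\<^sup>2"
    and x1: "0 \<le> xi_y" "\<And>y. (\<Sum>i\<in>Iy. (kappa i * (y v* B) $ i / mu i)\<^sup>2) \<le> xi_y * (norm y)\<^sup>2"
    and cz: "0 \<le> cz" "0 \<le> dz" "\<And>i. e i = 1 \<Longrightarrow> cz \<le> mu i \<and> mu i \<le> dz"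
    and r2: "\<And>z. cz * (norm z)\<^sup>2 \<le> schur_z z" "\<And>z. schur_z z \<le> dz * (norm z)\<^sup>2"
    and x2: "0 \<le> xi_z" "\<And>z. (\<Sum>i\<in>Iz. (w * kappa i * ((z v* C) v* B) $ i / mu i)\<^sup>2) \<le> xi_z * (norm z)\<^sup>2"
    and f: "0 \<le> f" "\<And>y. (\<Sum>i\<in>Iz. (kappa i * (y v* B) $ i)\<^sup>2) \<le> f * (norm y)\<^sup>2"
    and p: "0 \<le> p" "\<And>z. (norm (Gamma_op z))\<^sup>2 + (\<Sum>i\<in>Iy. (w * kappa i * ((z v* C) v* B) $ i)\<^sup>2) \<le> p * (norm z)\<^sup>2"
    and lo: "lo \<le> cy * g1 xi_y" "lo \<le> cz * g1 xi_z"
    and hi: "dy * g2 xi_y \<le> hi" "dz * g2 xi_z \<le> hi"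
  shows "normal_form_bounds mu B C D s t w lo hi (f + p)"
  unfolding normal_form_bounds_def
proof (intro allI impI)
  fix a b x y z x' y' z'
  assume st: "normal_form_step mu B C D s t w x y z
          (a *\<^sub>R x - b *\<^sub>R x') (a *\<^sub>R y - b *\<^sub>R y') (a *\<^sub>R z - b *\<^sub>R z')"
    and st': "normal_form_step mu B C D s t w x' y' z'
          (b *\<^sub>R x + a *\<^sub>R x') (b *\<^sub>R y + a *\<^sub>R y') (b *\<^sub>R z + a *\<^sub>R z')"
    and nz: "\<not> (x = 0 \<and> y = 0 \<and> z = 0 \<and> x' = 0 \<and> y' = 0 \<and> z' = 0)"
  have sp: "sq_norm x y z = ((\<Sum>i\<in>Iy. (scal i * x $ i)\<^sup>2) + (norm y)\<^sup>2) + ((\<Sum>i\<in>Iz. (scal i * x $ i)\<^sup>2) + (norm z)\<^sup>2)" for x y z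
    unfolding sq_norm_def sum_split by simp
  have I1: "0 < mu i \<and> cy \<le> mu i \<and> mu i \<le> dy" if "i \<in> Iy" for i
    using that cy(3) mu_pos by auto
  have I2: "0 < mu i \<and> cz \<le> mu i \<and> mu i \<le> dz" if "i \<in> Iz" for i
    using that cz(3) mu_pos by auto
  have blk1: "cy * g1 xi_y * ((\<Sum>i\<in>Iy. (scal i * x $ i)\<^sup>2) + (norm y)\<^sup>2) \<le> (\<Sum>i\<in>Iy. mu i * (scal i * x $ i)\<^sup>2 + 2 * kappa i * (scal i * x $ i) * (y v* B) $ i
          + (kappa i * (y v* B) $ i)\<^sup>2 / mu i) + (\<Sum>i\<in>UNIV. py i * ((y v* B) $ i)\<^sup>2)"
     "(\<Sum>i\<in>Iy. mu i * (scal i * x $ i)\<^sup>2 + 2 * kappa i * (scal i * x $ i) * (y v* B) $ i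
          + (kappa i * (y v* B) $ i)\<^sup>2 / mu i) + (\<Sum>i\<in>UNIV. py i * ((y v* B) $ i)\<^sup>2) \<le>
      dy * g2 xi_y * ((\<Sum>i\<in>Iy. (scal i * x $ i)\<^sup>2) + (norm y)\<^sup>2)" for x y
    using block_quadratic_form_bounds[where I = Iy and mu = mu and x = "\<lambda>i. scal i * x $ i" and kappa = kappa
        and u = "\<lambda>i. (y v* B) $ i" and Y = "(norm y)\<^sup>2",
      OF finite I1 r1(1)[of y] r1(2)[of y] zero_le_power2 cy(1) cy(2) x1(1) x1(2)[of y]] by simp_all
  have blk2: "cz * g1 xi_z * ((\<Sum>i\<in>Iz. (scal i * x $ i)\<^sup>2) + (norm z)\<^sup>2) \<le> (\<Sum>i\<in>Iz. mu i * (scal i * x $ i)\<^sup>2 + 2 * (w * kappa i) * (scal i * x $ i) * ((z v* C) v* B) $ i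
          + (w * kappa i * ((z v* C) v* B) $ i)\<^sup>2 / mu i) + schur_z z"
     "(\<Sum>i\<in>Iz. mu i * (scal i * x $ i)\<^sup>2 + 2 * (w * kappa i) * (scal i * x $ i) * ((z v* C) v* B) $ i
          + (w * kappa i * ((z v* C) v* B) $ i)\<^sup>2 / mu i) + schur_z z \<le>
      dz * g2 xi_z * ((\<Sum>i\<in>Iz. (scal i * x $ i)\<^sup>2) + (norm z)\<^sup>2)" for x z
    using block_quadratic_form_bounds[where I = Iz and mu = mu and x = "\<lambda>i. scal i * x $ i" and kappa = "\<lambda>i. w * kappa i"
        and u = "\<lambda>i. ((z v* C) v* B) $ i" and Y = "(norm z)\<^sup>2",
      OF finite I2 r2(1)[of z] r2(2)[of z] zero_le_power2 cz(1) cz(2) x2(1) x2(2)[of z]] by simp_all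
  have lo_form: "lo * sq_norm x y z \<le> form x y z x y z" for x y z
  proof -
    have "lo * ((\<Sum>i\<in>Iy. (scal i * x $ i)\<^sup>2) + (norm y)\<^sup>2) \<le> cy * g1 xi_y * ((\<Sum>i\<in>Iy. (scal i * x $ i)\<^sup>2) + (norm y)\<^sup>2)"
      "lo * ((\<Sum>i\<in>Iz. (scal i * x $ i)\<^sup>2) + (norm z)\<^sup>2) \<le> cz * g1 xi_z * ((\<Sum>i\<in>Iz. (scal i * x $ i)\<^sup>2) + (norm z)\<^sup>2)"
      using lo by (auto intro!: mult_right_mono add_nonneg_nonneg sum_nonneg)
    then show ?thesis
      using blk1(1)[of x y] blk2(1)[of x z] unfolding form_diag sp distrib_left by linarith
  qed
  have hi_form: "form x y z x y z \<le> hi * sq_norm x y z" for x y z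
  proof -
    have "dy * g2 xi_y * ((\<Sum>i\<in>Iy. (scal i * x $ i)\<^sup>2) + (norm y)\<^sup>2) \<le> hi * ((\<Sum>i\<in>Iy. (scal i * x $ i)\<^sup>2) + (norm y)\<^sup>2)"
      "dz * g2 xi_z * ((\<Sum>i\<in>Iz. (scal i * x $ i)\<^sup>2) + (norm z)\<^sup>2) \<le> hi * ((\<Sum>i\<in>Iz. (scal i * x $ i)\<^sup>2) + (norm z)\<^sup>2)"
      using hi by (auto intro!: mult_right_mono add_nonneg_nonneg sum_nonneg)
    then show ?thesis
      using blk1(2)[of x y] blk2(2)[of x z] unfolding form_diag sp distrib_left by linarith
  qed
  let ?S = "sq_norm x y z + sq_norm x' y' z'"
  have ip_lin: "ip x1 y1 z1 (k *\<^sub>R x + l *\<^sub>R x') (k *\<^sub>R y + l *\<^sub>R y') (k *\<^sub>R z + l *\<^sub>R z')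
      = k * ip x1 y1 z1 x y z + l * ip x1 y1 z1 x' y' z'" for x1 y1 z1 k l
    unfolding ip_def
    by (simp add: inner_add_right algebra_simps sum.distrib sum_distrib_left)
  have ip_sym: "ip x' y' z' x y z = ip x y z x' y' z'"
    by (simp add: ip_def inner_commute mult.commute)
  have E: "form x y z x y z = a * sq_norm x y z - b * ip x y z x' y' z'"
      "form x' y' z' x y z = a * ip x y z x' y' z' - b * sq_norm x' y' z'" 
    using ip_lin[of _ _ _ a "- b"] by (simp_all add: ip_self ip_sym flip: ip_step[OF st])
  have E': "form x' y' z' x' y' z' = b * ip x y z x' y' z' + a * sq_norm x' y' z'"
      "form x y z x' y' z' = b * sq_norm x y z + a * ip x y z x' y' z'"
    using ip_lin[of _ _ _ b a] by (simp_all add: ip_self ip_sym flip: ip_step[OF st'])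
  \<comment> \<open>the case distinction is whether the semi-inner product sees the eigenvector\<close>
  show "lo \<le> a \<and> a \<le> hi \<and> \<bar>b\<bar> \<le> sqrt (f + p)"
  proof (cases "?S = 0")
    case False
    then have S: "0 < ?S"
      using sq_norm_nonneg[of x y z] sq_norm_nonneg[of x' y' z'] by linarith
    have "a * ?S = form x y z x y z + form x' y' z' x' y' z'"
      using E E' by (simp add: algebra_simps)
    then have "lo * ?S \<le> a * ?S" "a * ?S \<le> hi * ?S"
      using lo_form[of x y z] lo_form[of x' y' z'] hi_form[of x y z] hi_form[of x' y' z']
      by (simp_all add: distrib_left)
    moreover have "\<bar>b\<bar> * ?S \<le> sqrt (f + p) * ?S"
    proof -
      have "\<bar>b\<bar> * ?S = \<bar>form x y z x' y' z' - form x' y' z' x y z\<bar>"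
        using S by (simp add: E E' abs_mult flip: distrib_left)
      also have "\<dots> \<le> sqrt (f + p) * ?S"
      proof -
        have comb: "\<bar>2 * T1 - 2 * T2\<bar> \<le> k * (N1 + N2)"
          if "\<bar>T1\<bar> \<le> k / 2 * N1" "\<bar>T2\<bar> \<le> k / 2 * N2" for T1 T2 k N1 N2 :: real
          using that unfolding distrib_left by linarith
        have S_split: "?S = ((\<Sum>i\<in>Iz. (scal i * x $ i)\<^sup>2) + (norm z)\<^sup>2 + (\<Sum>i\<in>Iy. (scal i * x' $ i)\<^sup>2) + (norm y')\<^sup>2)
            + ((\<Sum>i\<in>Iz. (scal i * x' $ i)\<^sup>2) + (norm z')\<^sup>2 + (\<Sum>i\<in>Iy. (scal i * x $ i)\<^sup>2) + (norm y)\<^sup>2)"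
          unfolding sp by simp
        show ?thesis
          unfolding form_skew[of x y z x' y' z'] S_split
          by (rule comb; rule skew_bracket[OF f(2) p(2) f(1) p(1)])
      qed
      finally show ?thesis .
    qed
    ultimately show ?thesis
      using S by (auto simp: mult_le_cancel_right)
  next
    case True
    then have z0: "sq_norm x y z = 0" "sq_norm x' y' z' = 0"
      using sq_norm_nonneg[of x y z] sq_norm_nonneg[of x' y' z'] by linarith+
    then have "y = 0" "z = 0" "y' = 0" "z' = 0"
      by (auto simp: sq_norm_zero)
    then obtain i where i: "x $ i \<noteq> 0 \<or> x' $ i \<noteq> 0"
      using nz by (auto simp: vec_eq_iff)
    have "a *\<^sub>R x - b *\<^sub>R x' = dscale mu x" "b *\<^sub>R x + a *\<^sub>R x' = dscale mu x'"
      using st st' \<open>y = 0\<close> \<open>z = 0\<close> \<open>y' = 0\<close> \<open>z' = 0\<close>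
      by (simp_all add: normal_form_step_def)
    then have "a * x $ i - b * x' $ i = mu i * x $ i" "b * x $ i + a * x' $ i = mu i * x' $ i"
      by (simp_all add: vec_eq_iff)
    then have "(a - mu i) * x $ i - b * x' $ i = 0" "(a - mu i) * x' $ i + b * x $ i = 0"
      by (simp_all add: algebra_simps)
    moreover have "((a - mu i) * x $ i - b * x' $ i)\<^sup>2 + ((a - mu i) * x' $ i + b * x $ i)\<^sup>2
        = ((a - mu i)\<^sup>2 + b\<^sup>2) * ((x $ i)\<^sup>2 + (x' $ i)\<^sup>2)"
      by (simp add: power2_eq_square algebra_simps)
    ultimately have "(a - mu i)\<^sup>2 + b\<^sup>2 = 0"
      using i by (auto simp: sum_power2_eq_zero_iff)
    then have ab: "a = mu i" "b = 0"
      by (simp_all add: sum_power2_eq_zero_iff)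
    have "c * g1 xi \<le> a" if "c \<le> mu i" "0 \<le> c" "0 \<le> xi" for c xi
      using mult_left_mono[OF g1_le_1 that(2), of xi] that ab by simp
    moreover have "a \<le> d * g2 xi" if "mu i \<le> d" "0 \<le> xi" for d xi
    proof -
      have "d * 1 \<le> d * g2 xi"
        using mu_pos[of i] that by (intro mult_left_mono g2_ge_1) auto
      then show ?thesis using that ab by simp
    qed
    ultimately have "(cy * g1 xi_y \<le> a \<and> a \<le> dy * g2 xi_y) \<or> (cz * g1 xi_z \<le> a \<and> a \<le> dz * g2 xi_z)"
      using e_cases[of i] cy cz x1(1) x2(1) by blast
    then have "lo \<le> a \<and> a \<le> hi"
      using lo hi by linarith
    then show ?thesis
      using ab f p by simp
  qed
qed

end

section \<open>Eigenvalue data of the normal form\<close>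

text \<open>
  Bounds for the spectra of the matrices \<open>N\<close>, \<open>Sh\<^sup>-\<^sup>1 S\<close> and so on, written as quadratic form inequalities in normal
  form coordinates. In these \<open>S\<close> is \<open>B diag(1 / mu) B\<^sup>T\<close>. The attained minimum guarantees
  an index with \<open>mu i < 1\<close> in the mixed case.
\<close>
locale normal_data =
  fixes mu :: "'n::finite \<Rightarrow> real" and B :: "real^'n^'m" and C :: "real^'m^'l" and D :: "real^'l^'l"
    and mulo muhi nulo nuhi omlo omhi taulo tauhi thlo thhi :: real
  assumes D_symm: "transpose D = D"
    and mulo_pos: "0 < mulo" and mulo_le: "\<And>i. mulo \<le> mu i" and le_muhi: "\<And>i. mu i \<le> muhi"
    and mulo_attained: "\<exists>i. mu i = mulo"
    and nonneg: "0 \<le> nulo" "nulo \<le> nuhi" "0 \<le> omlo" "omlo \<le> omhi" "0 \<le> taulo" "taulo \<le> tauhi" "0 \<le> thlo" "thlo \<le> thhi"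
    and nu: "\<And>y. nulo * (norm y)\<^sup>2 \<le> (\<Sum>i\<in>UNIV. ((y v* B) $ i)\<^sup>2 / mu i)"
            "\<And>y. (\<Sum>i\<in>UNIV. ((y v* B) $ i)\<^sup>2 / mu i) \<le> nuhi * (norm y)\<^sup>2"
    and om: "\<And>z. omlo * (norm z)\<^sup>2 \<le> (norm (z v* C))\<^sup>2" "\<And>z. (norm (z v* C))\<^sup>2 \<le> omhi * (norm z)\<^sup>2"
    and tau: "\<And>z. taulo * (norm z)\<^sup>2 \<le> z \<bullet> (D *v z)" "\<And>z. z \<bullet> (D *v z) \<le> tauhi * (norm z)\<^sup>2"
    and th: "\<And>z. thlo * (norm z)\<^sup>2 \<le> z \<bullet> (D *v z) + (norm (z v* C))\<^sup>2"
            "\<And>z. z \<bullet> (D *v z) + (norm (z v* C))\<^sup>2 \<le> thhi * (norm z)\<^sup>2"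
begin

lemma mu_gt_0: "0 < mu i"
  using mulo_pos mulo_le[of i] by linarith

lemma mulo_le_muhi: "mulo \<le> muhi"
  using mulo_le le_muhi order.trans by blast

lemma muhi_pos: "0 < muhi"
  using mulo_le_muhi mulo_pos by linarith

lemma D_nonneg: "0 \<le> z \<bullet> (D *v z)"
  using tau(1)[of z] mult_nonneg_nonneg[OF nonneg(5) zero_le_power2[of "norm z"]] by linarith

text \<open>
  A matrix \<open>B \<phi>(A) B\<^sup>T\<close> is bounded by \<open>S\<close> times an upper bound of \<open>\<phi>(\<mu>) \<mu>\<close>, because \<open>S = B A\<^sup>-\<^sup>1 B\<^sup>T\<close>.
\<close>
lemma weighted_sum_le:
  assumes "0 \<le> m" "\<And>i. i \<in> I \<Longrightarrow> phi i * mu i \<le> m"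
  shows "(\<Sum>i\<in>I. phi i * ((y v* B) $ i)\<^sup>2) \<le> m * nuhi * (norm y)\<^sup>2"
proof -
  have "(\<Sum>i\<in>I. phi i * ((y v* B) $ i)\<^sup>2) \<le> (\<Sum>i\<in>I. m * (((y v* B) $ i)\<^sup>2 / mu i))"
  proof (rule sum_mono)
    fix i assume "i \<in> I"
    have "phi i * ((y v* B) $ i)\<^sup>2 = (phi i * mu i) * (((y v* B) $ i)\<^sup>2 / mu i)"
      using mu_gt_0[of i] by simp
    also have "\<dots> \<le> m * (((y v* B) $ i)\<^sup>2 / mu i)"
      using assms(2)[OF \<open>i \<in> I\<close>] mu_gt_0[of i] by (intro mult_right_mono divide_nonneg_pos) auto
    finally show "phi i * ((y v* B) $ i)\<^sup>2 \<le> m * (((y v* B) $ i)\<^sup>2 / mu i)" .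
  qed
  also have "\<dots> = m * (\<Sum>i\<in>I. ((y v* B) $ i)\<^sup>2 / mu i)"
    by (simp add: sum_distrib_left)
  also have "(\<Sum>i\<in>I. ((y v* B) $ i)\<^sup>2 / mu i) \<le> (\<Sum>i\<in>UNIV. ((y v* B) $ i)\<^sup>2 / mu i)"
    using mu_gt_0 by (intro sum_mono2) (auto intro: divide_nonneg_pos)
  also have "\<dots> \<le> nuhi * (norm y)\<^sup>2"
    by (rule nu)
  finally show ?thesis
    using assms(1) by (simp add: mult_left_mono mult.assoc)
qed

lemma weighted_sum_ge:
  assumes "0 \<le> m" "\<And>i. m \<le> phi i * mu i"
  shows "m * nulo * (norm y)\<^sup>2 \<le> (\<Sum>i\<in>UNIV. phi i * ((y v* B) $ i)\<^sup>2)"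
proof -
  have "m * nulo * (norm y)\<^sup>2 \<le> m * (\<Sum>i\<in>UNIV. ((y v* B) $ i)\<^sup>2 / mu i)"
    using assms(1) nu(1)[of y] by (simp add: mult_left_mono mult.assoc)
  also have "\<dots> = (\<Sum>i\<in>UNIV. m * (((y v* B) $ i)\<^sup>2 / mu i))"
    by (simp add: sum_distrib_left)
  also have "\<dots> \<le> (\<Sum>i\<in>UNIV. phi i * ((y v* B) $ i)\<^sup>2)"
  proof (rule sum_mono)
    fix i
    have "m * (((y v* B) $ i)\<^sup>2 / mu i) \<le> (phi i * mu i) * (((y v* B) $ i)\<^sup>2 / mu i)"
      using assms(2)[of i] mu_gt_0[of i] by (intro mult_right_mono divide_nonneg_pos) auto
    then show "m * (((y v* B) $ i)\<^sup>2 / mu i) \<le> phi i * ((y v* B) $ i)\<^sup>2"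
      using mu_gt_0[of i] by simp
  qed
  finally show ?thesis .
qed

text \<open>
  Here \<open>F\<close> stands for the quadratic form of \<open>C X C\<^sup>T\<close>. For \<open>t \<le> 1\<close> one copy of \<open>C C\<^sup>T\<close> is combined with \<open>D\<close>
  into \<open>theta\<close> and the other keeps a nonnegative factor. For \<open>t > 1\<close> both copies are needed to
  compensate \<open>F\<close>, and \<open>D\<close> is bounded on its own.
\<close>
lemma h_lower:
  assumes "0 \<le> t" "t \<le> 2"
  shows "0 \<le> h_fun thlo taulo omlo t + omlo * (1 - t)"
    and "F \<le> t * (norm (z v* C))\<^sup>2 \<Longrightarrow>
      (h_fun thlo taulo omlo t + omlo * (1 - t)) * (norm z)\<^sup>2 \<le> z \<bullet> (D *v z) + (2 * (norm (z v* C))\<^sup>2 - F)"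
proof -
  show "0 \<le> h_fun thlo taulo omlo t + omlo * (1 - t)"
  proof (cases "t \<le> 1")
    case False
    have "0 \<le> taulo + omlo * (2 - t)" using nonneg assms by simp
    then show ?thesis using False by (simp add: h_fun_def algebra_simps)
  qed (simp add: h_fun_def nonneg)
  assume F: "F \<le> t * (norm (z v* C))\<^sup>2"
  show "(h_fun thlo taulo omlo t + omlo * (1 - t)) * (norm z)\<^sup>2 \<le> z \<bullet> (D *v z) + (2 * (norm (z v* C))\<^sup>2 - F)"
  proof (cases "t \<le> 1")
    case True
    have "(1 - t) * (omlo * (norm z)\<^sup>2) \<le> (1 - t) * (norm (z v* C))\<^sup>2"
      using True om by (intro mult_left_mono) auto
    then show ?thesis using True F th(1)[of z] by (simp add: h_fun_def algebra_simps)
  next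
    case False
    have "(2 - t) * (omlo * (norm z)\<^sup>2) \<le> (2 - t) * (norm (z v* C))\<^sup>2"
      using assms om by (intro mult_left_mono) auto
    then show ?thesis using False F tau(1)[of z] by (simp add: h_fun_def algebra_simps)
  qed
qed

lemma h_upper:
  assumes "0 \<le> t0" "t0 \<le> t" "t \<le> 2"
  shows "0 \<le> h_fun thhi tauhi omhi t + omhi * (1 - t0)"
    and "t0 * (norm (z v* C))\<^sup>2 \<le> F \<Longrightarrow>
      z \<bullet> (D *v z) + (2 * (norm (z v* C))\<^sup>2 - F) \<le> (h_fun thhi tauhi omhi t + omhi * (1 - t0)) * (norm z)\<^sup>2"
proof -
  show "0 \<le> h_fun thhi tauhi omhi t + omhi * (1 - t0)"
  proof (cases "t \<le> 1")
    case True
    then show ?thesis using assms nonneg by (simp add: h_fun_def)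
  next
    case False
    have "0 \<le> tauhi + omhi * (2 - t0)" using nonneg assms by simp
    then show ?thesis using False by (simp add: h_fun_def algebra_simps)
  qed
  assume F: "t0 * (norm (z v* C))\<^sup>2 \<le> F"
  show "z \<bullet> (D *v z) + (2 * (norm (z v* C))\<^sup>2 - F) \<le> (h_fun thhi tauhi omhi t + omhi * (1 - t0)) * (norm z)\<^sup>2"
  proof (cases "t \<le> 1")
    case True
    have "(1 - t0) * (norm (z v* C))\<^sup>2 \<le> (1 - t0) * (omhi * (norm z)\<^sup>2)"
      using True assms om by (intro mult_left_mono) auto
    then show ?thesis using True F th(2)[of z] by (simp add: h_fun_def algebra_simps)
  next
    case False
    have "(2 - t0) * (norm (z v* C))\<^sup>2 \<le> (2 - t0) * (omhi * (norm z)\<^sup>2)"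
      using assms om by (intro mult_left_mono) auto
    then show ?thesis using False F tau(2)[of z] by (simp add: h_fun_def algebra_simps)
  qed
qed

end

locale bounded_normal_form =
  normal_data mu B C D mulo muhi nulo nuhi omlo omhi taulo tauhi thlo thhi
  + normal_form mu B C D s t w scal kappa e
  for mu :: "'n::finite \<Rightarrow> real" and B :: "real^'n^'m" and C :: "real^'m^'l" and D :: "real^'l^'l"
    and mulo muhi nulo nuhi omlo omhi taulo tauhi thlo thhi s t w :: real and scal kappa e :: "'n \<Rightarrow> real"
begin

lemma schur_z_0: "w = 0 \<Longrightarrow> schur_z z = z \<bullet> (D *v z)"
  unfolding schur_z_def by simp

text \<open>
  The Schur complement of the \<open>z\<close>-block is \<open>D + C (2 I - X) C\<^sup>T\<close> with \<open>X = B diag(pz) B\<^sup>T\<close>.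
\<close>
lemma schur_z_1:
  assumes w: "w = 1" and m: "0 \<le> m1" "\<And>i. m1 \<le> pz i * mu i" "\<And>i. pz i * mu i \<le> m2" "m2 * nuhi \<le> 2"
  shows "0 \<le> h_fun thlo taulo omlo (m2 * nuhi) + omlo * (1 - m2 * nuhi)"
    and "0 \<le> h_fun thhi tauhi omhi (m2 * nuhi) + omhi * (1 - m1 * nulo)"
    and "(h_fun thlo taulo omlo (m2 * nuhi) + omlo * (1 - m2 * nuhi)) * (norm z)\<^sup>2 \<le> schur_z z"
    and "schur_z z \<le> (h_fun thhi tauhi omhi (m2 * nuhi) + omhi * (1 - m1 * nulo)) * (norm z)\<^sup>2"
proof -
  have m12: "m1 \<le> m2" using m(2,3) order.trans by blast
  then have t: "0 \<le> m1 * nulo" "m1 * nulo \<le> m2 * nuhi"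
    using m(1) nonneg by (auto intro: mult_mono)
  then have t': "0 \<le> m2 * nuhi" by linarith
  have sc: "schur_z z = z \<bullet> (D *v z) + (2 * (norm (z v* C))\<^sup>2 - (\<Sum>i\<in>UNIV. pz i * (((z v* C) v* B) $ i)\<^sup>2))"
    unfolding schur_z_def by (simp add: w)
  show "0 \<le> h_fun thlo taulo omlo (m2 * nuhi) + omlo * (1 - m2 * nuhi)"
    by (rule h_lower(1)[OF t' m(4)])
  show "0 \<le> h_fun thhi tauhi omhi (m2 * nuhi) + omhi * (1 - m1 * nulo)"
    by (rule h_upper(1)[OF t m(4)])
  show "(h_fun thlo taulo omlo (m2 * nuhi) + omlo * (1 - m2 * nuhi)) * (norm z)\<^sup>2 \<le> schur_z z"
    unfolding sc using m m12 by (intro h_lower(2)[OF t' m(4)] weighted_sum_le) auto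
  show "schur_z z \<le> (h_fun thhi tauhi omhi (m2 * nuhi) + omhi * (1 - m1 * nulo)) * (norm z)\<^sup>2"
    unfolding sc using m by (intro h_upper(2)[OF t m(4)] weighted_sum_ge) auto
qed

lemma Gamma_op_0:
  assumes "w = 0"
  shows "(norm (Gamma_op z))\<^sup>2 + (\<Sum>i\<in>Iy. (w * kappa i * ((z v* C) v* B) $ i)\<^sup>2) \<le> omhi * (norm z)\<^sup>2"
  using om unfolding Gamma_op_def by (simp add: assms)

text \<open>
  The squared norm of the block row of \<open>z\<close> in the skew part, which is \<open>C (I - Q)\<close> next to the columns of
  \<open>C B diag(kappa)\<close> that belong to \<open>Iy\<close>. Here \<open>Q = B diag(q) B\<^sup>T\<close> has its spectrum in \<open>[s1 * nulo, s2 * nuhi]\<close>; \<open>varrho\<close> bounds \<open>(I - Q)\<^sup>2\<close>.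
\<close>
lemma Gamma_op_1:
  assumes w: "w = 1" and s: "0 \<le> s1" "0 \<le> s2" "\<And>i. s1 \<le> q i * mu i" "\<And>i. q i * mu i \<le> s2"
    and km: "0 \<le> km" "\<And>i. e i = -1 \<Longrightarrow> (kappa i)\<^sup>2 * mu i \<le> km"
  shows "(norm (Gamma_op z))\<^sup>2 + (\<Sum>i\<in>Iy. (w * kappa i * ((z v* C) v* B) $ i)\<^sup>2)
    \<le> omhi * (km * nuhi + varrho (s2 * nuhi) (s1 * nulo)) * (norm z)\<^sup>2"
proof -
  define T where "T y = y - B *v dscale q (y v* B)" for y
  let ?r = "varrho (s2 * nuhi) (s1 * nulo)"
  have r0: "0 \<le> ?r" by (simp add: varrho_def max_def)
  have "linear T"
    by (rule linearI)
      (simp_all add: T_def vec_eq_iff algebra_simps matrix_vector_mult_def vector_matrix_mult_def sum.distrib sum_distrib_left)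
  moreover have ip: "x \<bullet> T y = x \<bullet> y - (\<Sum>i\<in>UNIV. q i * ((x v* B) $ i * (y v* B) $ i))" for x y
    by (simp add: T_def inner_diff_right flip: dot_lmul_matrix)
       (simp add: inner_vec_def mult.left_commute)
  have "x \<bullet> T y = T x \<bullet> y" for x y
    by (simp add: ip inner_commute[of "T x"]) (simp add: inner_commute mult.commute)
  moreover have "\<bar>y \<bullet> T y\<bar> \<le> sqrt ?r * (norm y)\<^sup>2" for y
  proof -
    have y: "y \<bullet> T y = (norm y)\<^sup>2 - (\<Sum>i\<in>UNIV. q i * ((y v* B) $ i)\<^sup>2)"
      by (simp add: ip power2_norm_eq_inner power2_eq_square[of "_ $ _"])
    have "\<bar>1 - s1 * nulo\<bar> \<le> sqrt ?r" "\<bar>s2 * nuhi - 1\<bar> \<le> sqrt ?r"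
      by (simp_all add: varrho_def real_le_rsqrt)
    then have "1 - s1 * nulo \<le> sqrt ?r" "s2 * nuhi - 1 \<le> sqrt ?r"
      by linarith+
    then have "(1 - s1 * nulo) * (norm y)\<^sup>2 \<le> sqrt ?r * (norm y)\<^sup>2" "(s2 * nuhi - 1) * (norm y)\<^sup>2 \<le> sqrt ?r * (norm y)\<^sup>2"
      by (auto intro: mult_right_mono)
    moreover have "s1 * nulo * (norm y)\<^sup>2 \<le> (\<Sum>i\<in>UNIV. q i * ((y v* B) $ i)\<^sup>2)"
      "(\<Sum>i\<in>UNIV. q i * ((y v* B) $ i)\<^sup>2) \<le> s2 * nuhi * (norm y)\<^sup>2"
      using s by (auto intro: weighted_sum_ge weighted_sum_le)
    ultimately show ?thesis
      unfolding y by (simp add: abs_le_iff algebra_simps)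
  qed
  ultimately have "norm (T (z v* C)) \<le> sqrt ?r * norm (z v* C)"
    by (rule norm_le_of_quadratic_form)
  then have "(norm (T (z v* C)))\<^sup>2 \<le> (sqrt ?r * norm (z v* C))\<^sup>2"
    by (intro power_mono) auto
  also have "\<dots> = ?r * (norm (z v* C))\<^sup>2"
    using r0 by (simp add: power_mult_distrib)
  finally have 1: "(norm (Gamma_op z))\<^sup>2 \<le> ?r * (norm (z v* C))\<^sup>2"
    unfolding Gamma_op_def T_def by (simp add: w)
  have 2: "(\<Sum>i\<in>Iy. (w * kappa i * ((z v* C) v* B) $ i)\<^sup>2) \<le> km * nuhi * (norm (z v* C))\<^sup>2"
    unfolding w mult_1 power_mult_distrib using km by (intro weighted_sum_le) auto
  have "(norm (Gamma_op z))\<^sup>2 + (\<Sum>i\<in>Iy. (w * kappa i * ((z v* C) v* B) $ i)\<^sup>2)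
      \<le> (km * nuhi + ?r) * (norm (z v* C))\<^sup>2"
    using 1 2 by (simp add: algebra_simps)
  also have "\<dots> \<le> (km * nuhi + ?r) * (omhi * (norm z)\<^sup>2)"
    using r0 km nonneg om by (intro mult_left_mono) auto
  finally show ?thesis by (simp add: algebra_simps)
qed

text \<open>
  The hypotheses on the blocks are reduced to inequalities for each \<open>mu i\<close> separately, so that a
  preconditioner is treated by verifying scalar inequalities. The bounds on \<open>schur_z\<close> and on the skew
  block row of \<open>z\<close> remain hypotheses because their form depends on \<open>w\<close>.
\<close>
theorem normal_form_bounds_scalar:
  assumes py: "0 \<le> ly" "0 \<le> uy" "\<And>i. ly \<le> py i * mu i" "\<And>i. py i * mu i \<le> uy"
    and b1: "0 \<le> cy" "0 \<le> dy" "cy \<le> ly * nulo" "uy * nuhi \<le> dy" "\<And>i. e i = -1 \<Longrightarrow> cy \<le> mu i \<and> mu i \<le> dy"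
    and ky: "0 \<le> ky" "\<And>i. e i = -1 \<Longrightarrow> (kappa i)\<^sup>2 / mu i \<le> ky"
    and b2: "0 \<le> cz" "0 \<le> dz" "\<And>z. cz * (norm z)\<^sup>2 \<le> schur_z z" "\<And>z. schur_z z \<le> dz * (norm z)\<^sup>2"
      "\<And>i. e i = 1 \<Longrightarrow> cz \<le> mu i \<and> mu i \<le> dz"
    and kz: "0 \<le> kz" "\<And>i. e i = 1 \<Longrightarrow> w * (kappa i)\<^sup>2 / mu i \<le> kz"
    and f: "0 \<le> f" "\<And>i. e i = 1 \<Longrightarrow> (kappa i)\<^sup>2 * mu i \<le> f"
    and p: "0 \<le> p" "\<And>z. (norm (Gamma_op z))\<^sup>2 + (\<Sum>i\<in>Iy. (w * kappa i * ((z v* C) v* B) $ i)\<^sup>2) \<le> p * (norm z)\<^sup>2"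
    and lo: "lo \<le> cy * g1 (ky * nuhi)" "lo \<le> cz * g1 (kz * nuhi * omhi)"
    and hi: "dy * g2 (ky * nuhi) \<le> hi" "dz * g2 (kz * nuhi * omhi) \<le> hi"
    and r: "r = f * nuhi + p"
  shows "normal_form_bounds mu B C D s t w lo hi r"
  unfolding r
proof (rule normal_form_bounds_of_blocks[OF b1(1,2,5) _ _ _ _ b2(1,2,5,3,4) _ _ _ _ p lo hi])
  fix y :: "real^'m"
  have mu_cancel: "c / (mu i)\<^sup>2 * mu i = c / mu i" for c i
    using mu_gt_0[of i] by (simp add: power2_eq_square)
  show "cy * (norm y)\<^sup>2 \<le> (\<Sum>i\<in>UNIV. py i * ((y v* B) $ i)\<^sup>2)"
    using weighted_sum_ge[of ly py y, OF py(1,3)] mult_right_mono[OF b1(3), of "(norm y)\<^sup>2"] by simp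
  show "(\<Sum>i\<in>UNIV. py i * ((y v* B) $ i)\<^sup>2) \<le> dy * (norm y)\<^sup>2"
    using weighted_sum_le[of uy UNIV py y, OF py(2,4)] mult_right_mono[OF b1(4), of "(norm y)\<^sup>2"] by simp
  show "0 \<le> ky * nuhi" "0 \<le> kz * nuhi * omhi" "0 \<le> f * nuhi"
    using ky kz f nonneg by simp_all
  show "(\<Sum>i\<in>Iy. (kappa i * (y v* B) $ i / mu i)\<^sup>2) \<le> ky * nuhi * (norm y)\<^sup>2"
    using weighted_sum_le[of ky Iy "\<lambda>i. (kappa i)\<^sup>2 / (mu i)\<^sup>2" y, OF ky(1)] ky(2) mu_cancel
    by (simp add: power_divide power_mult_distrib)
  show "(\<Sum>i\<in>Iz. (kappa i * (y v* B) $ i)\<^sup>2) \<le> f * nuhi * (norm y)\<^sup>2"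
    unfolding power_mult_distrib using f by (intro weighted_sum_le) auto
  fix z :: "real^'l"
  have w2: "w\<^sup>2 = w" using w01 by auto
  have "(\<Sum>i\<in>Iz. (w * kappa i * ((z v* C) v* B) $ i / mu i)\<^sup>2) \<le> kz * nuhi * (norm (z v* C))\<^sup>2"
    using weighted_sum_le[of kz Iz "\<lambda>i. w * (kappa i)\<^sup>2 / (mu i)\<^sup>2" "z v* C", OF kz(1)] kz(2) mu_cancel
    by (simp add: power_divide power_mult_distrib w2)
  also have "\<dots> \<le> kz * nuhi * (omhi * (norm z)\<^sup>2)"
    using kz nonneg om by (intro mult_left_mono) auto
  finally show "(\<Sum>i\<in>Iz. (w * kappa i * ((z v* C) v* B) $ i / mu i)\<^sup>2) \<le> kz * nuhi * omhi * (norm z)\<^sup>2"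
    by (simp add: mult.assoc)
qed

end

section \<open>The eight preconditioners in normal form\<close>

context normal_data begin

abbreviation "nf_bounds s t w lo hi r \<equiv> normal_form_bounds mu B C D s t w lo hi r"
abbreviation "hlo \<equiv> h_fun thlo taulo omlo"
abbreviation "hhi \<equiv> h_fun thhi tauhi omhi"

lemma bounded_normal_formI:
  assumes "w = 0 \<or> w = 1" "\<And>i. e i = 1 \<or> e i = -1"
    "\<And>i. scal i * (1 - s * mu i) = kappa i" "\<And>i. e i * kappa i * scal i = 1 - t * mu i"
  shows "bounded_normal_form mu B C D mulo muhi nulo nuhi omlo omhi taulo tauhi thlo thhi s t w scal kappa e"
  by unfold_locales (use assms mu_gt_0 D_symm in auto)

text \<open>
  Without triangular factors the coupling is entirely skew.
\<close>
lemma bounds_d: "nf_bounds 0 0 0 0 (max muhi tauhi) (omhi + nuhi * muhi)"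
proof -
  interpret bounded_normal_form mu B C D mulo muhi nulo nuhi omlo omhi taulo tauhi thlo thhi
    0 0 0 "\<lambda>_. 1" "\<lambda>_. 1" "\<lambda>_. 1"
    by (rule bounded_normal_formI) auto
  have py: "py i * mu i = 0" for i by (simp add: py_def q_def)
  have tz: "z \<bullet> (D *v z) \<le> max muhi tauhi * (norm z)\<^sup>2" for z
    by (rule order.trans[OF tau(2)]) (simp add: mult_right_mono)
  have G: "(norm (Gamma_op z))\<^sup>2 \<le> omhi * (norm z)\<^sup>2" for z
    using Gamma_op_0[OF refl, of z] by simp
  show ?thesis
    by (rule normal_form_bounds_scalar[where ly = 0 and uy = 0 and cy = 0 and dy = "max muhi tauhi" and
        ky = 0 and cz = 0 and dz = "max muhi tauhi" and kz = 0 and f = muhi and p = omhi])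
      (use muhi_pos le_muhi nonneg tz D_nonneg mu_gt_0[THEN less_imp_le] G in \<open>simp_all add: py schur_z_0 le_max_iff_disj\<close>)
qed

text \<open>
  The \<open>y\<close>-block of the symmetric part is zero, which is why the lower bound is \<open>0\<close>. The Schur
  complement of the \<open>z\<close>-block is \<open>D + C (2 I - S) C\<^sup>T\<close>.
\<close>
lemma bounds_f2:
  assumes nu2: "nuhi \<le> 2"
  defines "xi2 \<equiv> omhi * nuhi / mulo"
  shows "nf_bounds 0 0 1 0 (max muhi (hhi nuhi + omhi * (1 - nulo)) * g2 xi2) (omhi + nuhi * muhi)"
proof -
  interpret bounded_normal_form mu B C D mulo muhi nulo nuhi omlo omhi taulo tauhi thlo thhi
    0 0 1 "\<lambda>_. 1" "\<lambda>_. 1" "\<lambda>_. 1"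
    by (rule bounded_normal_formI) auto
  let ?d = "max muhi (hhi nuhi + omhi * (1 - nulo))"
  have py: "py i * mu i = 0" for i by (simp add: py_def q_def)
  have pz: "pz i * mu i = 1" for i using mu_gt_0[of i] by (simp add: pz_def q_def)
  have q: "q i * mu i = 0" for i by (simp add: q_def)
  note sch = schur_z_1[of 1 1, unfolded pz mult_1, OF refl zero_le_one order.refl order.refl nu2]
  have s0: "0 \<le> schur_z z" for z
    using sch(1) by (intro order.trans[OF _ sch(3)] mult_nonneg_nonneg) auto
  have s1: "schur_z z \<le> ?d * (norm z)\<^sup>2" for z
    by (rule order.trans[OF sch(4)], rule mult_right_mono) auto
  have G: "(norm (Gamma_op z))\<^sup>2 + (\<Sum>i\<in>{i. (1::real) = -1}. (1 * 1 * ((z v* C) v* B) $ i)\<^sup>2) \<le> omhi * (norm z)\<^sup>2" for z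
    using Gamma_op_1[of 0 0 0 z] by (simp add: q varrho_def)
  have x0: "0 \<le> xi2" using nonneg mulo_pos by (simp add: xi2_def)
  have d0: "0 \<le> ?d" using muhi_pos by (simp add: le_max_iff_disj)
  have kx: "1 / mulo * nuhi * omhi = xi2"
    by (simp add: xi2_def)
  show ?thesis
    by (rule normal_form_bounds_scalar[where ly = 0 and uy = 0 and cy = 0 and dy = "?d" and
        ky = 0 and cz = 0 and dz = "?d" and kz = "1 / mulo" and f = muhi and p = omhi], unfold kx)
      (use muhi_pos le_muhi nonneg s0 s1 G d0 mulo_pos mulo_le mu_gt_0 mu_gt_0[THEN less_imp_le] 
         mult_left_mono[OF g2_ge_1[OF x0] d0]
       in \<open>simp_all add: py le_max_iff_disj frac_le\<close>)
qed

lemma mult_le_of_le_divide: "0 < g \<Longrightarrow> S \<le> c / g \<Longrightarrow> S * g \<le> (c::real)"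
  by (simp add: pos_le_divide_eq)

lemma le_mult_of_divide_le: "0 < g \<Longrightarrow> c / g \<le> S \<Longrightarrow> c \<le> S * (g::real)"
  by (simp add: pos_divide_le_eq)

lemma g2_pos: "0 \<le> x \<Longrightarrow> 0 < g2 x"
  using g2_ge_1[of x] by linarith

lemma D_bounds:
  "c \<le> taulo \<Longrightarrow> c * (norm z)\<^sup>2 \<le> z \<bullet> (D *v z)"
  "tauhi \<le> d \<Longrightarrow> z \<bullet> (D *v z) \<le> d * (norm z)\<^sup>2"
  using tau[of z] by (meson mult_right_mono order.trans zero_le_power2)+

text \<open>
  With both factors present \<open>q i * mu i = mu i * (2 - mu i)\<close>. As a concave function of \<open>mu i\<close> this is
  at least its smaller value at the ends of the spectrum, and it is at most \<open>1\<close>. The Schur complement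
  for \<open>f5\<close> is again governed by \<open>S\<close>, since \<open>\<mu> (2 - \<mu>) + (1 - \<mu>)\<^sup>2 = 1\<close>.
\<close>
lemma bounds_f1_f5:
  assumes mu2: "muhi \<le> 2" and L: "\<And>i. (1 - mu i)\<^sup>2 * mu i \<le> L"
    and dlo: "dlo = min (mulo * (2 - mulo)) (muhi * (2 - muhi))"
    and dhi: "dhi = max (mulo * (2 - mulo)) (max (muhi * (2 - muhi)) 1)"
  shows "nf_bounds 1 1 0 (min mulo (min taulo (dlo * nulo))) (max muhi (max tauhi (dhi * nuhi))) (omhi + nuhi * L)"
    and "nuhi \<le> 2 \<Longrightarrow> xi4 = (1 - dlo) * (omhi * nuhi / mulo) \<Longrightarrow>
      nf_bounds 1 1 1 (min mulo (min (hlo nuhi + omlo * (1 - nuhi)) (dlo * nulo / g1 xi4)) * g1 xi4)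
        (max muhi (max (hhi nuhi + omhi * (1 - nulo)) (dhi * nuhi / g2 xi4)) * g2 xi4)
        (omhi * varrho (dhi * nuhi) (dlo * nulo) + nuhi * L)"
proof -
  have dlo0: "0 \<le> dlo"
    unfolding dlo using mu2 mulo_pos mulo_le_muhi muhi_pos by simp
  have dhi0: "0 \<le> dhi" unfolding dhi by simp
  have dlo_le: "dlo \<le> mu i * (2 - mu i)" for i
  proof (cases "mu i + mulo \<le> 2")
    case True
    have "0 \<le> (mu i - mulo) * (2 - mu i - mulo)"
      using mulo_le[of i] True by simp
    then show ?thesis unfolding dlo by (intro min.coboundedI1) (simp add: algebra_simps)
  next
    case False
    have "0 \<le> (muhi - mu i) * (mu i + muhi - 2)"
      using False le_muhi[of i] mulo_le_muhi by simp
    then show ?thesis unfolding dlo by (intro min.coboundedI2) (simp add: algebra_simps)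
  qed
  have le_1: "mu i * (2 - mu i) \<le> 1" for i
    using zero_le_power2[of "1 - mu i"] by (simp add: power2_eq_square algebra_simps)
  then have dhi_le: "mu i * (2 - mu i) \<le> dhi" for i
    unfolding dhi by (intro order.trans[OF le_1]) simp
  have dlo1: "dlo \<le> 1" using dlo_le le_1 order.trans by blast
  have L0: "0 \<le> L"
    using L mu_gt_0 by (meson less_imp_le mult_nonneg_nonneg order.trans zero_le_power2)
  show "nf_bounds 1 1 0 (min mulo (min taulo (dlo * nulo))) (max muhi (max tauhi (dhi * nuhi))) (omhi + nuhi * L)"
  proof -
    interpret bounded_normal_form mu B C D mulo muhi nulo nuhi omlo omhi taulo tauhi thlo thhi
      1 1 0 "\<lambda>_. 1" "\<lambda>i. 1 - mu i" "\<lambda>_. 1"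
      by (rule bounded_normal_formI) auto
    have py: "py i * mu i = mu i * (2 - mu i)" for i by (simp add: py_def q_def)
    show ?thesis
    proof (rule normal_form_bounds_scalar[where ly = dlo and uy = dhi and cy = "dlo * nulo" and dy = "dhi * nuhi" and
        ky = 0 and cz = "min mulo taulo" and dz = "max muhi tauhi" and kz = 0 and f = L and p = omhi])
      show "min mulo taulo * (norm z)\<^sup>2 \<le> schur_z z" "schur_z z \<le> max muhi tauhi * (norm z)\<^sup>2" for z
        unfolding schur_z_0[OF refl] by (rule D_bounds; simp)+
      show "(norm (Gamma_op z))\<^sup>2 + (\<Sum>i\<in>{i. (1::real) = -1}. (0 * (1 - mu i) * ((z v* C) v* B) $ i)\<^sup>2) \<le> omhi * (norm z)\<^sup>2" for z
        by (rule Gamma_op_0) simp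
      show "max muhi tauhi * g2 (0 * nuhi * omhi) \<le> max muhi (max tauhi (dhi * nuhi))"
        unfolding mult_zero_left g2_0 mult_1_right by (simp flip: max.assoc)
      show "min mulo (min taulo (dlo * nulo)) \<le> min mulo taulo * g1 (0 * nuhi * omhi)"
        unfolding mult_zero_left g1_0 mult_1_right by (simp add: min_le_iff_disj)
    qed (use dlo0 dhi0 dlo_le dhi_le L0 L nonneg mulo_pos mulo_le le_muhi muhi_pos in \<open>simp_all add: py le_max_iff_disj min_le_iff_disj\<close>)
  qed
  show "nf_bounds 1 1 1 (min mulo (min (hlo nuhi + omlo * (1 - nuhi)) (dlo * nulo / g1 xi4)) * g1 xi4)
        (max muhi (max (hhi nuhi + omhi * (1 - nulo)) (dhi * nuhi / g2 xi4)) * g2 xi4)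
        (omhi * varrho (dhi * nuhi) (dlo * nulo) + nuhi * L)"
    if nu2: "nuhi \<le> 2" and xi: "xi4 = (1 - dlo) * (omhi * nuhi / mulo)"
  proof -
    interpret bounded_normal_form mu B C D mulo muhi nulo nuhi omlo omhi taulo tauhi thlo thhi
      1 1 1 "\<lambda>_. 1" "\<lambda>i. 1 - mu i" "\<lambda>_. 1"
      by (rule bounded_normal_formI) auto
    have py: "py i * mu i = mu i * (2 - mu i)" for i by (simp add: py_def q_def)
    have q: "q i * mu i = mu i * (2 - mu i)" for i by (simp add: q_def)
    have pz: "pz i * mu i = 1" for i
      using mu_gt_0[of i] by (simp add: pz_def q_def field_simps power2_eq_square)
    note sch = schur_z_1[of 1 1, unfolded pz mult_1, OF refl zero_le_one order.refl order.refl nu2]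
    let ?c = "min mulo (hlo nuhi + omlo * (1 - nuhi))" and ?d = "max muhi (hhi nuhi + omhi * (1 - nulo))"
    have kz: "(1 - mu i)\<^sup>2 / mu i \<le> (1 - dlo) / mulo" for i
    proof (rule frac_le)
      show "(1 - mu i)\<^sup>2 \<le> 1 - dlo" using dlo_le[of i] by (simp add: power2_eq_square algebra_simps)
    qed (use dlo1 mulo_pos mulo_le in auto)
    have kx: "(1 - dlo) / mulo * nuhi * omhi = xi4" by (simp add: xi)
    have x0: "0 \<le> xi4" using dlo1 nonneg mulo_pos by (simp add: xi)
    note g = g1_pos[OF x0] g2_pos[OF x0]
    show ?thesis
    proof (rule normal_form_bounds_scalar[where ly = dlo and uy = dhi and cy = "dlo * nulo" and dy = "dhi * nuhi" and
        ky = 0 and cz = ?c and dz = ?d and kz = "(1 - dlo) / mulo" and f = L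
        and p = "omhi * varrho (dhi * nuhi) (dlo * nulo)"], unfold kx)
      show "?c * (norm z)\<^sup>2 \<le> schur_z z" for z
        by (rule order.trans[OF mult_right_mono sch(3)]) auto
      show "schur_z z \<le> ?d * (norm z)\<^sup>2" for z
        by (rule order.trans[OF sch(4) mult_right_mono]) auto
      show "(norm (Gamma_op z))\<^sup>2 + (\<Sum>i\<in>{i. (1::real) = -1}. (1 * (1 - mu i) * ((z v* C) v* B) $ i)\<^sup>2)
          \<le> omhi * varrho (dhi * nuhi) (dlo * nulo) * (norm z)\<^sup>2" for z
        using Gamma_op_1[of dlo dhi 0 z] dlo0 dhi0 dlo_le dhi_le by (simp add: q)
      show "0 \<le> ?c" using sch(1) mulo_pos by simp
      show "0 \<le> ?d" using muhi_pos by (simp add: le_max_iff_disj)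
      show "min mulo (min (hlo nuhi + omlo * (1 - nuhi)) (dlo * nulo / g1 xi4)) * g1 xi4 \<le> dlo * nulo * g1 (0 * nuhi)"
        using mult_le_of_le_divide[OF g(1)] by simp
      show "min mulo (min (hlo nuhi + omlo * (1 - nuhi)) (dlo * nulo / g1 xi4)) * g1 xi4 \<le> ?c * g1 xi4"
        using g by (intro mult_right_mono) auto
      show "dhi * nuhi * g2 (0 * nuhi) \<le> max muhi (max (hhi nuhi + omhi * (1 - nulo)) (dhi * nuhi / g2 xi4)) * g2 xi4"
        using le_mult_of_divide_le[OF g(2)] by simp
      show "?d * g2 xi4 \<le> max muhi (max (hhi nuhi + omhi * (1 - nulo)) (dhi * nuhi / g2 xi4)) * g2 xi4"
        using g by (intro mult_right_mono) auto
    qed (use dlo0 dlo1 dhi0 dlo_le dhi_le L0 L kz nonneg mulo_pos mulo_le le_muhi muhi_pos in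
      \<open>simp_all add: py le_max_iff_disj min_le_iff_disj varrho_def\<close>)
  qed
qed

definition sqrt_gap :: "'n \<Rightarrow> real" where "sqrt_gap i = sqrt \<bar>1 - mu i\<bar>"

lemma sqrt_gap_square: "(sqrt_gap i)\<^sup>2 = \<bar>1 - mu i\<bar>"
  by (simp add: sqrt_gap_def)

text \<open>
  The sign \<open>e i\<close> must be that of \<open>1 - mu i\<close>. It is left open for \<open>mu i = 1\<close>, so that it can be chosen
  constant when the spectrum lies on one side of \<open>1\<close>.
\<close>
lemma sqrt_scaling:
  assumes "w = 0 \<or> w = 1" and "\<And>i. e i = 1 \<and> mu i \<le> 1 \<or> e i = -1 \<and> 1 \<le> mu i"
  shows "bounded_normal_form mu B C D mulo muhi nulo nuhi omlo omhi taulo tauhi thlo thhi 0 1 w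
    sqrt_gap sqrt_gap e"
proof (rule bounded_normal_formI)
  fix i
  have "e i * sqrt_gap i * sqrt_gap i = e i * \<bar>1 - mu i\<bar>"
    by (simp add: mult.assoc power2_eq_square flip: sqrt_gap_square)
  then show "e i * sqrt_gap i * sqrt_gap i = 1 - 1 * mu i"
    using assms(2)[of i] by auto
  show "e i = 1 \<or> e i = -1"
    using assms(2)[of i] by auto
qed (use assms(1) in auto)

text \<open>
  All couplings are skew, so that no factor \<open>g1\<close> or \<open>g2\<close> appears.
\<close>
lemma bounds_lt_le_1:
  assumes mu1: "muhi \<le> 1" and L: "\<And>i. mu i * (1 - mu i) \<le> L"
  shows "nf_bounds 0 1 0 (min mulo (min taulo (mulo * nulo))) (max muhi (max tauhi (muhi * nuhi))) (omhi + nuhi * L)"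
proof -
  have mu_le_1: "mu i \<le> 1" for i using le_muhi[of i] mu1 by linarith
  interpret bounded_normal_form mu B C D mulo muhi nulo nuhi omlo omhi taulo tauhi thlo thhi
    0 1 0 sqrt_gap sqrt_gap "\<lambda>_. 1"
    by (rule sqrt_scaling) (simp_all add: mu_le_1)
  have py: "py i * mu i = mu i" for i unfolding py_def q_def by simp
  have L0: "0 \<le> L"
    using L mu_gt_0 mu_le_1 by (meson diff_ge_0_iff_ge less_imp_le mult_nonneg_nonneg order.trans)
  show ?thesis
  proof (rule normal_form_bounds_scalar[where ly = mulo and uy = muhi and cy = "mulo * nulo" and dy = "muhi * nuhi" and
      ky = 0 and cz = "min mulo taulo" and dz = "max muhi tauhi" and kz = 0 and f = L and p = omhi])
    show "min mulo taulo * (norm z)\<^sup>2 \<le> schur_z z" "schur_z z \<le> max muhi tauhi * (norm z)\<^sup>2" for z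
      unfolding schur_z_0[OF refl] by (rule D_bounds; simp)+
    show "(norm (Gamma_op z))\<^sup>2 + (\<Sum>i\<in>{i. (1::real) = -1}. (0 * sqrt_gap i * ((z v* C) v* B) $ i)\<^sup>2) \<le> omhi * (norm z)\<^sup>2" for z
      by (rule Gamma_op_0) simp
    show "max muhi tauhi * g2 (0 * nuhi * omhi) \<le> max muhi (max tauhi (muhi * nuhi))"
      unfolding mult_zero_left g2_0 mult_1_right by (simp flip: max.assoc)
    show "min mulo (min taulo (mulo * nulo)) \<le> min mulo taulo * g1 (0 * nuhi * omhi)"
      unfolding mult_zero_left g1_0 mult_1_right by (simp add: min_le_iff_disj)
    show "(sqrt_gap i)\<^sup>2 * mu i \<le> L" for i
      using L[of i] mu_le_1[of i] by (simp add: mult.commute sqrt_gap_square)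
  qed (use L0 nonneg mulo_pos mulo_le le_muhi muhi_pos mu_le_1 in
      \<open>simp_all add: py sqrt_gap_square le_max_iff_disj min_le_iff_disj\<close>)
qed

text \<open>
  The \<open>z\<close>-block acquires an off-diagonal part of squared norm at most \<open>xi3\<close>; its Schur complement involves
  \<open>A + (I - A) = I\<close>, that is \<open>S\<close> itself.
\<close>
lemma bounds_f4_le_1:
  assumes mu1: "muhi \<le> 1" and L: "\<And>i. mu i * (1 - mu i) \<le> L" and nu2: "nuhi \<le> 2"
    and xi: "xi3 = (1 - mulo) * (omhi * nuhi / mulo)"
  shows "nf_bounds 0 1 1 (min mulo (min (hlo nuhi + omlo * (1 - nuhi)) (mulo * nulo / g1 xi3)) * g1 xi3)
        (max muhi (max (hhi nuhi + omhi * (1 - nulo)) (muhi * nuhi / g2 xi3)) * g2 xi3)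
        (omhi * varrho (muhi * nuhi) (mulo * nulo) + nuhi * L)"
proof -
  have mu_le_1: "mu i \<le> 1" for i using le_muhi[of i] mu1 by linarith
  interpret bounded_normal_form mu B C D mulo muhi nulo nuhi omlo omhi taulo tauhi thlo thhi
    0 1 1 sqrt_gap sqrt_gap "\<lambda>_. 1"
    by (rule sqrt_scaling) (simp_all add: mu_le_1)
  have py: "py i * mu i = mu i" for i unfolding py_def q_def by simp
  have q: "q i * mu i = mu i" for i by (simp add: q_def)
  have pz: "pz i * mu i = 1" for i
    using mu_gt_0[of i] mu_le_1[of i] unfolding pz_def q_def by (simp add: field_simps sqrt_gap_square)
  have L0: "0 \<le> L"
    using L mu_gt_0 mu_le_1 by (meson diff_ge_0_iff_ge less_imp_le mult_nonneg_nonneg order.trans)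
  have mulo1: "mulo \<le> 1" using mulo_le_muhi mu1 by linarith
  note sch = schur_z_1[of 1 1, unfolded pz mult_1, OF refl zero_le_one order.refl order.refl nu2]
  let ?c = "min mulo (hlo nuhi + omlo * (1 - nuhi))" and ?d = "max muhi (hhi nuhi + omhi * (1 - nulo))"
  have kz: "(1 - mu i) / mu i \<le> (1 - mulo) / mulo" for i
    by (rule frac_le) (use mulo1 mulo_pos mulo_le in auto)
  have kx: "(1 - mulo) / mulo * nuhi * omhi = xi3" by (simp add: xi)
  have x0: "0 \<le> xi3" using mulo1 nonneg mulo_pos by (simp add: xi)
  note g = g1_pos[OF x0] g2_pos[OF x0]
  show ?thesis
  proof (rule normal_form_bounds_scalar[where ly = mulo and uy = muhi and cy = "mulo * nulo" and dy = "muhi * nuhi" and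
      ky = 0 and cz = ?c and dz = ?d and kz = "(1 - mulo) / mulo" and f = L
      and p = "omhi * varrho (muhi * nuhi) (mulo * nulo)"], unfold kx)
    show "?c * (norm z)\<^sup>2 \<le> schur_z z" for z
      by (rule order.trans[OF mult_right_mono sch(3)]) auto
    show "schur_z z \<le> ?d * (norm z)\<^sup>2" for z
      by (rule order.trans[OF sch(4) mult_right_mono]) auto
    show "(norm (Gamma_op z))\<^sup>2 + (\<Sum>i\<in>{i. (1::real) = -1}. (1 * sqrt_gap i * ((z v* C) v* B) $ i)\<^sup>2)
        \<le> omhi * varrho (muhi * nuhi) (mulo * nulo) * (norm z)\<^sup>2" for z
      using Gamma_op_1[of mulo muhi 0 z] mulo_pos muhi_pos mulo_le le_muhi by (simp add: q)
    show "0 \<le> ?c" using sch(1) mulo_pos by simp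
    show "0 \<le> ?d" using muhi_pos by (simp add: le_max_iff_disj)
    show "min mulo (min (hlo nuhi + omlo * (1 - nuhi)) (mulo * nulo / g1 xi3)) * g1 xi3 \<le> mulo * nulo * g1 (0 * nuhi)"
      using mult_le_of_le_divide[OF g(1)] by simp
    show "min mulo (min (hlo nuhi + omlo * (1 - nuhi)) (mulo * nulo / g1 xi3)) * g1 xi3 \<le> ?c * g1 xi3"
      using g by (intro mult_right_mono) auto
    show "muhi * nuhi * g2 (0 * nuhi) \<le> max muhi (max (hhi nuhi + omhi * (1 - nulo)) (muhi * nuhi / g2 xi3)) * g2 xi3"
      using le_mult_of_divide_le[OF g(2)] by simp
    show "?d * g2 xi3 \<le> max muhi (max (hhi nuhi + omhi * (1 - nulo)) (muhi * nuhi / g2 xi3)) * g2 xi3"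
      using g by (intro mult_right_mono) auto
    show "(sqrt_gap i)\<^sup>2 * mu i \<le> L" for i
      using L[of i] mu_le_1[of i] by (simp add: mult.commute sqrt_gap_square)
  qed (use L0 mulo1 kz mu_le_1 nonneg mulo_pos mulo_le le_muhi muhi_pos in
    \<open>simp_all add: py sqrt_gap_square le_max_iff_disj min_le_iff_disj varrho_def\<close>)
qed

lemma xi1_facts:
  assumes "1 \<le> muhi" "xi1 = nuhi - nuhi / muhi"
  shows "(1 - 1 / muhi) * nuhi = xi1" "0 \<le> xi1" "0 < g1 xi1" "g1 xi1 \<le> 1" "1 \<le> g2 xi1"
    "1 \<le> mu i \<Longrightarrow> (mu i - 1) / mu i \<le> 1 - 1 / muhi" "0 \<le> 1 - 1 / muhi"
proof -
  show 1: "(1 - 1 / muhi) * nuhi = xi1" using assms by (simp add: algebra_simps)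
  show 2: "0 \<le> 1 - 1 / muhi" using assms by simp
  show "0 \<le> xi1" unfolding 1[symmetric] using 2 nonneg by simp
  then show "0 < g1 xi1" "g1 xi1 \<le> 1" "1 \<le> g2 xi1" by (auto intro: g1_pos g1_le_1 g2_ge_1)
  have "(mu i - 1) / mu i = 1 - 1 / mu i"
    using mu_gt_0[of i] by (simp add: diff_divide_distrib)
  then show "(mu i - 1) / mu i \<le> 1 - 1 / muhi"
    using le_muhi[of i] mu_gt_0[of i] by (simp add: frac_le)
qed

text \<open>
  The whole coupling of \<open>x\<close> and \<open>y\<close> is symmetric. Eliminating \<open>x\<close> leaves \<open>S\<close> in the \<open>y\<close>-block, because
  \<open>A - (A - I) = I\<close>, and the off-diagonal part has squared norm at most \<open>xi1\<close>.
\<close>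
lemma bounds_lt_ge_1:
  assumes mu1: "1 \<le> mulo" and xi: "xi1 = nuhi - nuhi / muhi"
  shows "nf_bounds 0 1 0 (min (mulo * g1 xi1) (min (nulo * g1 xi1) taulo))
    (max (muhi * g2 xi1) (max (nuhi * g2 xi1) tauhi)) omhi"
proof -
  have mu_ge_1: "1 \<le> mu i" for i using mulo_le[of i] mu1 by linarith
  have muhi1: "1 \<le> muhi" using mulo_le_muhi mu1 by linarith
  interpret bounded_normal_form mu B C D mulo muhi nulo nuhi omlo omhi taulo tauhi thlo thhi
    0 1 0 sqrt_gap sqrt_gap "\<lambda>_. -1"
    by (rule sqrt_scaling) (simp_all add: mu_ge_1)
  have py: "py i * mu i = 1" for i
    using mu_gt_0[of i] mu_ge_1[of i] unfolding py_def q_def by (simp add: field_simps sqrt_gap_square)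
  note xf = xi1_facts[OF muhi1 xi]
  show ?thesis
  proof (rule normal_form_bounds_scalar[where ly = 1 and uy = 1 and cy = "min mulo nulo" and dy = "max muhi nuhi" and
      ky = "1 - 1 / muhi" and cz = taulo and dz = tauhi and kz = 0 and f = 0 and p = omhi], unfold xf(1))
    show "taulo * (norm z)\<^sup>2 \<le> schur_z z" "schur_z z \<le> tauhi * (norm z)\<^sup>2" for z
      unfolding schur_z_0[OF refl] by (rule D_bounds; simp)+
    show "(norm (Gamma_op z))\<^sup>2 + (\<Sum>i\<in>{i. (-1::real) = -1}. (0 * sqrt_gap i * ((z v* C) v* B) $ i)\<^sup>2) \<le> omhi * (norm z)\<^sup>2" for z
      by (rule Gamma_op_0) simp
    show "min (mulo * g1 xi1) (min (nulo * g1 xi1) taulo) \<le> min mulo nulo * g1 xi1"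
      using xf(3) by (auto simp: min_mult_distrib_right min_le_iff_disj)
    show "max muhi nuhi * g2 xi1 \<le> max (muhi * g2 xi1) (max (nuhi * g2 xi1) tauhi)"
      using xf(5) by (auto simp: max_mult_distrib_right le_max_iff_disj)
    show "(sqrt_gap i)\<^sup>2 / mu i \<le> 1 - 1 / muhi" for i
      using xf(6)[OF mu_ge_1] mu_ge_1[of i] by (simp add: sqrt_gap_square)
  qed (use xf(7) nonneg mulo_pos mulo_le le_muhi muhi_pos in
    \<open>simp_all add: py sqrt_gap_square le_max_iff_disj min_le_iff_disj\<close>)
qed

text \<open>
  In contrast to \<open>lt\<close> there is a skew coupling of \<open>x\<close> with \<open>z\<close>. It contributes
  \<open>C B (A - I) B\<^sup>T C\<^sup>T\<close> to the bound on the imaginary part.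
\<close>
lemma bounds_f4_ge_1:
  assumes mu1: "1 \<le> mulo" and xi: "xi1 = nuhi - nuhi / muhi" and munu: "muhi * nuhi \<le> 2"
  shows "nf_bounds 0 1 1 (min (mulo * g1 xi1) (min (nulo * g1 xi1) (hlo (muhi * nuhi) + omlo * (1 - muhi * nuhi))))
    (max (muhi * g2 xi1) (max (nuhi * g2 xi1) (hhi (muhi * nuhi) + omhi * (1 - mulo * nulo))))
    (omhi * (nuhi * muhi * (muhi - 1) + varrho (muhi * nuhi) (mulo * nulo)))"
proof -
  have mu_ge_1: "1 \<le> mu i" for i using mulo_le[of i] mu1 by linarith
  have muhi1: "1 \<le> muhi" using mulo_le_muhi mu1 by linarith
  interpret bounded_normal_form mu B C D mulo muhi nulo nuhi omlo omhi taulo tauhi thlo thhi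
    0 1 1 sqrt_gap sqrt_gap "\<lambda>_. -1"
    by (rule sqrt_scaling) (simp_all add: mu_ge_1)
  have py: "py i * mu i = 1" for i
    using mu_gt_0[of i] mu_ge_1[of i] unfolding py_def q_def by (simp add: field_simps sqrt_gap_square)
  have pz: "pz i * mu i = mu i" and q: "q i * mu i = mu i" for i unfolding pz_def q_def by simp_all
  note sch = schur_z_1[of mulo muhi, unfolded pz, OF refl less_imp_le[OF mulo_pos] mulo_le le_muhi munu]
  have km: "(mu i - 1) * mu i \<le> muhi * (muhi - 1)" for i
    unfolding mult.commute[of muhi] using mu_ge_1 le_muhi muhi1 by (intro mult_mono) (simp_all add: order.trans[OF zero_le_one])
  note xf = xi1_facts[OF muhi1 xi]
  show ?thesis
  proof (rule normal_form_bounds_scalar[where ly = 1 and uy = 1 and cy = "min mulo nulo" and dy = "max muhi nuhi" and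
      ky = "1 - 1 / muhi" and cz = "hlo (muhi * nuhi) + omlo * (1 - muhi * nuhi)"
      and dz = "hhi (muhi * nuhi) + omhi * (1 - mulo * nulo)" and kz = 0 and f = 0
      and p = "omhi * (nuhi * muhi * (muhi - 1) + varrho (muhi * nuhi) (mulo * nulo))"], unfold xf(1))
    show "(norm (Gamma_op z))\<^sup>2 + (\<Sum>i\<in>{i. (-1::real) = -1}. (1 * sqrt_gap i * ((z v* C) v* B) $ i)\<^sup>2)
        \<le> omhi * (nuhi * muhi * (muhi - 1) + varrho (muhi * nuhi) (mulo * nulo)) * (norm z)\<^sup>2" for z
      using Gamma_op_1[of mulo muhi "muhi * (muhi - 1)" z, unfolded q] mulo_pos muhi_pos mulo_le le_muhi km mu_ge_1 muhi1
      by (simp add: sqrt_gap_square mult.commute mult.left_commute)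
    show "min (mulo * g1 xi1) (min (nulo * g1 xi1) (hlo (muhi * nuhi) + omlo * (1 - muhi * nuhi))) \<le> min mulo nulo * g1 xi1"
      using xf(3) by (auto simp: min_mult_distrib_right min_le_iff_disj)
    show "max muhi nuhi * g2 xi1 \<le> max (muhi * g2 xi1) (max (nuhi * g2 xi1) (hhi (muhi * nuhi) + omhi * (1 - mulo * nulo)))"
      using xf(5) by (auto simp: max_mult_distrib_right le_max_iff_disj)
    show "(sqrt_gap i)\<^sup>2 / mu i \<le> 1 - 1 / muhi" for i
      using xf(6)[OF mu_ge_1] mu_ge_1[of i] by (simp add: sqrt_gap_square)
    show "0 \<le> omhi * (nuhi * muhi * (muhi - 1) + varrho (muhi * nuhi) (mulo * nulo))"
      using nonneg muhi1 by (simp add: varrho_def le_max_iff_disj)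
  qed (use xf(7) sch nonneg mulo_pos mulo_le le_muhi muhi_pos in
    \<open>simp_all add: py sqrt_gap_square le_max_iff_disj min_le_iff_disj\<close>)
qed

text \<open>
  The coordinates with \<open>mu i < 1\<close> belong to the \<open>z\<close>-block and all others to the \<open>y\<close>-block. The Schur
  complement of the \<open>y\<close>-block is \<open>S\<close> weighted by \<open>min 1 (mu i)\<close>.
\<close>
lemma bounds_lt_mixed:
  assumes mu1: "mulo < 1" "1 < muhi" and xi: "xi1 = nuhi - nuhi / muhi" and L: "\<And>i. mu i * (1 - mu i) \<le> L"
  shows "nf_bounds 0 1 0 (min mulo (min taulo (min (g1 xi1) (mulo * nulo * g1 xi1))))
    (max tauhi (max (muhi * g2 xi1) (nuhi * g2 xi1))) (omhi + nuhi * L)"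
proof -
  let ?e = "\<lambda>i. if mu i < 1 then 1 else -1 :: real"
  interpret bounded_normal_form mu B C D mulo muhi nulo nuhi omlo omhi taulo tauhi thlo thhi
    0 1 0 sqrt_gap sqrt_gap ?e
    by (rule sqrt_scaling) auto
  have py: "py i * mu i = min 1 (mu i)" for i
    using mu_gt_0[of i] unfolding py_def q_def by (simp add: field_simps min_def sqrt_gap_square)
  have L0: "0 \<le> L"
  proof -
    obtain i where "mu i = mulo" using mulo_attained by blast
    then have "0 \<le> mu i * (1 - mu i)" using mulo_pos mu1 by simp
    then show ?thesis using L[of i] by linarith
  qed
  note xf = xi1_facts[OF less_imp_le[OF mu1(2)] xi]
  have m1: "1 \<le> muhi * g2 xi1"
    using mult_mono[OF less_imp_le[OF mu1(2)] xf(5)] muhi_pos by simp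
  show ?thesis
  proof (rule normal_form_bounds_scalar[where ly = mulo and uy = 1 and cy = "min 1 (mulo * nulo)" and dy = "max muhi nuhi" and
      ky = "1 - 1 / muhi" and cz = "min mulo taulo" and dz = "max 1 tauhi" and kz = 0 and f = L and p = omhi], unfold xf(1))
    show "min mulo taulo * (norm z)\<^sup>2 \<le> schur_z z" "schur_z z \<le> max 1 tauhi * (norm z)\<^sup>2" for z
      unfolding schur_z_0[OF refl] by (rule D_bounds; simp)+
    show "(norm (Gamma_op z))\<^sup>2 + (\<Sum>i\<in>{i. ?e i = -1}. (0 * sqrt_gap i * ((z v* C) v* B) $ i)\<^sup>2) \<le> omhi * (norm z)\<^sup>2" for z
      by (rule Gamma_op_0) simp
    show "min mulo (min taulo (min (g1 xi1) (mulo * nulo * g1 xi1))) \<le> min 1 (mulo * nulo) * g1 xi1"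
      using xf(3) by (auto simp: min_mult_distrib_right min_le_iff_disj)
    show "min mulo (min taulo (min (g1 xi1) (mulo * nulo * g1 xi1))) \<le> min mulo taulo * g1 (0 * nuhi * omhi)"
      unfolding mult_zero_left g1_0 mult_1_right by (simp add: min_le_iff_disj)
    show "max muhi nuhi * g2 xi1 \<le> max tauhi (max (muhi * g2 xi1) (nuhi * g2 xi1))"
      using xf(5) by (auto simp: max_mult_distrib_right le_max_iff_disj)
    show "max 1 tauhi * g2 (0 * nuhi * omhi) \<le> max tauhi (max (muhi * g2 xi1) (nuhi * g2 xi1))"
      using m1 by (auto simp: le_max_iff_disj)
    show "(sqrt_gap i)\<^sup>2 / mu i \<le> 1 - 1 / muhi" if "?e i = -1" for i
      using xf(6)[of i] that by (simp add: sqrt_gap_square split: if_splits)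
    show "(sqrt_gap i)\<^sup>2 * mu i \<le> L" if "?e i = 1" for i
      using L[of i] that by (simp add: mult.commute sqrt_gap_square split: if_splits)
    show "min 1 (mulo * nulo) \<le> mu i \<and> mu i \<le> max muhi nuhi" if "?e i = -1" for i
      using that le_muhi[of i] by (simp add: le_max_iff_disj min_le_iff_disj split: if_splits)
    show "min mulo taulo \<le> mu i \<and> mu i \<le> max 1 tauhi" if "?e i = 1" for i
      using that mulo_le[of i] by (simp add: le_max_iff_disj min_le_iff_disj split: if_splits)
  qed (use L0 mu1 mulo_le xf(7) nonneg mulo_pos muhi_pos in
    \<open>simp_all add: py sqrt_gap_square le_max_iff_disj min_le_iff_disj\<close>)
qed

text \<open>
  Both blocks have off-diagonal parts, of squared norms at most \<open>xi1\<close> and \<open>xi3\<close>. Their Schur complements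
  contain \<open>S\<close> weighted by \<open>min 1 (mu i)\<close> and by \<open>max 1 (mu i)\<close>.
\<close>
lemma bounds_f4_mixed:
  assumes mu1: "mulo < 1" "1 < muhi" and xi: "xi1 = nuhi - nuhi / muhi" and munu: "muhi * nuhi \<le> 2"
    and L: "\<And>i. mu i * (1 - mu i) \<le> L" and xi3: "xi3 = (1 - mulo) * (omhi * nuhi / mulo)"
  shows "nf_bounds 0 1 1
    (min mulo (min (hlo (muhi * nuhi) + omlo * (1 - muhi * nuhi)) (min (g1 xi1 / g1 xi3) (mulo * nulo * g1 xi1 / g1 xi3))) * g1 xi3)
    (max 1 (max (hhi (muhi * nuhi) + omhi * (1 - nulo)) (max (muhi * g2 xi1 / g2 xi3) (nuhi * g2 xi1 / g2 xi3))) * g2 xi3)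
    (omhi * (nuhi * muhi * (muhi - 1) + varrho (muhi * nuhi) (mulo * nulo)) + nuhi * L)"
    (is "nf_bounds 0 1 1 (min mulo (min ?hl (min ?a ?b)) * g1 xi3) (max 1 (max ?hh (max ?a' ?b')) * g2 xi3) (?p + nuhi * L)")
proof -
  let ?e = "\<lambda>i. if mu i < 1 then 1 else -1 :: real"
  interpret bounded_normal_form mu B C D mulo muhi nulo nuhi omlo omhi taulo tauhi thlo thhi
    0 1 1 sqrt_gap sqrt_gap ?e
    by (rule sqrt_scaling) auto
  have py: "py i * mu i = min 1 (mu i)" for i
    using mu_gt_0[of i] unfolding py_def q_def by (simp add: field_simps min_def sqrt_gap_square)
  have pz: "pz i * mu i = max 1 (mu i)" for i
    using mu_gt_0[of i] unfolding pz_def q_def by (simp add: field_simps max_def sqrt_gap_square)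
  have q: "q i * mu i = mu i" for i by (simp add: q_def)
  have L0: "0 \<le> L"
  proof -
    obtain i where "mu i = mulo" using mulo_attained by blast
    then have "0 \<le> mu i * (1 - mu i)" using mulo_pos mu1 by simp
    then show ?thesis using L[of i] by linarith
  qed
  note xf = xi1_facts[OF less_imp_le[OF mu1(2)] xi]
  have m2: "1 \<le> max 1 (mu i)" "max 1 (mu i) \<le> muhi" for i
    using mu1 le_muhi[of i] by auto
  note sch = schur_z_1[of 1 muhi, unfolded pz mult_1, OF refl zero_le_one m2 munu]
  have kz: "(1 - mu i) / mu i \<le> (1 - mulo) / mulo" for i
    by (rule frac_le) (use mu1 mulo_pos mulo_le in auto)
  have kx: "(1 - mulo) / mulo * nuhi * omhi = xi3" by (simp add: xi3)
  have x0: "0 \<le> xi3" using mu1 nonneg mulo_pos by (simp add: xi3)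
  note g = g1_pos[OF x0] g2_pos[OF x0]
  have km: "(mu i - 1) * mu i \<le> muhi * (muhi - 1)" if "1 \<le> mu i" for i
    unfolding mult.commute[of muhi] using that le_muhi mu1 by (intro mult_mono) auto
  show ?thesis
  proof (rule normal_form_bounds_scalar[where ly = mulo and uy = 1 and cy = "min 1 (mulo * nulo)" and dy = "max muhi nuhi" and
      ky = "1 - 1 / muhi" and cz = "min mulo ?hl" and dz = "max 1 ?hh" and kz = "(1 - mulo) / mulo" and f = L and p = ?p],
      unfold xf(1) kx)
    show "min mulo ?hl * (norm z)\<^sup>2 \<le> schur_z z" for z
      by (rule order.trans[OF mult_right_mono sch(3)]) auto
    show "schur_z z \<le> max 1 ?hh * (norm z)\<^sup>2" for z
      by (rule order.trans[OF sch(4) mult_right_mono]) auto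
    show "(norm (Gamma_op z))\<^sup>2 + (\<Sum>i\<in>{i. ?e i = -1}. (1 * sqrt_gap i * ((z v* C) v* B) $ i)\<^sup>2) \<le> ?p * (norm z)\<^sup>2" for z
    proof -
      have "(sqrt_gap i)\<^sup>2 * mu i \<le> muhi * (muhi - 1)" if "?e i = -1" for i
        using that km[of i] by (simp add: sqrt_gap_square split: if_splits)
      then show ?thesis
        using Gamma_op_1[of mulo muhi "muhi * (muhi - 1)" z, unfolded q] mulo_pos muhi_pos mulo_le le_muhi mu1
        by (simp add: mult.commute mult.left_commute)
    qed
    show "min mulo (min ?hl (min ?a ?b)) * g1 xi3 \<le> min 1 (mulo * nulo) * g1 xi1"
      using mult_le_of_le_divide[OF g(1), of _ "g1 xi1"] mult_le_of_le_divide[OF g(1), of _ "mulo * nulo * g1 xi1"]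
      by (cases "1 \<le> mulo * nulo") (simp_all add: min_le_iff_disj min_absorb1 min_absorb2)
    show "min mulo (min ?hl (min ?a ?b)) * g1 xi3 \<le> min mulo ?hl * g1 xi3"
      using g by (intro mult_right_mono) auto
    show "max muhi nuhi * g2 xi1 \<le> max 1 (max ?hh (max ?a' ?b')) * g2 xi3"
      using le_mult_of_divide_le[OF g(2), of "muhi * g2 xi1"] le_mult_of_divide_le[OF g(2), of "nuhi * g2 xi1"]
      by (cases "muhi \<le> nuhi") (simp_all add: le_max_iff_disj max_absorb1 max_absorb2)
    show "max 1 ?hh * g2 xi3 \<le> max 1 (max ?hh (max ?a' ?b')) * g2 xi3"
      using g by (intro mult_right_mono) auto
    show "(sqrt_gap i)\<^sup>2 / mu i \<le> 1 - 1 / muhi" if "?e i = -1" for i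
      using xf(6)[of i] that by (simp add: sqrt_gap_square split: if_splits)
    show "(sqrt_gap i)\<^sup>2 * mu i \<le> L" if "?e i = 1" for i
      using L[of i] that by (simp add: mult.commute sqrt_gap_square split: if_splits)
    show "1 * (sqrt_gap i)\<^sup>2 / mu i \<le> (1 - mulo) / mulo" if "?e i = 1" for i
      using kz[of i] that by (simp add: sqrt_gap_square split: if_splits)
    show "min 1 (mulo * nulo) \<le> mu i \<and> mu i \<le> max muhi nuhi" if "?e i = -1" for i
      using that le_muhi[of i] by (simp add: le_max_iff_disj min_le_iff_disj split: if_splits)
    show "min mulo ?hl \<le> mu i \<and> mu i \<le> max 1 ?hh" if "?e i = 1" for i
      using that mulo_le[of i] by (simp add: le_max_iff_disj min_le_iff_disj split: if_splits)
    show "0 \<le> ?p"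
      using nonneg mu1 by (simp add: varrho_def le_max_iff_disj)
    show "0 \<le> min mulo ?hl" using sch(1) mulo_pos by simp
  qed (use L0 mu1 mulo_le xf(7) nonneg mulo_pos muhi_pos in
    \<open>simp_all add: py sqrt_gap_square le_max_iff_disj min_le_iff_disj\<close>)
qed

end

section \<open>Reduction of the preconditioned saddle point matrix to the normal form\<close>

lemma complex_eigenvector_real_pair:
  fixes T :: "real^'k^'k"
  assumes "is_eigenvalue (map_matrix complex_of_real T) k"
  obtains v v' where "T *v v = Re k *\<^sub>R v - Im k *\<^sub>R v'" "T *v v' = Im k *\<^sub>R v + Re k *\<^sub>R v'"
    "v \<noteq> 0 \<or> v' \<noteq> 0"
proof -
  obtain c where c: "c \<noteq> 0" "map_matrix complex_of_real T *v c = k *s c"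
    using assms by (auto simp: is_eigenvalue_def)
  have row: "(\<Sum>j\<in>UNIV. complex_of_real (T $ i $ j) * c $ j) = k * c $ i" for i
    using c(2) by (simp add: vec_eq_iff matrix_vector_mult_def)
  show ?thesis
  proof (rule that[of "\<chi> i. Re (c $ i)" "\<chi> i. Im (c $ i)"])
    show "T *v (\<chi> i. Re (c $ i)) = Re k *\<^sub>R (\<chi> i. Re (c $ i)) - Im k *\<^sub>R (\<chi> i. Im (c $ i))"
      using row[THEN arg_cong[of _ _ Re]] by (simp add: vec_eq_iff matrix_vector_mult_def)
    show "T *v (\<chi> i. Im (c $ i)) = Im k *\<^sub>R (\<chi> i. Re (c $ i)) + Re k *\<^sub>R (\<chi> i. Im (c $ i))"
      using row[THEN arg_cong[of _ _ Im]] by (simp add: vec_eq_iff matrix_vector_mult_def algebra_simps)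
    show "(\<chi> i. Re (c $ i)) \<noteq> 0 \<or> (\<chi> i. Im (c $ i)) \<noteq> 0"
      using c(1) by (auto simp: vec_eq_iff complex_eq_iff)
  qed
qed

definition vec3 :: "'a^'n \<Rightarrow> 'a^'m \<Rightarrow> 'a^'l \<Rightarrow> 'a^('n + 'm + 'l)" where
  "vec3 x y z = (\<chi> i. case i of Inl a \<Rightarrow> x $ a | Inr (Inl b) \<Rightarrow> y $ b | Inr (Inr c) \<Rightarrow> z $ c)"

lemma all_sum3: "(\<forall>i :: 'n + 'm + 'l. P i) \<longleftrightarrow> (\<forall>a. P (Inl a)) \<and> (\<forall>b. P (Inr (Inl b))) \<and> (\<forall>c. P (Inr (Inr c)))"
  by (metis sum.exhaust)

lemma vec3_nth [simp]:
  "vec3 x y z $ Inl a = x $ a" "vec3 x y z $ Inr (Inl b) = y $ b" "vec3 x y z $ Inr (Inr c) = z $ c"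
  by (simp_all add: vec3_def)

lemma vec3_eq_iff: "vec3 x y z = vec3 x' y' z' \<longleftrightarrow> x = x' \<and> y = y' \<and> z = z'"
  by (simp add: vec_eq_iff all_sum3)

lemma vec3_cases: obtains x y z where "v = vec3 x y z"
proof -
  have "v = vec3 (\<chi> a. v $ Inl a) (\<chi> b. v $ Inr (Inl b)) (\<chi> c. v $ Inr (Inr c))"
    by (simp add: vec_eq_iff all_sum3)
  then show ?thesis by (rule that)
qed

lemma vec3_0: "vec3 0 0 0 = 0"
  by (simp add: vec_eq_iff all_sum3)

lemma vec3_add: "vec3 x y z + vec3 x' y' z' = vec3 (x + x') (y + y') (z + z')"
  by (simp add: vec_eq_iff all_sum3)

lemma vec3_scaleR: "k *\<^sub>R vec3 x y z = vec3 (k *\<^sub>R x) (k *\<^sub>R y) (k *\<^sub>R z)"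
  by (simp add: vec_eq_iff all_sum3)

lemma sum_UNIV_Plus:
  fixes f :: "'a::finite + 'b::finite \<Rightarrow> 'c::comm_monoid_add"
  shows "sum f UNIV = (\<Sum>a\<in>UNIV. f (Inl a)) + (\<Sum>b\<in>UNIV. f (Inr b))"
  unfolding UNIV_Plus_UNIV[symmetric] by (subst sum.Plus) (simp_all add: comp_def)

lemma block3_vec3:
  fixes x :: "real^'n" and y :: "real^'m" and z :: "real^'l"
  shows "block3 A11 A12 A13 A21 A22 A23 A31 A32 A33 *v vec3 x y z =
    vec3 (A11 *v x + A12 *v y + A13 *v z) (A21 *v x + A22 *v y + A23 *v z) (A31 *v x + A32 *v y + A33 *v z)"
  by (simp add: vec_eq_iff all_sum3 matrix_vector_mult_def block3_def sum_UNIV_Plus add.assoc)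

lemma uminus_matrix_vector: "(- A) *v x = - (A *v (x :: real^'n))"
  by (simp add: matrix_vector_mult_def vec_eq_iff sum_negf)

lemma saddle_matrix_vec3:
  "saddle_matrix A B C D *v vec3 x y z = vec3 (A *v x + y v* B) (B *v x + z v* C) (C *v y + D *v z)"
  by (simp add: saddle_matrix_def block3_vec3)

lemma preconditioner_vec3:
  "preconditioner M_A Sh M_S B C YA ZA WS *v vec3 x y z =
    (let q1 = M_A *v (x + ZA *v (y v* B)); q2 = - (Sh *v (y - WS *v (z v* C)))
     in vec3 q1 (B *v (YA *v q1) + q2) (M_S *v z - C *v (WS *v q2)))"
  by (simp add: preconditioner_def Let_def block3_vec3 uminus_matrix_vector
    flip: matrix_vector_mul_assoc)

locale normalized_saddle =
  fixes A :: "real^'n^'n" and B :: "real^'n^'m" and C :: "real^'m^'l" and D :: "real^'l^'l"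
    and M_A :: "real^'n^'n" and Sh :: "real^'m^'m" and M_S :: "real^'l^'l"
    and P :: "real^'n^'n" and Q :: "real^'m^'m" and R :: "real^'l^'l" and mu :: "'n \<Rightarrow> real"
  assumes PM: "transpose P ** M_A ** P = mat 1" and PA: "transpose P ** A ** P = diag_mat mu"
    and QS: "transpose Q ** Sh ** Q = mat 1" and RM: "transpose R ** M_S ** R = mat 1"
begin

definition "Bn = transpose Q ** B ** P"
definition "Cn = transpose R ** C ** Q"
definition "Dn = transpose R ** D ** R"

lemma Bn: "Bn *v x = (B *v (P *v x)) v* Q" "y v* Bn = ((Q *v y) v* B) v* P"
  unfolding Bn_def by (simp_all flip: matrix_vector_mul_assoc vector_matrix_mul_assoc)
lemma Cn: "Cn *v y = (C *v (Q *v y)) v* R" "z v* Cn = ((R *v z) v* C) v* Q"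
  unfolding Cn_def by (simp_all flip: matrix_vector_mul_assoc vector_matrix_mul_assoc)
lemma Dn: "Dn *v z = (D *v (R *v z)) v* R"
  unfolding Dn_def by (simp flip: matrix_vector_mul_assoc)

lemma norm_vecs:
  "(M_A *v (P *v x)) v* P = x" "(A *v (P *v x)) v* P = dscale mu x"
  "(Sh *v (Q *v y)) v* Q = y" "(M_S *v (R *v z)) v* R = z"
  using arg_cong[OF PM, of "\<lambda>M. M *v x"] arg_cong[OF PA, of "\<lambda>M. M *v x"]
    arg_cong[OF QS, of "\<lambda>M. M *v y"] arg_cong[OF RM, of "\<lambda>M. M *v z"]
  by (simp_all add: diag_mat_vector flip: matrix_vector_mul_assoc)

lemma inverses:
  "matrix_inv M_A = P ** transpose P" "matrix_inv Sh = Q ** transpose Q" "matrix_inv M_S = R ** transpose R"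
  using normalizing_matrix(3)[OF PM] normalizing_matrix(3)[OF QS] normalizing_matrix(3)[OF RM] by auto

lemma inv_vecs: "matrix_inv M_A *v (M_A *v x) = x" "matrix_inv Sh *v (Sh *v y) = y"
  unfolding inverses matrix_vector_mul_assoc normalizing_matrix(4)[OF PM] normalizing_matrix(4)[OF QS]
  by simp_all

text \<open>
  The inverse of the upper triangular factor of the preconditioner, applied after the change of
  bases \<open>P\<close>, \<open>Q\<close>, \<open>R\<close>.
\<close>
definition coords where
  "coords s w x y z = (let yt = y + w *\<^sub>R (z v* Cn) in vec3 (P *v (x - s *\<^sub>R (yt v* Bn))) (Q *v yt) (R *v z))"

lemma coords_cases: obtains x y z where "v = coords s w x y z"
proof -
  obtain v1 v2 v3 where v: "v = vec3 v1 v2 v3" by (rule vec3_cases)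
  have surj: "\<exists>c. u = L *v c" if "invertible L" for L :: "real^'k^'k" and u
    using that by (metis invertible_def matrix_vector_mul_assoc matrix_vector_mul_lid)
  obtain a b c where abc: "v1 = P *v a" "v2 = Q *v b" "v3 = R *v c"
    using surj normalizing_matrix(1)[OF PM] normalizing_matrix(1)[OF QS] normalizing_matrix(1)[OF RM] by metis
  have "v = coords s w (a + s *\<^sub>R (b v* Bn)) (b - w *\<^sub>R (c v* Cn)) c"
    by (simp add: coords_def v abc)
  then show ?thesis by (rule that)
qed

lemma coords_linear:
  "coords s w (k *\<^sub>R x + l *\<^sub>R x') (k *\<^sub>R y + l *\<^sub>R y') (k *\<^sub>R z + l *\<^sub>R z') =
    k *\<^sub>R coords s w x y z + l *\<^sub>R coords s w x' y' z'"
  by (simp add: coords_def Let_def vec3_scaleR vec3_add vec3_eq_iff algebra_simps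
    matrix_vector_mult_scaleR scaleR_vector_matrix_assoc)

lemma coords_0: "coords s w 0 0 0 = 0"
  by (simp add: coords_def vec3_0)

abbreviation "Mx s t w \<equiv> preconditioner M_A Sh M_S B C (t *\<^sub>R matrix_inv M_A) (s *\<^sub>R matrix_inv M_A) (w *\<^sub>R matrix_inv Sh)"

lemma preconditioner_coords:
  "Mx s t w *v coords s w x y z = vec3 (M_A *v (P *v x))
     (t *\<^sub>R (B *v (P *v x)) - Sh *v (Q *v y)) (M_S *v (R *v z) + w *\<^sub>R (C *v (Q *v y)))"
proof -
  define yt where "yt = y + w *\<^sub>R (z v* Cn)"
  have 1: "P *v (x - s *\<^sub>R (yt v* Bn)) + (s *\<^sub>R matrix_inv M_A) *v ((Q *v yt) v* B) = P *v x"
    by (simp add: inverses Bn algebra_simps matrix_vector_mult_scaleR flip: scaleR_matrix_vector_assoc matrix_vector_mul_assoc)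
  have 2: "Q *v yt - (w *\<^sub>R matrix_inv Sh) *v ((R *v z) v* C) = Q *v y"
    by (simp add: yt_def inverses Cn algebra_simps matrix_vector_mult_scaleR flip: scaleR_matrix_vector_assoc matrix_vector_mul_assoc)
  have neg: "L *v (- u) = - (L *v u)" for L :: "real^'i^'j" and u
    using matrix_vector_mult_scaleR[of L "-1" u] by simp
  show ?thesis
    unfolding coords_def Let_def yt_def[symmetric] preconditioner_vec3 1 2
    by (simp add: vec3_eq_iff inv_vecs matrix_vector_mult_scaleR neg flip: scaleR_matrix_vector_assoc)
qed

text \<open>
  After the substitution on the right only the lower triangular factor is left in the preconditioner.
  Testing the three rows with the columns of \<open>P\<close>, \<open>Q\<close>, \<open>R\<close> completes the congruence.
\<close>
lemma pencil_coords:
  assumes "saddle_matrix A B C D *v coords s w x y z = Mx s t w *v coords s w x' y' z'"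
  shows "normal_form_step mu Bn Cn Dn s t w x y z x' y' z'"
proof -
  define yt where "yt = y + w *\<^sub>R (z v* Cn)"
  define b where "b = yt v* Bn"
  define xi where "xi = x - s *\<^sub>R b"
  have "A *v (P *v xi) + (Q *v yt) v* B = M_A *v (P *v x')"
    and "B *v (P *v xi) + (R *v z) v* C = t *\<^sub>R (B *v (P *v x')) - Sh *v (Q *v y')"
    and "C *v (Q *v yt) + D *v (R *v z) = M_S *v (R *v z') + w *\<^sub>R (C *v (Q *v y'))"
    using assms unfolding preconditioner_coords
    by (simp_all add: coords_def saddle_matrix_vec3 vec3_eq_iff Let_def yt_def b_def xi_def)
  then have "(A *v (P *v xi) + (Q *v yt) v* B) v* P = (M_A *v (P *v x')) v* P"
    and "(B *v (P *v xi) + (R *v z) v* C) v* Q = (t *\<^sub>R (B *v (P *v x')) - Sh *v (Q *v y')) v* Q"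
    and "(C *v (Q *v yt) + D *v (R *v z)) v* R = (M_S *v (R *v z') + w *\<^sub>R (C *v (Q *v y'))) v* R"
    by simp_all
  then have 1: "dscale mu xi + b = x'"
    and 2: "Bn *v xi + z v* Cn = t *\<^sub>R (Bn *v x') - y'"
    and 3: "Cn *v yt + Dn *v z = z' + w *\<^sub>R (Cn *v y')"
    by (simp_all add: vector_matrix_left_distrib vector_matrix_mult_diff_distrib scaleR_vector_matrix_assoc
      norm_vecs Bn Cn Dn b_def)
  have "x' = dscale mu x + dscale (\<lambda>i. 1 - s * mu i) b"
    unfolding 1[symmetric] by (simp add: xi_def vec_eq_iff algebra_simps)
  moreover have "y' = t *\<^sub>R (Bn *v x') - Bn *v x + s *\<^sub>R (Bn *v b) - z v* Cn"
    using 2 by (simp add: xi_def matrix_vector_mult_diff_distrib matrix_vector_mult_scaleR algebra_simps)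
  moreover have "z' = Cn *v yt + Dn *v z - w *\<^sub>R (Cn *v y')"
    using 3 by (simp add: algebra_simps)
  ultimately show ?thesis
    unfolding normal_form_step_def Let_def yt_def[symmetric] b_def[symmetric] by blast
qed

lemma invertible_preconditioner: "invertible (Mx s t w)"
proof -
  have "v = 0" if v0: "Mx s t w *v v = 0" for v
  proof -
    obtain x y z where v: "v = coords s w x y z" by (rule coords_cases)
    have e: "M_A *v (P *v x) = 0" "t *\<^sub>R (B *v (P *v x)) - Sh *v (Q *v y) = 0"
        "M_S *v (R *v z) + w *\<^sub>R (C *v (Q *v y)) = 0"
      using v0 unfolding v preconditioner_coords vec3_0[symmetric] vec3_eq_iff by auto
    have "x = 0" using norm_vecs(1)[of x] e(1) by simp
    moreover from this have "y = 0" using norm_vecs(3)[of y] e(2) by simp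
    moreover from this have "z = 0" using norm_vecs(4)[of z] e(3) by simp
    ultimately show ?thesis by (simp add: v coords_0)
  qed
  then show ?thesis
    using matrix_left_invertible_ker invertible_left_inverse by blast
qed

theorem spectrum_bounds_of_normal_form:
  assumes nf: "normal_form_bounds mu Bn Cn Dn s t w lo hi r"
  shows "spectrum_bounds (matrix_inv (Mx s t w) ** saddle_matrix A B C D) lo hi r"
  unfolding spectrum_bounds_def
proof (intro allI impI)
  fix k
  assume "is_eigenvalue (map_matrix complex_of_real (matrix_inv (Mx s t w) ** saddle_matrix A B C D)) k"
  then obtain v v' where
      v: "(matrix_inv (Mx s t w) ** saddle_matrix A B C D) *v v = Re k *\<^sub>R v - Im k *\<^sub>R v'"
    and v': "(matrix_inv (Mx s t w) ** saddle_matrix A B C D) *v v' = Im k *\<^sub>R v + Re k *\<^sub>R v'"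
    and nz: "v \<noteq> 0 \<or> v' \<noteq> 0"
    by (rule complex_eigenvector_real_pair)
  have MM: "Mx s t w *v ((matrix_inv (Mx s t w) ** K) *v u) = K *v u" for K u
    by (simp add: matrix_vector_mul_assoc matrix_mul_assoc matrix_inv_right[OF invertible_preconditioner])
  obtain x y z where c: "v = coords s w x y z" by (rule coords_cases)
  obtain x' y' z' where c': "v' = coords s w x' y' z'" by (rule coords_cases)
  have "saddle_matrix A B C D *v v = Mx s t w *v (Re k *\<^sub>R v + (- Im k) *\<^sub>R v')"
    using arg_cong[OF v, of "\<lambda>u. Mx s t w *v u"] unfolding MM by simp
  then have st: "normal_form_step mu Bn Cn Dn s t w x y z (Re k *\<^sub>R x + (- Im k) *\<^sub>R x')
      (Re k *\<^sub>R y + (- Im k) *\<^sub>R y') (Re k *\<^sub>R z + (- Im k) *\<^sub>R z')"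
    unfolding c c' coords_linear[symmetric] by (rule pencil_coords)
  have "saddle_matrix A B C D *v v' = Mx s t w *v (Im k *\<^sub>R v + Re k *\<^sub>R v')"
    using arg_cong[OF v', of "\<lambda>u. Mx s t w *v u"] unfolding MM by simp
  then have st': "normal_form_step mu Bn Cn Dn s t w x' y' z' (Im k *\<^sub>R x + Re k *\<^sub>R x')
      (Im k *\<^sub>R y + Re k *\<^sub>R y') (Im k *\<^sub>R z + Re k *\<^sub>R z')"
    unfolding c c' coords_linear[symmetric] by (rule pencil_coords)
  have "\<not> (x = 0 \<and> y = 0 \<and> z = 0 \<and> x' = 0 \<and> y' = 0 \<and> z' = 0)"
    using nz coords_0 unfolding c c' by auto
  then show "lo \<le> Re k \<and> Re k \<le> hi \<and> \<bar>Im k\<bar> \<le> sqrt r"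
    using nf st st' unfolding normal_form_bounds_def by (simp only: scaleR_minus_left add_uminus_conv_diff) blast
qed

text \<open>
  The quadratic forms of \<open>S\<close>, \<open>C Sh\<^sup>-\<^sup>1 C\<^sup>T\<close> and \<open>D\<close> are computed in the new coordinates, and the
  Rayleigh bounds for the respective pencils are read off.
\<close>
theorem normal_data_of_saddle:
  assumes A: "spd A" and D: "spsd D" and M_A: "spd M_A" and Sh: "spd Sh" and M_S: "spd M_S"
    and S: "S = B ** matrix_inv A ** transpose B" and G: "G = C ** matrix_inv Sh ** transpose C"
  shows "normal_data mu Bn Cn Dn (lambda_min (matrix_inv M_A ** A)) (lambda_max (matrix_inv M_A ** A))
    (lambda_min (matrix_inv Sh ** S)) (lambda_max (matrix_inv Sh ** S))
    (lambda_min (matrix_inv M_S ** G)) (lambda_max (matrix_inv M_S ** G))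
    (lambda_min (matrix_inv M_S ** D)) (lambda_max (matrix_inv M_S ** D))
    (lambda_min (matrix_inv M_S ** (D + G))) (lambda_max (matrix_inv M_S ** (D + G)))"
proof -
  note PD = normalizing_matrix(1)[OF PM] pencil_diagonalizable[OF PM PA]
  have Dsym: "transpose D = D" and Dnn: "\<And>x. 0 \<le> x \<bullet> (D *v x)"
    using D by (auto simp: spsd_def)
  have Ssym: "transpose S = S"
    unfolding S by (intro symmetric_sandwich symmetric_matrix_inv spd_symmetric A spd_invertible)
  have Gsym: "transpose G = G"
    unfolding G by (intro symmetric_sandwich symmetric_matrix_inv spd_symmetric Sh spd_invertible)
  have DGsym: "transpose (D + G) = D + G"
    using Dsym Gsym by (simp add: transpose_def vec_eq_iff)
  have normM: "(Q *v y) \<bullet> (Sh *v (Q *v y)) = (norm y)\<^sup>2" "(R *v z) \<bullet> (M_S *v (R *v z)) = (norm z)\<^sup>2" for y z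
    by (simp_all add: transpose_congruence_inner QS RM power2_norm_eq_inner)
  have mu_pos: "0 < mu i" for i
    using lambda_min_pos[OF M_A A] lambda_min_le_diag[OF PD, of i] by linarith
  have S_form: "(Q *v y) \<bullet> (S *v (Q *v y)) = (\<Sum>i\<in>UNIV. ((y v* Bn) $ i)\<^sup>2 / mu i)" for y
  proof -
    define b where "b = (Q *v y) v* B"
    obtain c where c: "matrix_inv A *v b = P *v c"
      using PD(1) by (metis invertible_def matrix_vector_mul_assoc matrix_vector_mul_lid)
    have b: "b = A *v (P *v c)"
      unfolding c[symmetric] by (simp add: matrix_vector_mul_assoc matrix_inv_right[OF spd_invertible[OF A]])
    have "y v* Bn = dscale mu c"
      unfolding Bn(2) b_def[symmetric] unfolding b by (rule norm_vecs(2))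
    then have "(\<Sum>i\<in>UNIV. ((y v* Bn) $ i)\<^sup>2 / mu i) = (\<Sum>i\<in>UNIV. mu i * (c $ i)\<^sup>2)"
      using mu_pos[THEN less_imp_neq] by (simp add: power_mult_distrib power2_eq_square[of "mu _"])
    moreover have "(Q *v y) \<bullet> (S *v (Q *v y)) = b \<bullet> (P *v c)"
      unfolding S sandwich_inner b_def[symmetric] c ..
    moreover have "b \<bullet> (P *v c) = (P *v c) \<bullet> (A *v (P *v c))"
      unfolding b by (rule inner_commute)
    moreover have "\<dots> = (\<Sum>i\<in>UNIV. mu i * (c $ i)\<^sup>2)"
      unfolding transpose_congruence_inner PA
      by (simp add: diag_mat_vector inner_vec_def power2_eq_square algebra_simps)
    ultimately show ?thesis by simp
  qed
  have G_eq: "z \<bullet> (G *v z) = (norm ((z v* C) v* Q))\<^sup>2" for z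
    unfolding G sandwich_inner inverses
    by (simp add: dot_lmul_matrix power2_norm_eq_inner flip: matrix_vector_mul_assoc)
  have G_form: "(R *v z) \<bullet> (G *v (R *v z)) = (norm (z v* Cn))\<^sup>2" for z
    unfolding G_eq Cn(2) ..
  have D_form: "(R *v z) \<bullet> (D *v (R *v z)) = z \<bullet> (Dn *v z)" for z
    by (simp add: transpose_congruence_inner Dn_def)
  have Snn: "0 \<le> y \<bullet> (S *v y)" for y
  proof -
    obtain y' where "y = Q *v y'"
      using normalizing_matrix(1)[OF QS] by (metis invertible_def matrix_vector_mul_assoc matrix_vector_mul_lid)
    then show ?thesis
      using mu_pos by (auto simp: S_form intro!: sum_nonneg divide_nonneg_pos)
  qed
  have Gnn: "0 \<le> z \<bullet> (G *v z)" for z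
    by (simp add: G_eq)
  have DGnn: "0 \<le> z \<bullet> ((D + G) *v z)" for z
    using Gnn[of z] Dnn[of z] by (simp add: matrix_vector_mult_add_rdistrib inner_add_right)
  have DG_form: "(R *v z) \<bullet> ((D + G) *v (R *v z)) = z \<bullet> (Dn *v z) + (norm (z v* Cn))\<^sup>2" for z
    by (simp add: matrix_vector_mult_add_rdistrib inner_add_right D_form G_form)
  show ?thesis
  proof
    show "transpose Dn = Dn"
      unfolding Dn_def by (simp only: matrix_transpose_mul transpose_transpose Dsym matrix_mul_assoc)
    show "\<exists>i. mu i = lambda_min (matrix_inv M_A ** A)"
      using lambda_min_attained[OF PD] by metis
  qed (use rayleigh_bounds[OF Sh Ssym, of "Q *v _"] rayleigh_bounds[OF M_S Gsym, of "R *v _"]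
        rayleigh_bounds[OF M_S Dsym, of "R *v _"] rayleigh_bounds[OF M_S DGsym, of "R *v _"] in
     \<open>simp_all add: lambda_min_pos[OF M_A A] lambda_min_le_diag[OF PD] diag_le_lambda_max[OF PD]
      lambda_min_nonneg[OF Sh Ssym Snn] lambda_min_nonneg[OF M_S Gsym Gnn]
      lambda_min_nonneg[OF M_S Dsym Dnn] lambda_min_nonneg[OF M_S DGsym DGnn]
      lambda_min_le_max[OF Sh Ssym] lambda_min_le_max[OF M_S Gsym]
      lambda_min_le_max[OF M_S Dsym] lambda_min_le_max[OF M_S DGsym]
      normM S_form G_form D_form DG_form\<close>)
qed

lemma spectral_functions_le:
  "mu i * (1 - mu i) \<le> lambda_max ((matrix_inv M_A ** A) ** (mat 1 - matrix_inv M_A ** A))"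
  "(1 - mu i)\<^sup>2 * mu i \<le> lambda_max ((mat 1 - matrix_inv M_A ** A) ** (mat 1 - matrix_inv M_A ** A) ** (matrix_inv M_A ** A))"
proof -
  note N = pencil_diagonalizable[OF PM PA]
  note N1 = diagonalizable_one_minus[OF N]
  note inv = normalizing_matrix(1)[OF PM]
  show "mu i * (1 - mu i) \<le> lambda_max ((matrix_inv M_A ** A) ** (mat 1 - matrix_inv M_A ** A))"
    by (rule diag_le_lambda_max[OF inv diagonalizable_mult[OF N N1]])
  show "(1 - mu i)\<^sup>2 * mu i \<le> lambda_max ((mat 1 - matrix_inv M_A ** A) ** (mat 1 - matrix_inv M_A ** A) ** (matrix_inv M_A ** A))"
    using diag_le_lambda_max[OF inv diagonalizable_mult[OF diagonalizable_mult[OF N1 N1] N], of i]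
    by (simp add: power2_eq_square)
qed

end

section \<open>Transposing the preconditioner\<close>

lemma singular_transpose:
  fixes E :: "'a::field^'k^'k"
  assumes "E *v v = 0" "v \<noteq> 0"
  shows "\<exists>u. u \<noteq> 0 \<and> transpose E *v u = 0"
proof (rule ccontr)
  assume "\<not> ?thesis"
  then obtain F where "F ** transpose E = mat 1"
    using matrix_left_invertible_ker by blast
  then have "E ** transpose F = mat 1"
    by (metis matrix_transpose_mul transpose_mat transpose_transpose)
  then have "transpose F ** E = mat 1"
    using matrix_left_right_inverse by blast
  then have "v = 0"
    using assms(1) by (metis matrix_vector_mul_assoc matrix_vector_mul_lid matrix_vector_mult_0_right)
  then show False using assms(2) by blast
qed

lemma map_matrix_of_real_mult:
  fixes X :: "real^'k^'j" and Y :: "real^'i^'k"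
  shows "map_matrix complex_of_real (X ** Y) = map_matrix complex_of_real X ** map_matrix complex_of_real Y"
  by (simp add: vec_eq_iff matrix_matrix_mult_def)

text \<open>
  The pencil \<open>K - k M\<close>, unlike \<open>M\<^sup>-\<^sup>1 K\<close>, behaves well under transposition.
\<close>
lemma pencil_eigenvalue_iff:
  fixes K M :: "real^'k^'k"
  assumes M: "invertible M"
  defines "c \<equiv> map_matrix complex_of_real"
  shows "is_eigenvalue (c (matrix_inv M ** K)) k \<longleftrightarrow> (\<exists>v. v \<noteq> 0 \<and> (\<chi> i j. c K $ i $ j - k * c M $ i $ j) *v v = 0)"
proof -
  have inv: "c (matrix_inv M) ** c M = mat 1" "c M ** c (matrix_inv M) = mat 1"
    unfolding c_def map_matrix_of_real_mult[symmetric] matrix_inv_left[OF M] matrix_inv_right[OF M]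
    by (simp_all add: vec_eq_iff mat_def)
  have E: "(\<chi> i j. c K $ i $ j - k * c M $ i $ j) *v v = c K *v v - k *s (c M *v v)" for v
    by (simp add: vec_eq_iff matrix_vector_mult_def sum_subtractf sum_distrib_left left_diff_distrib mult.assoc)
  have "c (matrix_inv M ** K) *v v = k *s v \<longleftrightarrow> c K *v v = k *s (c M *v v)" for v
  proof
    assume "c (matrix_inv M ** K) *v v = k *s v"
    then have "c M *v (c (matrix_inv M) *v (c K *v v)) = c M *v (k *s v)"
      by (simp add: c_def map_matrix_of_real_mult matrix_vector_mul_assoc)
    then show "c K *v v = k *s (c M *v v)"
      by (simp add: matrix_vector_mul_assoc[of "c M"] inv vector_scalar_commute)
  next
    assume "c K *v v = k *s (c M *v v)"
    then have "c (matrix_inv M) *v (c K *v v) = k *s (c (matrix_inv M) *v (c M *v v))"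
      by (simp add: vector_scalar_commute)
    then show "c (matrix_inv M ** K) *v v = k *s v"
      by (simp add: matrix_vector_mul_assoc inv c_def map_matrix_of_real_mult)
        (simp add: inv flip: c_def)
  qed
  then show ?thesis
    unfolding is_eigenvalue_def E by simp
qed

text \<open>
  For symmetric \<open>K\<close> the pencils of \<open>M\<close> and of its transpose are transposes of each other and are singular
  at the same points. This relates \<open>ut\<close> to \<open>lt\<close> and \<open>f3\<close> to \<open>f4\<close>.
\<close>
lemma spectrum_bounds_transpose:
  fixes K M :: "real^'k^'k"
  assumes M: "invertible M" and K: "transpose K = K" and b: "spectrum_bounds (matrix_inv M ** K) lo hi r"
  shows "spectrum_bounds (matrix_inv (transpose M) ** K) lo hi r"
  unfolding spectrum_bounds_def
proof (intro allI impI)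
  fix k assume k: "is_eigenvalue (map_matrix complex_of_real (matrix_inv (transpose M) ** K)) k"
  let ?c = "map_matrix complex_of_real"
  have "invertible (transpose M)"
    using M by (rule transpose_invertible)
  then obtain v where "v \<noteq> 0" "(\<chi> i j. ?c K $ i $ j - k * ?c (transpose M) $ i $ j) *v v = 0"
    using k unfolding pencil_eigenvalue_iff[OF \<open>invertible (transpose M)\<close>] by blast
  then obtain u where u: "u \<noteq> 0" "transpose (\<chi> i j. ?c K $ i $ j - k * ?c (transpose M) $ i $ j) *v u = 0"
    using singular_transpose by blast
  have tr: "transpose (\<chi> i j. ?c K $ i $ j - k * ?c (transpose M) $ i $ j) = (\<chi> i j. ?c K $ i $ j - k * ?c M $ i $ j)"
    (is "?L = ?R")
  proof -
    have "K $ j $ i = K $ i $ j" for i j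
      using arg_cong[OF K, of "\<lambda>X. X $ i $ j"] unfolding transpose_def by simp
    then have "?L $ i $ j = ?R $ i $ j" for i j
      unfolding transpose_def by simp
    then show ?thesis
      unfolding vec_eq_iff by blast
  qed
  have "is_eigenvalue (?c (matrix_inv M ** K)) k"
    unfolding pencil_eigenvalue_iff[OF M] using u(1) u(2)[unfolded tr] by blast
  then show "lo \<le> Re k \<and> Re k \<le> hi \<and> \<bar>Im k\<bar> \<le> sqrt r"
    using b unfolding spectrum_bounds_def by blast
qed

lemma transpose_block3:
  "transpose (block3 A11 A12 A13 A21 A22 A23 A31 A32 A33) =
    block3 (transpose A11) (transpose A21) (transpose A31) (transpose A12) (transpose A22) (transpose A32)
      (transpose A13) (transpose A23) (transpose A33)"
  by (simp add: vec_eq_iff all_sum3 transpose_def block3_def)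

lemma transpose_minus: "transpose (- X) = - transpose (X :: real^'i^'j)"
  by (simp add: transpose_def vec_eq_iff)

lemma transpose_zero: "transpose 0 = (0 :: real^'i^'j)"
  by (simp add: transpose_def vec_eq_iff)

lemma symmetric_saddle_matrix:
  "transpose A = A \<Longrightarrow> transpose D = D \<Longrightarrow> transpose (saddle_matrix A B C D) = saddle_matrix A B C D"
  by (simp only: saddle_matrix_def transpose_block3 transpose_zero transpose_transpose)

lemma transpose_preconditioner:
  assumes "transpose M_A = M_A" "transpose Sh = Sh" "transpose M_S = M_S"
    "transpose YA = YA" "transpose ZA = ZA" "transpose WS = WS"
  shows "transpose (preconditioner M_A Sh M_S B C YA ZA WS) = preconditioner M_A Sh M_S B C ZA YA WS"
  by (simp only: preconditioner_def matrix_transpose_mul transpose_block3 transpose_zero transpose_transpose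
    transpose_minus transpose_mat assms matrix_mul_assoc)

section \<open>Bounds for the spectra of the preconditioned matrices\<close>

theorem theorem5p1:
  fixes A :: "real^'n^'n" and B :: "real^'n^'m" and C :: "real^'m^'l" and D :: "real^'l^'l"
    and M_A :: "real^'n^'n" and Sh :: "real^'m^'m" and M_S :: "real^'l^'l"
    and S :: "real^'m^'m" and N :: "real^'n^'n" and K :: "real^('n + 'm + 'l)^('n + 'm + 'l)"
    and M :: "real^'n^'n \<Rightarrow> real^'n^'n \<Rightarrow> real^'m^'m \<Rightarrow> real^('n + 'm + 'l)^('n + 'm + 'l)"
    and mu_min mu_max nu_min nu_max omega_min omega_max tau_min tau_max theta_min theta_max
      delta_min delta_max xi1 xi2 xi3 xi4 :: real
    and h_lo h_hi :: "real \<Rightarrow> real"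
  assumes "spd A" and "rank B = CARD('m)" and "CARD('m) \<le> CARD('n)"
    and "spsd D" and "\<not> spd D \<longrightarrow> rank C = CARD('l)"
    and "spd M_A" and "spd Sh" and "spd M_S"
    and "K = saddle_matrix A B C D"
    and "S = B ** matrix_inv A ** transpose B"
    and "M = preconditioner M_A Sh M_S B C"
    and "N = matrix_inv M_A ** A"
    and "mu_min = lambda_min N" and "mu_max = lambda_max N"
    and "nu_min = lambda_min (matrix_inv Sh ** S)" and "nu_max = lambda_max (matrix_inv Sh ** S)"
    and "omega_min = lambda_min (matrix_inv M_S ** C ** matrix_inv Sh ** transpose C)"
    and "omega_max = lambda_max (matrix_inv M_S ** C ** matrix_inv Sh ** transpose C)"
    and "tau_min = lambda_min (matrix_inv M_S ** D)" and "tau_max = lambda_max (matrix_inv M_S ** D)"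
    and "theta_min = lambda_min (matrix_inv M_S ** (D + C ** matrix_inv Sh ** transpose C))"
    and "theta_max = lambda_max (matrix_inv M_S ** (D + C ** matrix_inv Sh ** transpose C))"
    and "delta_min = Min {mu_min * (2 - mu_min), mu_max * (2 - mu_max)}"
    and "delta_max = Max {mu_min * (2 - mu_min), mu_max * (2 - mu_max), 1}"
    and "h_lo = h_fun theta_min tau_min omega_min" and "h_hi = h_fun theta_max tau_max omega_max"
    and "xi1 = nu_max - nu_max / mu_max"
    and "xi2 = omega_max * nu_max / mu_min"
    and "xi3 = (1 - mu_min) * xi2"
    and "xi4 = (1 - delta_min) * xi2"
    and "0 < mu_max" and "mu_max \<le> 2" and "0 < nu_max" and "nu_max \<le> 2"
    and "0 < mu_max * nu_max" and "mu_max * nu_max < 2"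
  shows
    "(spectrum_bounds (matrix_inv (M 0 0 0) ** K)
        0
        (Max {mu_max, tau_max})
        (omega_max + nu_max * mu_max)) \<and>
     (\<forall>P \<in> {M 0 (matrix_inv M_A) 0, M (matrix_inv M_A) 0 0}.
        (mu_max \<le> 1 \<longrightarrow>
           spectrum_bounds (matrix_inv P ** K)
             (Min {mu_min, tau_min, mu_min * nu_min})
             (Max {mu_max, tau_max, mu_max * nu_max})
             (omega_max + nu_max * lambda_max (N ** (mat 1 - N)))) \<and>
        (mu_min \<ge> 1 \<longrightarrow>
           spectrum_bounds (matrix_inv P ** K)
             (Min {mu_min * g1 xi1, nu_min * g1 xi1, tau_min})
             (Max {mu_max * g2 xi1, nu_max * g2 xi1, tau_max})
             omega_max) \<and>
        (mu_min < 1 \<and> 1 < mu_max \<longrightarrow>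
           spectrum_bounds (matrix_inv P ** K)
             (Min {mu_min, tau_min, g1 xi1, mu_min * nu_min * g1 xi1})
             (Max {tau_max, mu_max * g2 xi1, nu_max * g2 xi1})
             (omega_max + nu_max * lambda_max (N ** (mat 1 - N))))) \<and>
     (spectrum_bounds (matrix_inv (M (matrix_inv M_A) (matrix_inv M_A) 0) ** K)
        (Min {mu_min, tau_min, delta_min * nu_min})
        (Max {mu_max, tau_max, delta_max * nu_max})
        (omega_max + nu_max * lambda_max ((mat 1 - N) ** (mat 1 - N) ** N))) \<and>
     (spectrum_bounds (matrix_inv (M 0 0 (matrix_inv Sh)) ** K)
        0
        (Max {mu_max, h_hi nu_max + omega_max * (1 - nu_min)} * g2 xi2)
        (omega_max + nu_max * mu_max)) \<and>
     (\<forall>P \<in> {M 0 (matrix_inv M_A) (matrix_inv Sh), M (matrix_inv M_A) 0 (matrix_inv Sh)}.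
        (mu_max \<le> 1 \<longrightarrow>
           spectrum_bounds (matrix_inv P ** K)
             (Min {mu_min, h_lo nu_max + omega_min * (1 - nu_max), mu_min * nu_min / g1 xi3} * g1 xi3)
             (Max {mu_max, h_hi nu_max + omega_max * (1 - nu_min), mu_max * nu_max / g2 xi3} * g2 xi3)
             (omega_max * varrho (mu_max * nu_max) (mu_min * nu_min)
                + nu_max * lambda_max (N ** (mat 1 - N)))) \<and>
        (mu_min \<ge> 1 \<longrightarrow>
           spectrum_bounds (matrix_inv P ** K)
             (Min {mu_min * g1 xi1, nu_min * g1 xi1,
                   h_lo (mu_max * nu_max) + omega_min * (1 - mu_max * nu_max)})
             (Max {mu_max * g2 xi1, nu_max * g2 xi1,
                   h_hi (mu_max * nu_max) + omega_max * (1 - mu_min * nu_min)})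
             (omega_max * (nu_max * mu_max * (mu_max - 1)
                + varrho (mu_max * nu_max) (mu_min * nu_min)))) \<and>
        (mu_min < 1 \<and> 1 < mu_max \<longrightarrow>
           spectrum_bounds (matrix_inv P ** K)
             (Min {mu_min, h_lo (mu_max * nu_max) + omega_min * (1 - mu_max * nu_max),
                   g1 xi1 / g1 xi3, mu_min * nu_min * g1 xi1 / g1 xi3} * g1 xi3)
             (Max {1, h_hi (mu_max * nu_max) + omega_max * (1 - nu_min),
                   mu_max * g2 xi1 / g2 xi3, nu_max * g2 xi1 / g2 xi3} * g2 xi3)
             (omega_max * (nu_max * mu_max * (mu_max - 1)
                + varrho (mu_max * nu_max) (mu_min * nu_min))
                + nu_max * lambda_max (N ** (mat 1 - N))))) \<and>
     (spectrum_bounds (matrix_inv (M (matrix_inv M_A) (matrix_inv M_A) (matrix_inv Sh)) ** K)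
        (Min {mu_min, h_lo nu_max + omega_min * (1 - nu_max), delta_min * nu_min / g1 xi4} * g1 xi4)
        (Max {mu_max, h_hi nu_max + omega_max * (1 - nu_min), delta_max * nu_max / g2 xi4} * g2 xi4)
        (omega_max * varrho (delta_max * nu_max) (delta_min * nu_min)
           + nu_max * lambda_max ((mat 1 - N) ** (mat 1 - N) ** N)))"
proof -
  obtain P :: "real^'n^'n" and mu where P: "transpose P ** M_A ** P = mat 1" "transpose P ** A ** P = diag_mat mu"
    by (rule simultaneous_diagonalization_diag_mat[OF \<open>spd M_A\<close> spd_symmetric[OF \<open>spd A\<close>]])
  obtain Q :: "real^'m^'m" and d where Q: "transpose Q ** Sh ** Q = mat 1" "transpose Q ** Sh ** Q = diag_mat d"
    by (rule simultaneous_diagonalization_diag_mat[OF \<open>spd Sh\<close> spd_symmetric[OF \<open>spd Sh\<close>]])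
  obtain R :: "real^'l^'l" and d' where R: "transpose R ** M_S ** R = mat 1" "transpose R ** M_S ** R = diag_mat d'"
    by (rule simultaneous_diagonalization_diag_mat[OF \<open>spd M_S\<close> spd_symmetric[OF \<open>spd M_S\<close>]])
  interpret ns: normalized_saddle A B C D M_A Sh M_S P Q R mu
    by unfold_locales (fact P Q R)+
  define G where "G = C ** matrix_inv Sh ** transpose C"
  have om: "matrix_inv M_S ** C ** matrix_inv Sh ** transpose C = matrix_inv M_S ** G"
    by (simp only: G_def matrix_mul_assoc)
  interpret nd: normal_data mu ns.Bn ns.Cn ns.Dn mu_min mu_max nu_min nu_max omega_min omega_max
      tau_min tau_max theta_min theta_max
    using ns.normal_data_of_saddle[OF \<open>spd A\<close> \<open>spsd D\<close> \<open>spd M_A\<close> \<open>spd Sh\<close> \<open>spd M_S\<close> assms(10) G_def]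
    unfolding assms(12-22) om G_def[symmetric] .
  let ?MAi = "matrix_inv M_A" and ?Shi = "matrix_inv Sh"
  have transfer: "spectrum_bounds (matrix_inv (M (t *\<^sub>R ?MAi) (s *\<^sub>R ?MAi) (w *\<^sub>R ?Shi)) ** K) lo hi r"
    if "nd.nf_bounds s t w lo hi r" for s t w lo hi r
    unfolding \<open>M = _\<close> \<open>K = _\<close> using that by (rule ns.spectrum_bounds_of_normal_form)
  have transfer_lower: "\<forall>P \<in> {M 0 ?MAi (w *\<^sub>R ?Shi), M ?MAi 0 (w *\<^sub>R ?Shi)}. spectrum_bounds (matrix_inv P ** K) lo hi r"
    if nf: "nd.nf_bounds 0 1 w lo hi r" for w lo hi r
  proof -
    have sym: "transpose M_A = M_A" "transpose Sh = Sh" "transpose M_S = M_S"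
      using \<open>spd M_A\<close> \<open>spd Sh\<close> \<open>spd M_S\<close> by (simp_all add: spd_symmetric)
    have isym: "transpose ?MAi = ?MAi" "transpose (w *\<^sub>R ?Shi) = w *\<^sub>R ?Shi"
      using \<open>spd M_A\<close> \<open>spd Sh\<close> by (simp_all add: sym symmetric_matrix_inv spd_invertible transpose_scalar)
    have 1: "spectrum_bounds (matrix_inv (M ?MAi 0 (w *\<^sub>R ?Shi)) ** K) lo hi r"
      using transfer[OF nf] by simp
    have inv: "invertible (M ?MAi 0 (w *\<^sub>R ?Shi))"
      using ns.invertible_preconditioner[where s = 0 and t = 1 and w = w] by (simp add: \<open>M = _\<close>)
    have tr: "transpose (M ?MAi 0 (w *\<^sub>R ?Shi)) = M 0 ?MAi (w *\<^sub>R ?Shi)"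
      unfolding \<open>M = _\<close> by (rule transpose_preconditioner[OF sym isym(1) transpose_zero isym(2)])
    have K: "transpose K = K"
      unfolding \<open>K = _\<close> using \<open>spd A\<close> \<open>spsd D\<close>
      by (intro symmetric_saddle_matrix) (simp_all add: spd_def spsd_def)
    from spectrum_bounds_transpose[OF inv K 1] show ?thesis
      unfolding tr using 1 by simp
  qed
  have L: "mu i * (1 - mu i) \<le> lambda_max (N ** (mat 1 - N))"
    "(1 - mu i)\<^sup>2 * mu i \<le> lambda_max ((mat 1 - N) ** (mat 1 - N) ** N)" for i
    unfolding \<open>N = _\<close> by (rule ns.spectral_functions_le)+
  have delta: "delta_min = min (mu_min * (2 - mu_min)) (mu_max * (2 - mu_max))"
    "delta_max = max (mu_min * (2 - mu_min)) (max (mu_max * (2 - mu_max)) 1)"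
    by (simp_all add: \<open>delta_min = _\<close> \<open>delta_max = _\<close>)
  have munu: "mu_max * nu_max \<le> 2"
    using \<open>mu_max * nu_max < 2\<close> by simp
  note xi = \<open>xi1 = _\<close> \<open>xi3 = _\<close>[unfolded \<open>xi2 = _\<close>] \<open>xi4 = _\<close>[unfolded \<open>xi2 = _\<close>]
  note h = \<open>h_lo = _\<close> \<open>h_hi = _\<close>
  have d: "spectrum_bounds (matrix_inv (M 0 0 0) ** K) 0 (Max {mu_max, tau_max}) (omega_max + nu_max * mu_max)"
    using transfer[OF nd.bounds_d] by simp
  have f1: "spectrum_bounds (matrix_inv (M ?MAi ?MAi 0) ** K)
      (Min {mu_min, tau_min, delta_min * nu_min}) (Max {mu_max, tau_max, delta_max * nu_max})
      (omega_max + nu_max * lambda_max ((mat 1 - N) ** (mat 1 - N) ** N))"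
    using transfer[OF nd.bounds_f1_f5(1)[OF \<open>mu_max \<le> 2\<close> L(2) delta]] by simp
  have f2: "spectrum_bounds (matrix_inv (M 0 0 ?Shi) ** K) 0
      (Max {mu_max, h_hi nu_max + omega_max * (1 - nu_min)} * g2 xi2) (omega_max + nu_max * mu_max)"
    using transfer[OF nd.bounds_f2[OF \<open>nu_max \<le> 2\<close>]] by (simp add: h \<open>xi2 = _\<close>)
  have f5: "spectrum_bounds (matrix_inv (M ?MAi ?MAi ?Shi) ** K)
      (Min {mu_min, h_lo nu_max + omega_min * (1 - nu_max), delta_min * nu_min / g1 xi4} * g1 xi4)
      (Max {mu_max, h_hi nu_max + omega_max * (1 - nu_min), delta_max * nu_max / g2 xi4} * g2 xi4)
      (omega_max * varrho (delta_max * nu_max) (delta_min * nu_min)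
         + nu_max * lambda_max ((mat 1 - N) ** (mat 1 - N) ** N))"
    using transfer[OF nd.bounds_f1_f5(2)[OF \<open>mu_max \<le> 2\<close> L(2) delta \<open>nu_max \<le> 2\<close> xi(3)]] by (simp add: h)
  have lt: "mu_max \<le> 1 \<Longrightarrow> \<forall>P \<in> {M 0 ?MAi 0, M ?MAi 0 0}. spectrum_bounds (matrix_inv P ** K)
             (Min {mu_min, tau_min, mu_min * nu_min})
             (Max {mu_max, tau_max, mu_max * nu_max})
             (omega_max + nu_max * lambda_max (N ** (mat 1 - N)))"
    "mu_min \<ge> 1 \<Longrightarrow> \<forall>P \<in> {M 0 ?MAi 0, M ?MAi 0 0}. spectrum_bounds (matrix_inv P ** K)
             (Min {mu_min * g1 xi1, nu_min * g1 xi1, tau_min})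
             (Max {mu_max * g2 xi1, nu_max * g2 xi1, tau_max})
             omega_max"
    "mu_min < 1 \<Longrightarrow> 1 < mu_max \<Longrightarrow> \<forall>P \<in> {M 0 ?MAi 0, M ?MAi 0 0}. spectrum_bounds (matrix_inv P ** K)
             (Min {mu_min, tau_min, g1 xi1, mu_min * nu_min * g1 xi1})
             (Max {tau_max, mu_max * g2 xi1, nu_max * g2 xi1})
             (omega_max + nu_max * lambda_max (N ** (mat 1 - N)))"
    using transfer_lower[OF nd.bounds_lt_le_1[OF _ L(1)]] transfer_lower[OF nd.bounds_lt_ge_1[OF _ xi(1)]]
      transfer_lower[OF nd.bounds_lt_mixed[OF _ _ xi(1) L(1)]]
    by simp_all
  have f4: "mu_max \<le> 1 \<Longrightarrow> \<forall>P \<in> {M 0 ?MAi ?Shi, M ?MAi 0 ?Shi}. spectrum_bounds (matrix_inv P ** K)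
             (Min {mu_min, h_lo nu_max + omega_min * (1 - nu_max), mu_min * nu_min / g1 xi3} * g1 xi3)
             (Max {mu_max, h_hi nu_max + omega_max * (1 - nu_min), mu_max * nu_max / g2 xi3} * g2 xi3)
             (omega_max * varrho (mu_max * nu_max) (mu_min * nu_min)
                + nu_max * lambda_max (N ** (mat 1 - N)))"
    "mu_min \<ge> 1 \<Longrightarrow> \<forall>P \<in> {M 0 ?MAi ?Shi, M ?MAi 0 ?Shi}. spectrum_bounds (matrix_inv P ** K)
             (Min {mu_min * g1 xi1, nu_min * g1 xi1,
                   h_lo (mu_max * nu_max) + omega_min * (1 - mu_max * nu_max)})
             (Max {mu_max * g2 xi1, nu_max * g2 xi1,
                   h_hi (mu_max * nu_max) + omega_max * (1 - mu_min * nu_min)})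
             (omega_max * (nu_max * mu_max * (mu_max - 1)
                + varrho (mu_max * nu_max) (mu_min * nu_min)))"
    "mu_min < 1 \<Longrightarrow> 1 < mu_max \<Longrightarrow> \<forall>P \<in> {M 0 ?MAi ?Shi, M ?MAi 0 ?Shi}. spectrum_bounds (matrix_inv P ** K)
             (Min {mu_min, h_lo (mu_max * nu_max) + omega_min * (1 - mu_max * nu_max),
                   g1 xi1 / g1 xi3, mu_min * nu_min * g1 xi1 / g1 xi3} * g1 xi3)
             (Max {1, h_hi (mu_max * nu_max) + omega_max * (1 - nu_min),
                   mu_max * g2 xi1 / g2 xi3, nu_max * g2 xi1 / g2 xi3} * g2 xi3)
             (omega_max * (nu_max * mu_max * (mu_max - 1)
                + varrho (mu_max * nu_max) (mu_min * nu_min))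
                + nu_max * lambda_max (N ** (mat 1 - N)))"
    using transfer_lower[OF nd.bounds_f4_le_1[OF _ L(1) \<open>nu_max \<le> 2\<close> xi(2)]]
      transfer_lower[OF nd.bounds_f4_ge_1[OF _ xi(1) munu]]
      transfer_lower[OF nd.bounds_f4_mixed[OF _ _ xi(1) munu L(1) xi(2)]]
    by (simp_all add: h)
  show ?thesis
    using d f1 f2 f5 lt f4 by blast
qed

end
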